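(* The map $j\colon\mathcal{R}(N_1,\ell)\to\mathcal{R}[[N_1,\ell]]$ is not injective in general: for any root $\beta\neq\alpha$ in $\Phi^+$, the element $\log(n_\beta)=\log(1+b_\beta)\in D(N_1,K)\subset\mathcal{R}(N_1,\ell)$ lies in the kernel of $j$.
   Context: Setting. $G$ is the group of $\mathbb{Q}_p$-points of a $\mathbb{Q}_p$-split connected reductive group with connected centre, $P=TN$ a Borel subgroup with split maximal torus $T$ and unipotent radical $N$, $\Phi^+\supseteq\Delta$ the positive and simple roots, $N_\beta$ the root subgroups. $N_0\subseteq N$ is a compact open subgroup with $N_0=\prod_{\beta\in\Phi^+}(N_0\cap N_\beta)$ for any ordering of $\Phi^+$, assumed to be a uniform pro-$p$ group. $T_+=\{t\in T\mid tN_0t^{-1}\subseteq N_0\}$. Fix $\alpha\in\Delta$ and $\iota_\alpha\colon N_\alpha\cong\mathbb{Q}_p$ with $\iota_\alpha(tnt^{-1})=\alpha(t)\iota_\alpha(n)$ and $\iota_\alpha(N_0\cap N_\alpha)=\mathbb{Z}_p$; $\ell\colon N\to N/[N,N]\to\prod_{\beta\in\Delta}N_\beta\to N_\alpha\cong\mathbb{Q}_p$; $N_1=\ker(\ell|_{N_0})$; $\iota=\iota_\alpha^{-1}\colon\mathbb{Z}_p\to N_0$. Fix $\xi\in X_*(T)$ with $\beta\circ\xi=\mathrm{id}$ for all $\beta\in\Delta$, $s=\xi(p)$. For $t\in T_+$ let $\varphi_t(n)=tnt^{-1}$ on $N_0$, $\varphi=\varphi_s$. Choose topological generators $n_\beta$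 of $N_0\cap N_\beta$ with $\ell(n_\alpha)=1$; $b_\beta:=n_\beta-1$; $\mathbf{b}^{\mathbf{k}}=\prod_\beta b_\beta^{k_\beta}$ in a fixed order with $b_\alpha$ leftmost. $K/\mathbb{Q}_p$ is a finite extension, $|p|=p^{-1}$. All radii lie in $p^{\mathbb{Q}}\cap(p^{-1},1)$. $D(N_0,K)$ is the locally analytic distribution algebra, i.e. the series $\sum_{\mathbf{k}\in\mathbb{N}^{\Phi^+}}d_{\mathbf{k}}\mathbf{b}^{\mathbf{k}}$ with $\{|d_{\mathbf{k}}|\rho^{|\mathbf{k}|}\}$ bounded for all $0<\rho<1$; $D(N_1,K)\subset D(N_0,K)$ is the corresponding algebra for $N_1$ (series in the $b_\beta$, $\beta\ne\alpha$). $\|\sum d_{\mathbf{k}}\mathbf{b}^{\mathbf{k}}\|_\rho:=\sup|d_{\mathbf{k}}|\rho^{|\mathbf{k}|}$ is a multiplicative norm with completion $D_{[0,\rho]}(N_0,K)$. For $\rho_1<\rho_2$, $D_{[\rho_1,\rho_2]}(N_0,K,\alpha)$ is the generalized microlocalization at the powers of $b_\alpha$: the (unique) Banach algebra containing $D_{[0,\rho_2]}(N_0,K)$ in which $b_\alpha$ is invertible, to which $\|\cdot\|_{\rho_1},\|\cdot\|_{\rho_2}$ extend multiplicatively, with topology defined by $\max(\|\cdot\|_{\rho_1},\|\cdot\|_{\rho_2})$, and in which the elements $b_\alpha^{-l}x$ ($l\ge0$, $x\in D_{[0,\rho_2]}(N_0,K)$) are dense. $D_{[\rho_1,1)}(N_0,K,\alpha):=\varprojlim_{\rho_2\to1}D_{[\rho_1,\rho_2]}(N_0,K,\alpha)$,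 $\mathfrak{R}_0:=\varinjlim_{\rho_1\to1}D_{[\rho_1,1)}(N_0,K,\alpha)$. For $t\in T_+$ and $\rho_1$ close to $1$, $\varphi_t(b_\alpha)=\varphi_t(n_\alpha)-1$ is invertible in $D_{[\rho_1,\rho_2]}(N_0,K,\alpha)$; $D_{r_t([\rho_1,\rho_2])}(\varphi_t(N_0),\alpha)$ is the closure there of $\{\varphi_t(b_\alpha)^{-l}x\mid l\ge0,x\in D(\varphi_t(N_0),K)\}$; $\mathfrak{R}_{0,r_t(\cdot)}(\varphi_t(N_0),\alpha):=\varinjlim_{\rho_1\to1}\varprojlim_{\rho_2\to1}D_{r_t([\rho_1,\rho_2])}(\varphi_t(N_0),\alpha)\subseteq\mathfrak{R}_0$. Write $t_1\le_\alpha t_2$ iff $|\beta(t_2t_1^{-1})|\le|\alpha(t_2t_1^{-1})|\le1$ for all $\beta\in\Phi^+$; conjugation by $t_2t_1^{-1}$ extends to injective ring homomorphisms from the $t_1$-component to the $t_2$-component, and $\mathcal{R}(N_1,\ell):=\varinjlim_{t\in T_+}\mathfrak{R}_{0,r_t(\cdot)}(\varphi_t(N_0),\alpha)$. The component $t=1$ gives inclusions $D(N_1,K)\subset\mathfrak{R}_0\subset\mathcal{R}(N_1,\ell)$. $\mathcal{R}=\varinjlim_{\rho\to1}\mathcal{A}_{[\rho,1)}$ is the Robba ring ($\mathcal{A}_{[\rho,1)}$: Laurent series over $K$ in $T$ converging for $\rho\le|T|<1$), $\chi(1)=1+T$, $\varphi(T)=(1+T)^p-1$. With $N_k$ the normal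 subgroup of $N_0$ generated by $\varphi^{k-1}(N_1)$, $\mathcal{R}[N_1/N_k,\ell]:=\bigoplus_{h\in N_1/N_k}\mathcal{R}h$ with multiplication $(r_1h_1)(r_2h_2)=\sum_{i=0}^{p^{c_k}-1}r_1\chi(i)\varphi^{c_k}(r_{i,2})(\iota(i)^{-1}h_1\iota(i)h_2)$, where $c_k\ge1$ is such that $\iota(p^{c_k}\mathbb{Z}_p)$ acts trivially on $N_1/N_k$ by conjugation and $r_2=\sum_i\chi(i)\varphi^{c_k}(r_{i,2})$. $\mathcal{R}[[N_1,\ell]]:=\varprojlim_k\mathcal{R}[N_1/N_k,\ell]$. The map $j$ is the natural ring homomorphism whose restriction to $\mathfrak{R}_0$ is the projective limit over $H=N_k$ of the maps $\pi_H\colon\mathfrak{R}_0\to\mathcal{R}[N_1/H,\ell]$, $\sum_{n\in\mathbb{Z}}b_\alpha^nf_n\mapsto\sum_{u\in N_1/H}\sum_{n\in\mathbb{Z}}\pi_H(f_n)_uT^nu$, where $f_n\in D(N_1,K)$ and $\pi_H(f_n)=\sum_{u}\pi_H(f_n)_uu$ is the image of $f_n$ under the projection $D(N_1,K)\to K[N_1/H]$. *)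

theory Defs
  imports
    "HOL-Analysis.Analysis"
    "HOL-Algebra.Solvable_Groups"
    "HOL-Algebra.AbelCoset"
    "HOL-Algebra.FiniteProduct"
    "HOL-Algebra.Algebraic_Closure_Type"
begin

section \<open>Non-archimedean fields and Q\_p\<close>

text \<open>A field of characteristic 0 with a non-archimedean absolute value and the metric it defines.\<close>

class nonarch_field = field_char_0 + metric_space +
  fixes vabs :: "'a \<Rightarrow> real"
  assumes dist_vabs: "dist x y = vabs (x - y)"
    and vabs_mult: "vabs (x * y) = vabs x * vabs y"
    and vabs_add: "vabs (x + y) \<le> max (vabs x) (vabs y)"

text \<open>\<open>is_Qp p TYPE('q)\<close>: the field \<open>'q\<close> with its absolute value is (isometrically isomorphic to) the
  completion of the rationals for the \<open>p\<close>-adic absolute value with \<open>|p| = 1/p\<close>.\<close>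

definition is_Qp :: "nat \<Rightarrow> 'q::nonarch_field itself \<Rightarrow> bool" where
  "is_Qp p _ \<longleftrightarrow> Factorial_Ring.prime p \<and> vabs (of_nat p :: 'q) = 1 / real p
     \<and> complete (UNIV :: 'q set) \<and> closure (\<rat> :: 'q set) = UNIV"

definition finite_extension_embedding ::
    "('q::nonarch_field \<Rightarrow> 'k::nonarch_field) \<Rightarrow> bool" where
  "finite_extension_embedding h \<longleftrightarrow>
     h 1 = 1 \<and> (\<forall>x y. h (x + y) = h x + h y) \<and> (\<forall>x y. h (x * y) = h x * h y)
     \<and> (\<forall>x. vabs (h x) = vabs x)
     \<and> (\<exists>B. finite B \<and> (\<forall>z. \<exists>c. z = (\<Sum>b\<in>B. h (c b) * b)))"


section \<open>Linear algebraic groups\<close>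

text \<open>Linear algebraic groups are Zariski closed subgroups of \<open>GL\<^sub>n\<close> over an algebraic closure of
  \<open>'q\<close>. In characteristic 0, being defined over \<open>'q\<close> is the same as being the zero locus of
  polynomials with coefficients in \<open>'q\<close>.\<close>

type_synonym ('e, 'n) mat = "'e ^ 'n ^ 'n"
type_synonym ('q, 'n) gmat = "'q alg_closure ^ 'n ^ 'n"
type_synonym ('q, 'n) chr = "('q, 'n) gmat \<Rightarrow> 'q alg_closure"

definition GLm :: "('e::field, 'n::finite) mat monoid" where
  "GLm = \<lparr>carrier = {A. invertible A}, mult = (**), one = mat 1\<rparr>"

abbreviation subgrp :: "('e::field, 'n::finite) mat set \<Rightarrow> ('e, 'n) mat monoid" where
  "subgrp H \<equiv> GLm\<lparr>carrier := H\<rparr>"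

definition conj_by :: "('e::field, 'n::finite) mat \<Rightarrow> ('e, 'n) mat \<Rightarrow> ('e, 'n) mat" where
  "conj_by t g = t ** g ** inv\<^bsub>GLm\<^esub> t"

definition of_mat :: "('q::field, 'n::finite) mat \<Rightarrow> ('q, 'n) gmat" where
  "of_mat A = (\<chi> i j. to_ac (A $ i $ j))"

definition rational_points :: "('q::field, 'n::finite) gmat set \<Rightarrow> ('q, 'n) mat set" where
  "rational_points H = {A. of_mat A \<in> H}"

inductive_set polyfun :: "'e::field set \<Rightarrow> (('e, 'n::finite) mat \<Rightarrow> 'e) set" for C where
  const: "c \<in> C \<Longrightarrow> (\<lambda>_. c) \<in> polyfun C"
| coord: "(\<lambda>A. A $ i $ j) \<in> polyfun C"
| add: "f \<in> polyfun C \<Longrightarrow> g \<in> polyfun C \<Longrightarrow> (\<lambda>A. f A + g A) \<in> polyfun C"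
| mult: "f \<in> polyfun C \<Longrightarrow> g \<in> polyfun C \<Longrightarrow> (\<lambda>A. f A * g A) \<in> polyfun C"

definition zclosed_over :: "'e::field set \<Rightarrow> ('e, 'n::finite) mat set \<Rightarrow> bool" where
  "zclosed_over C Z \<longleftrightarrow> (\<exists>F. F \<subseteq> polyfun C \<and> Z = {A \<in> carrier GLm. \<forall>f\<in>F. f A = 0})"

definition zconnected :: "('e::field, 'n::finite) mat set \<Rightarrow> bool" where
  "zconnected Z \<longleftrightarrow> (\<forall>A B. zclosed_over UNIV A \<and> zclosed_over UNIV B \<and> Z = A \<union> B \<and> A \<inter> B = {}
      \<longrightarrow> A = {} \<or> B = {})"

definition alg_group :: "('e::field, 'n::finite) mat set \<Rightarrow> bool" where
  "alg_group H \<longleftrightarrow> subgroup H GLm \<and> zclosed_over UNIV H"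

definition over_base :: "('q::field, 'n::finite) gmat set \<Rightarrow> bool" where
  "over_base H \<longleftrightarrow> zclosed_over (range to_ac) H"

definition is_diagonal :: "('e::field, 'n::finite) mat \<Rightarrow> bool" where
  "is_diagonal A \<longleftrightarrow> (\<forall>i j. i \<noteq> j \<longrightarrow> A $ i $ j = 0)"

definition torus :: "('e::field, 'n::finite) mat set \<Rightarrow> bool" where
  "torus T \<longleftrightarrow> alg_group T \<and> zconnected T
     \<and> (\<exists>A\<in>carrier GLm. \<forall>t\<in>T. is_diagonal (conj_by A t))"

definition split_torus :: "('q::field, 'n::finite) gmat set \<Rightarrow> bool" where
  "split_torus T \<longleftrightarrow> torus T \<and> over_base T
     \<and> (\<exists>A\<in>carrier GLm. \<forall>t\<in>T. is_diagonal (conj_by (of_mat A) t))"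

definition maximal_torus :: "('e::field, 'n::finite) mat set \<Rightarrow> ('e, 'n) mat set \<Rightarrow> bool" where
  "maximal_torus G T \<longleftrightarrow> torus T \<and> T \<subseteq> G \<and> (\<forall>T'. torus T' \<and> T' \<subseteq> G \<and> T \<subseteq> T' \<longrightarrow> T' = T)"

definition unipotent :: "('e::field, 'n::finite) mat \<Rightarrow> bool" where
  "unipotent A \<longleftrightarrow> (\<exists>m. ((\<lambda>B. B ** (A - mat 1)) ^^ m) (mat 1) = 0)"

definition normal_unipotent :: "('e::field, 'n::finite) mat set \<Rightarrow> ('e, 'n) mat set \<Rightarrow> bool" where
  "normal_unipotent H U \<longleftrightarrow>
     alg_group U \<and> zconnected U \<and> U \<lhd> subgrp H \<and> (\<forall>u\<in>U. unipotent u)"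

definition unipotent_radical :: "('e::field, 'n::finite) mat set \<Rightarrow> ('e, 'n) mat set \<Rightarrow> bool" where
  "unipotent_radical H U \<longleftrightarrow>
     normal_unipotent H U \<and> (\<forall>V. normal_unipotent H V \<longrightarrow> V \<subseteq> U)"

definition connected_reductive :: "('e::field, 'n::finite) mat set \<Rightarrow> bool" where
  "connected_reductive G \<longleftrightarrow> alg_group G \<and> zconnected G \<and> unipotent_radical G {mat 1}"

definition connected_solvable :: "('e::field, 'n::finite) mat set \<Rightarrow> bool" where
  "connected_solvable B \<longleftrightarrow> alg_group B \<and> zconnected B \<and> solvable (subgrp B)"

definition borel_subgroup :: "('e::field, 'n::finite) mat set \<Rightarrow> ('e, 'n) mat set \<Rightarrow> bool" where
  "borel_subgroup G B \<longleftrightarrow> connected_solvable B \<and> B \<subseteq> G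
     \<and> (\<forall>B'. connected_solvable B' \<and> B' \<subseteq> G \<and> B \<subseteq> B' \<longrightarrow> B' = B)"

definition centre :: "('e::field, 'n::finite) mat set \<Rightarrow> ('e, 'n) mat set" where
  "centre G = {z \<in> G. \<forall>g\<in>G. z ** g = g ** z}"

definition characters :: "('e::field, 'n::finite) mat set \<Rightarrow> (('e, 'n) mat \<Rightarrow> 'e) set" where
  "characters T = {c \<in> extensional T.
     (\<exists>f\<in>polyfun UNIV. \<exists>m. \<forall>t\<in>T. c t = f t / det t ^ m)
     \<and> (\<forall>t\<in>T. c t \<noteq> 0) \<and> (\<forall>t\<in>T. \<forall>u\<in>T. c (t ** u) = c t * c u)}"

text \<open>Cocharacters are only constrained on \<open>x \<noteq> 0\<close>.\<close>

definition cocharacter :: "('e::field, 'n::finite) mat set \<Rightarrow> ('e \<Rightarrow> ('e, 'n) mat) \<Rightarrow> bool" where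
  "cocharacter T x \<longleftrightarrow> (\<forall>a. a \<noteq> 0 \<longrightarrow> x a \<in> T)
     \<and> (\<forall>a b. a \<noteq> 0 \<and> b \<noteq> 0 \<longrightarrow> x (a * b) = x a ** x b)
     \<and> (\<forall>i j. \<exists>q m. \<forall>a. a \<noteq> 0 \<longrightarrow> x a $ i $ j = poly q a / a ^ m)"

text \<open>The Lie algebra as tangent space at 1: \<open>v\<close> is tangent iff for every polynomial \<open>f\<close> vanishing on
  \<open>H\<close> the one-variable polynomial \<open>f (1 + a v)\<close> vanishes to second order at \<open>a = 0\<close>.\<close>

definition lie_algebra :: "('e::field, 'n::finite) mat set \<Rightarrow> ('e, 'n) mat set" where
  "lie_algebra H = {v. \<forall>f\<in>polyfun UNIV. (\<forall>h\<in>H. f h = 0) \<longrightarrow>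
     (\<exists>q. \<forall>a. f (mat 1 + (\<chi> i j. a * v $ i $ j)) = a ^ 2 * poly q a)}"

definition weights_on :: "('e::field, 'n::finite) mat set \<Rightarrow> ('e, 'n) mat set \<Rightarrow>
    (('e, 'n) mat \<Rightarrow> 'e) set" where
  "weights_on T V = {c \<in> characters T.
     \<exists>v\<in>V. v \<noteq> 0 \<and> (\<forall>t\<in>T. conj_by t v = (\<chi> i j. c t * v $ i $ j))}"

text \<open>\<open>Delta\<close> is the basis of simple roots for the set \<open>Pos\<close> of positive roots. Characters are
  written multiplicatively.\<close>

definition simple_roots :: "('e::field, 'n::finite) mat set \<Rightarrow>
    (('e, 'n) mat \<Rightarrow> 'e) set \<Rightarrow> (('e, 'n) mat \<Rightarrow> 'e) set \<Rightarrow> bool" where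
  "simple_roots T Pos Delta \<longleftrightarrow> finite Delta \<and> Delta \<subseteq> Pos
     \<and> (\<forall>m. (\<forall>t\<in>T. (\<Prod>d\<in>Delta. d t powi m d) = 1) \<longrightarrow> (\<forall>d\<in>Delta. m d = (0::int)))
     \<and> (\<forall>b\<in>Pos. \<exists>m. \<forall>t\<in>T. b t = (\<Prod>d\<in>Delta. d t ^ m d))"

text \<open>The root subgroup of \<open>b\<close>: the image of an isomorphism \<open>x\<close> of the additive group onto a closed
  subgroup with \<open>t x(a) t\<^sup>-\<^sup>1 = x(b(t) a)\<close>.\<close>

definition root_subgroup :: "('e::field, 'n::finite) mat set \<Rightarrow> (('e, 'n) mat \<Rightarrow> 'e) \<Rightarrow>
    ('e, 'n) mat set \<Rightarrow> bool" where
  "root_subgroup T b U \<longleftrightarrow> alg_group U \<and>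
     (\<exists>x. range x = U \<and> (\<forall>i j. \<exists>q. \<forall>a. x a $ i $ j = poly q a)
        \<and> (\<exists>f\<in>polyfun UNIV. \<forall>a. f (x a) = a)
        \<and> (\<forall>a a'. x (a + a') = x a ** x a')
        \<and> (\<forall>t\<in>T. \<forall>a. conj_by t (x a) = x (b t * a)))"


section \<open>Uniform pro-p groups of matrices\<close>

definition index_in :: "('e::field, 'n::finite) mat set \<Rightarrow> ('e, 'n) mat set \<Rightarrow> nat" where
  "index_in H U = card (rcosets\<^bsub>subgrp H\<^esub> U)"

text \<open>A compact group of matrices over \<open>'q\<close> is profinite, so pro-\<open>p\<close> is a condition on the
  indices of its open normal subgroups.\<close>

definition pro_p_group :: "nat \<Rightarrow> ('q::nonarch_field, 'n::finite) mat set \<Rightarrow> bool" where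
  "pro_p_group p H \<longleftrightarrow> subgroup H GLm \<and> compact H
     \<and> (\<forall>U. U \<lhd> subgrp H \<and> openin (top_of_set H) U \<longrightarrow> (\<exists>m. index_in H U = p ^ m))"

fun lower_p_series :: "nat \<Rightarrow> ('q::nonarch_field, 'n::finite) mat set \<Rightarrow> nat \<Rightarrow> ('q, 'n) mat set" where
  "lower_p_series p H 0 = H"
| "lower_p_series p H (Suc i) = closure (generate GLm
     ({x [^]\<^bsub>GLm\<^esub> p | x. x \<in> lower_p_series p H i}
      \<union> {x ** y ** inv\<^bsub>GLm\<^esub> x ** inv\<^bsub>GLm\<^esub> y | x y. x \<in> lower_p_series p H i \<and> y \<in> H}))"

definition uniform_pro_p :: "nat \<Rightarrow> ('q::nonarch_field, 'n::finite) mat set \<Rightarrow> bool" where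
  "uniform_pro_p p H \<longleftrightarrow> pro_p_group p H
     \<and> (\<exists>Y. finite Y \<and> Y \<subseteq> H \<and> closure (generate GLm Y) = H)
     \<and> derived GLm H \<subseteq>
         closure (generate GLm {x [^]\<^bsub>GLm\<^esub> (if p = 2 then 4 else p) | x. x \<in> H})
     \<and> (\<forall>i. index_in (lower_p_series p H i) (lower_p_series p H (Suc i))
            = index_in H (lower_p_series p H 1))"


section \<open>The setting\<close>

text \<open>\<open>ell_proj n\<close> is the image of \<open>n\<close> under \<open>N \<rightarrow> N/[N,N] \<rightarrow> \<Prod>\<^sub>\<beta>\<^sub>\<in>\<^sub>\<Delta> N\<^sub>\<beta>\<close>,
  \<open>root_order\<close> the fixed order of the positive roots, and \<open>cexp k\<close> is \<open>c\<^sub>k\<close>.\<close>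

record (overloaded) ('q, 'k, 'n) setting =
  prm :: nat
  coeff_emb :: "'q \<Rightarrow> 'k"
  grpG :: "('q::nonarch_field, 'n::finite) gmat set"
  borelP :: "('q, 'n) gmat set"
  torusT :: "('q, 'n) gmat set"
  unipN :: "('q, 'n) gmat set"
  simple :: "('q, 'n) chr set"
  root_grp :: "('q, 'n) chr \<Rightarrow> ('q, 'n) gmat set"
  alpha :: "('q, 'n) chr"
  N0 :: "('q, 'n) mat set"
  iota_alpha :: "('q, 'n) mat \<Rightarrow> 'q"
  ell_proj :: "('q, 'n) mat \<Rightarrow> ('q, 'n) chr \<Rightarrow> ('q, 'n) mat"
  xi :: "'q alg_closure \<Rightarrow> ('q, 'n) gmat"
  top_gen :: "('q, 'n) chr \<Rightarrow> ('q, 'n) mat"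
  root_order :: "('q, 'n) chr list"
  cexp :: "nat \<Rightarrow> nat"

type_synonym ('q, 'n) midx = "('q, 'n) chr \<Rightarrow> nat"
type_synonym ('q, 'k, 'n) distr = "('q, 'n) midx \<Rightarrow> 'k"

context
  fixes S :: "('q::nonarch_field, 'k::nonarch_field, 'n::finite) setting"
begin

definition pos_roots :: "('q, 'n) chr set" where
  "pos_roots = weights_on (torusT S) (lie_algebra (unipN S))"

definition Tpts :: "('q, 'n) mat set" where "Tpts = rational_points (torusT S)"
definition Npts :: "('q, 'n) mat set" where "Npts = rational_points (unipN S)"
definition root_pts :: "('q, 'n) chr \<Rightarrow> ('q, 'n) mat set" where
  "root_pts b = rational_points (root_grp S b)"

text \<open>As \<open>T\<close> is split, characters take values in \<open>'q\<close> on rational points.\<close>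

definition char_val :: "('q, 'n) chr \<Rightarrow> ('q, 'n) mat \<Rightarrow> 'q" where
  "char_val c t = of_ac (c (of_mat t))"

definition ordered_prod :: "('q, 'n) chr list \<Rightarrow> (('q, 'n) chr \<Rightarrow> ('q, 'n) mat) \<Rightarrow> ('q, 'n) mat" where
  "ordered_prod bs a = foldr (\<lambda>b g. a b ** g) bs (mat 1)"

definition ell :: "('q, 'n) mat \<Rightarrow> 'q" where
  "ell n = iota_alpha S (ell_proj S n (alpha S))"

definition N1 :: "('q, 'n) mat set" where
  "N1 = {n \<in> N0 S. ell n = 0}"

definition iota :: "'q \<Rightarrow> ('q, 'n) mat" where
  "iota z = inv_into (root_pts (alpha S)) (iota_alpha S) z"

definition s_elt :: "('q, 'n) mat" where
  "s_elt = (THE t. of_mat t = xi S (of_nat (prm S)))"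

definition Tplus :: "('q, 'n) mat set" where
  "Tplus = {t \<in> Tpts. conj_by t ` N0 S \<subseteq> N0 S}"

definition le_alpha :: "('q, 'n) mat \<Rightarrow> ('q, 'n) mat \<Rightarrow> bool" where
  "le_alpha t1 t2 \<longleftrightarrow> (\<forall>b\<in>pos_roots.
     vabs (char_val b (t2 ** inv\<^bsub>GLm\<^esub> t1)) \<le> vabs (char_val (alpha S) (t2 ** inv\<^bsub>GLm\<^esub> t1))
     \<and> vabs (char_val (alpha S) (t2 ** inv\<^bsub>GLm\<^esub> t1)) \<le> 1)"

definition Nk :: "nat \<Rightarrow> ('q, 'n) mat set" where
  "Nk k = generate GLm {conj_by g ((conj_by s_elt ^^ (k - 1)) x) | g x. g \<in> N0 S \<and> x \<in> N1}"

definition N1_mod :: "nat \<Rightarrow> ('q, 'n) mat set set" where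
  "N1_mod k = rcosets\<^bsub>subgrp N1\<^esub> (Nk k)"

definition conj_coset :: "'q \<Rightarrow> ('q, 'n) mat set \<Rightarrow> ('q, 'n) mat set" where
  "conj_coset z h = (inv\<^bsub>GLm\<^esub> (iota z) <#\<^bsub>GLm\<^esub> h) #>\<^bsub>GLm\<^esub> iota z"

definition valid_group :: bool where
  "valid_group \<longleftrightarrow>
     connected_reductive (grpG S) \<and> over_base (grpG S) \<and> zconnected (centre (grpG S))
     \<and> maximal_torus (grpG S) (torusT S) \<and> split_torus (torusT S)
     \<and> borel_subgroup (grpG S) (borelP S) \<and> over_base (borelP S)
     \<and> unipotent_radical (borelP S) (unipN S) \<and> over_base (unipN S)
     \<and> borelP S = torusT S <#>\<^bsub>GLm\<^esub> unipN S
     \<and> simple_roots (torusT S) pos_roots (simple S)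
     \<and> (\<forall>b\<in>pos_roots. root_subgroup (torusT S) b (root_grp S b) \<and> root_grp S b \<subseteq> unipN S)"

definition valid_N0 :: bool where
  "valid_N0 \<longleftrightarrow>
     subgroup (N0 S) GLm \<and> N0 S \<subseteq> Npts \<and> compact (N0 S) \<and> openin (top_of_set Npts) (N0 S)
     \<and> uniform_pro_p (prm S) (N0 S)
     \<and> (\<forall>bs. distinct bs \<and> set bs = pos_roots \<longrightarrow>
          bij_betw (ordered_prod bs) (\<Pi>\<^sub>E b\<in>pos_roots. N0 S \<inter> root_pts b) (N0 S))"

text \<open>\<open>n \<mapsto> (ell_proj n b)\<^sub>b\<close> is the projection \<open>N \<rightarrow> N/[N,N]\<close> followed by the inverse of the
  isomorphism \<open>\<Prod>\<^sub>\<beta>\<^sub>\<in>\<^sub>\<Delta> N\<^sub>\<beta> \<rightarrow> N/[N,N]\<close>.\<close>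

definition valid_ell_proj :: bool where
  "valid_ell_proj \<longleftrightarrow> (\<forall>n\<in>Npts. ell_proj S n \<in> (\<Pi>\<^sub>E b\<in>simple S. root_pts b)
     \<and> (\<forall>a\<in>(\<Pi>\<^sub>E b\<in>simple S. root_pts b).
          ell_proj S n = a \<longleftrightarrow>
          derived GLm Npts #>\<^bsub>GLm\<^esub> n =
            finprod (subgrp Npts Mod derived GLm Npts)
              (\<lambda>b. derived GLm Npts #>\<^bsub>GLm\<^esub> a b) (simple S)))"

definition valid_setting :: bool where
  "valid_setting \<longleftrightarrow>
     is_Qp (prm S) TYPE('q) \<and> finite_extension_embedding (coeff_emb S)
     \<and> valid_group \<and> valid_N0 \<and> valid_ell_proj
     \<and> alpha S \<in> simple S
     \<and> bij_betw (iota_alpha S) (root_pts (alpha S)) UNIV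
     \<and> (\<forall>x\<in>root_pts (alpha S). \<forall>y\<in>root_pts (alpha S).
          iota_alpha S (x ** y) = iota_alpha S x + iota_alpha S y)
     \<and> (\<forall>t\<in>Tpts. \<forall>x\<in>root_pts (alpha S).
          iota_alpha S (conj_by t x) = char_val (alpha S) t * iota_alpha S x)
     \<and> iota_alpha S ` (N0 S \<inter> root_pts (alpha S)) = {z. vabs z \<le> 1}
     \<and> cocharacter (torusT S) (xi S)
     \<and> (\<forall>b\<in>simple S. \<forall>a. a \<noteq> 0 \<longrightarrow> b (xi S a) = a)
     \<and> (\<forall>b\<in>pos_roots. top_gen S b \<in> N0 S \<inter> root_pts b
          \<and> closure (generate GLm {top_gen S b}) = N0 S \<inter> root_pts b)
     \<and> ell (top_gen S (alpha S)) = 1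
     \<and> distinct (root_order S) \<and> set (root_order S) = pos_roots \<and> hd (root_order S) = alpha S
     \<and> (\<forall>k\<ge>1. cexp S k \<ge> 1 \<and>
          (\<forall>z. vabs z \<le> vabs (of_nat (prm S) ^ cexp S k :: 'q) \<longrightarrow>
            (\<forall>h\<in>N1_mod k. conj_coset z h = h)))"

definition radii :: "real set" where
  "radii = {r. 1 / real (prm S) < r \<and> r < 1 \<and> (\<exists>x::rat. r = real (prm S) powr of_rat x)}"


section \<open>Distribution algebras\<close>

text \<open>A distribution \<open>\<Sum>\<^sub>k d\<^sub>k b\<^sup>k\<close> is represented by its coefficient function; multi-indices vanish
  outside the positive roots.\<close>

definition midxs :: "('q, 'n) midx set" where
  "midxs = {k. \<forall>b. b \<notin> pos_roots \<longrightarrow> k b = 0}"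

definition deg :: "('q, 'n) midx \<Rightarrow> nat" where
  "deg k = (\<Sum>b\<in>pos_roots. k b)"

text \<open>\<open>n\<^sup>z\<close> for \<open>z\<close> in the valuation ring \<open>\<int>\<^sub>p\<close>, by continuity.\<close>

definition zp_pow :: "('q, 'n) mat \<Rightarrow> 'q \<Rightarrow> ('q, 'n) mat" where
  "zp_pow n z = (THE g. \<forall>e::nat \<Rightarrow> nat.
     (\<lambda>i. of_nat (e i)) \<longlonglongrightarrow> z \<longrightarrow> (\<lambda>i. n [^]\<^bsub>GLm\<^esub> e i) \<longlonglongrightarrow> g)"

definition coords :: "('q, 'n) mat \<Rightarrow> ('q, 'n) chr \<Rightarrow> 'q" where
  "coords g = (THE x. x \<in> (\<Pi>\<^sub>E b\<in>pos_roots. {z. vabs z \<le> 1})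
     \<and> g = ordered_prod (root_order S) (\<lambda>b. zp_pow (top_gen S b) (x b)))"

definition gen_monomial :: "('q, 'n) midx \<Rightarrow> ('q, 'n) mat" where
  "gen_monomial i = ordered_prod (root_order S) (\<lambda>b. top_gen S b [^]\<^bsub>GLm\<^esub> i b)"

text \<open>The value of the distribution \<open>d\<close> at a function \<open>f\<close> on \<open>N\<^sub>0\<close>. As
  \<open>b\<^sup>k = \<Sum>\<^sub>i\<^sub>\<le>\<^sub>k (-1)\<^bsup>|k|-|i|\<^esup> binom(k,i) n\<^sup>i\<close> in the group ring, the monomial \<open>b\<^sup>k\<close> sends \<open>f\<close> to its
  \<open>k\<close>-th Mahler coefficient.\<close>

definition dist_apply :: "('q, 'k, 'n) distr \<Rightarrow> (('q, 'n) mat \<Rightarrow> 'k) \<Rightarrow> 'k" where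
  "dist_apply d f = infsum (\<lambda>k. d k * (\<Sum>i\<in>{i\<in>midxs. \<forall>b. i b \<le> k b}.
      (-1) ^ (deg k - deg i) * (\<Prod>b\<in>pos_roots. of_nat (k b choose i b)) * f (gen_monomial i))) midxs"

text \<open>The function dual to \<open>b\<^sup>m\<close>: the group element \<open>g\<close> expands as \<open>\<Sum>\<^sub>m (mahler_fun m g) b\<^sup>m\<close>, hence
  the coefficient of \<open>b\<^sup>m\<close> in any distribution is its value at \<open>mahler_fun m\<close>.\<close>

definition mahler_fun :: "('q, 'n) midx \<Rightarrow> ('q, 'n) mat \<Rightarrow> 'k" where
  "mahler_fun m g = coeff_emb S (\<Prod>b\<in>pos_roots. coords g b gchoose m b)"

text \<open>Convolution, and push-forward along \<open>\<phi>\<^sub>t\<close>.\<close>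

definition dist_mult :: "('q, 'k, 'n) distr \<Rightarrow> ('q, 'k, 'n) distr \<Rightarrow> ('q, 'k, 'n) distr" where
  "dist_mult d e = (\<lambda>m. if m \<in> midxs
     then dist_apply d (\<lambda>g. dist_apply e (\<lambda>h. mahler_fun m (g ** h))) else 0)"

definition push :: "('q, 'n) mat \<Rightarrow> ('q, 'k, 'n) distr \<Rightarrow> ('q, 'k, 'n) distr" where
  "push t d = (\<lambda>m. if m \<in> midxs then dist_apply d (\<lambda>g. mahler_fun m (conj_by t g)) else 0)"

definition distN0 :: "('q, 'k, 'n) distr set" where
  "distN0 = {d. (\<forall>k. k \<notin> midxs \<longrightarrow> d k = 0)
     \<and> (\<forall>r. 0 < r \<and> r < 1 \<longrightarrow> bdd_above (range (\<lambda>k. vabs (d k) * r ^ deg k)))}"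

definition distN1 :: "('q, 'k, 'n) distr set" where
  "distN1 = {d \<in> distN0. \<forall>k. k (alpha S) \<noteq> 0 \<longrightarrow> d k = 0}"

definition dist_norm_at :: "real \<Rightarrow> ('q, 'k, 'n) distr \<Rightarrow> real" where
  "dist_norm_at r d = (SUP k. vabs (d k) * r ^ deg k)"

text \<open>\<open>D\<^bsub>[0,r]\<^esub>(N\<^sub>0,K)\<close>: completing for the sup-norm gives the series with
  \<open>|d\<^sub>k| r\<^bsup>|k|\<^esup> \<rightarrow> 0\<close>.\<close>

definition Dcompl :: "real \<Rightarrow> ('q, 'k, 'n) distr ring" where
  "Dcompl r = \<lparr>carrier = {d. (\<forall>k. k \<notin> midxs \<longrightarrow> d k = 0)
        \<and> (\<forall>\<epsilon>>0. finite {k. vabs (d k) * r ^ deg k \<ge> \<epsilon>})},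
     mult = dist_mult, one = (\<lambda>k. if k = (\<lambda>_. 0) then 1 else 0),
     zero = (\<lambda>_. 0), add = (\<lambda>d e k. d k + e k)\<rparr>"

definition bvar :: "('q, 'n) chr \<Rightarrow> ('q, 'k, 'n) distr" where
  "bvar b = (\<lambda>k. if k = (\<lambda>_. 0)(b := 1) then 1 else 0)"

text \<open>\<open>log (n\<^sub>b) = log (1 + b\<^sub>b) = \<Sum>\<^sub>m\<^sub>\<ge>\<^sub>1 (-1)\<^bsup>m+1\<^esup> b\<^sub>b\<^sup>m / m\<close>.\<close>

definition log_gen :: "('q, 'n) chr \<Rightarrow> ('q, 'k, 'n) distr" where
  "log_gen b = (\<lambda>k. if k b \<ge> 1 \<and> k = (\<lambda>_. 0)(b := k b)
     then (-1) ^ (k b + 1) / of_nat (k b) else 0)"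

end


section \<open>Projective and inductive limits of rings\<close>

definition proj_lim :: "'i set \<Rightarrow> ('i \<Rightarrow> 'i \<Rightarrow> bool) \<Rightarrow> ('i \<Rightarrow> 'a ring) \<Rightarrow> ('i \<Rightarrow> 'i \<Rightarrow> 'a \<Rightarrow> 'a) \<Rightarrow>
    ('i \<Rightarrow> 'a) ring" where
  "proj_lim I leq R f = \<lparr>
     carrier = {x \<in> (\<Pi>\<^sub>E i\<in>I. carrier (R i)). \<forall>i\<in>I. \<forall>j\<in>I. leq i j \<longrightarrow> f j i (x j) = x i},
     mult = (\<lambda>x y. \<lambda>i\<in>I. x i \<otimes>\<^bsub>R i\<^esub> y i), one = (\<lambda>i\<in>I. \<one>\<^bsub>R i\<^esub>),
     zero = (\<lambda>i\<in>I. \<zero>\<^bsub>R i\<^esub>), add = (\<lambda>x y. \<lambda>i\<in>I. x i \<oplus>\<^bsub>R i\<^esub> y i)\<rparr>"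

text \<open>Inductive limit over a directed preorder: two representatives are identified when they
  become equal at a later stage.\<close>

definition ind_class :: "'i set \<Rightarrow> ('i \<Rightarrow> 'i \<Rightarrow> bool) \<Rightarrow> ('i \<Rightarrow> 'a ring) \<Rightarrow> ('i \<Rightarrow> 'i \<Rightarrow> 'a \<Rightarrow> 'a) \<Rightarrow>
    'i \<Rightarrow> 'a \<Rightarrow> ('i \<times> 'a) set" where
  "ind_class I leq R f i x = {(j, y). j \<in> I \<and> y \<in> carrier (R j)
     \<and> (\<exists>k\<in>I. leq i k \<and> leq j k \<and> f i k x = f j k y)}"

definition ind_op :: "'i set \<Rightarrow> ('i \<Rightarrow> 'i \<Rightarrow> bool) \<Rightarrow> ('i \<Rightarrow> 'a ring) \<Rightarrow> ('i \<Rightarrow> 'i \<Rightarrow> 'a \<Rightarrow> 'a) \<Rightarrow>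
    ('i \<Rightarrow> 'a \<Rightarrow> 'a \<Rightarrow> 'a) \<Rightarrow> ('i \<times> 'a) set \<Rightarrow> ('i \<times> 'a) set \<Rightarrow> ('i \<times> 'a) set" where
  "ind_op I leq R f bop C D = (THE Z. \<exists>i\<in>I. \<exists>x\<in>carrier (R i). \<exists>y\<in>carrier (R i).
     C = ind_class I leq R f i x \<and> D = ind_class I leq R f i y \<and> Z = ind_class I leq R f i (bop i x y))"

definition ind_lim :: "'i set \<Rightarrow> ('i \<Rightarrow> 'i \<Rightarrow> bool) \<Rightarrow> ('i \<Rightarrow> 'a ring) \<Rightarrow> ('i \<Rightarrow> 'i \<Rightarrow> 'a \<Rightarrow> 'a) \<Rightarrow>
    ('i \<times> 'a) set ring" where
  "ind_lim I leq R f = \<lparr>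
     carrier = {ind_class I leq R f i x | i x. i \<in> I \<and> x \<in> carrier (R i)},
     mult = ind_op I leq R f (\<lambda>i. mult (R i)),
     one = {(j, y). j \<in> I \<and> y \<in> carrier (R j) \<and> (\<exists>k\<in>I. leq j k \<and> f j k y = \<one>\<^bsub>R k\<^esub>)},
     zero = {(j, y). j \<in> I \<and> y \<in> carrier (R j) \<and> (\<exists>k\<in>I. leq j k \<and> f j k y = \<zero>\<^bsub>R k\<^esub>)},
     add = ind_op I leq R f (\<lambda>i. add (R i))\<rparr>"

definition ind_system :: "'i set \<Rightarrow> ('i \<Rightarrow> 'i \<Rightarrow> bool) \<Rightarrow> ('i \<Rightarrow> 'a ring) \<Rightarrow> ('i \<Rightarrow> 'i \<Rightarrow> 'a \<Rightarrow> 'a) \<Rightarrow>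
    bool" where
  "ind_system I leq R f \<longleftrightarrow>
     (\<forall>i\<in>I. \<forall>j\<in>I. leq i j \<longrightarrow> f i j \<in> ring_hom (R i) (R j))
     \<and> (\<forall>i\<in>I. \<forall>x\<in>carrier (R i). f i i x = x)
     \<and> (\<forall>i\<in>I. \<forall>j\<in>I. \<forall>k\<in>I. leq i j \<and> leq j k \<longrightarrow>
          (\<forall>x\<in>carrier (R i). f j k (f i j x) = f i k x))"


section \<open>Generalized microlocalizations and R(N\_1, l)\<close>

text \<open>Realizations of the Banach algebras \<open>D\<^bsub>[r1,r2]\<^esub>(N\<^sub>0,K,\<alpha>)\<close> (ring, map from
  \<open>D\<^bsub>[0,r2]\<^esub>(N\<^sub>0,K)\<close>, and norms \<open>mnorm r1 r2 r\<close> for \<open>r \<in> {r1, r2}\<close>), of the restriction maps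
  between them, and of the transition maps between the \<open>t\<close>-components. They are pinned down by
  \<open>valid_microloc\<close> below.\<close>

type_synonym 'a R0elt = "(real \<times> (real \<Rightarrow> 'a)) set"

record (overloaded) ('q, 'k, 'n, 'a) microloc =
  mring :: "real \<Rightarrow> real \<Rightarrow> 'a ring"
  memb :: "real \<Rightarrow> real \<Rightarrow> ('q::nonarch_field, 'k, 'n::finite) distr \<Rightarrow> 'a"
  mnorm :: "real \<Rightarrow> real \<Rightarrow> real \<Rightarrow> 'a \<Rightarrow> real"
  mres :: "real \<times> real \<Rightarrow> real \<times> real \<Rightarrow> 'a \<Rightarrow> 'a"
  mtrans :: "('q, 'n) mat \<Rightarrow> ('q, 'n) mat \<Rightarrow> 'a R0elt \<Rightarrow> 'a R0elt"

context
  fixes S :: "('q::nonarch_field, 'k::nonarch_field, 'n::finite) setting"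
    and M :: "('q, 'k, 'n, 'a) microloc"
begin

definition mmax :: "real \<Rightarrow> real \<Rightarrow> 'a \<Rightarrow> real" where
  "mmax r1 r2 x = max (mnorm M r1 r2 r1 x) (mnorm M r1 r2 r2 x)"

definition is_microlocalization :: "real \<Rightarrow> real \<Rightarrow> bool" where
  "is_microlocalization r1 r2 \<longleftrightarrow> (let L = mring M r1 r2; e = memb M r1 r2 in
     ring L
     \<and> e \<in> ring_hom (Dcompl S r2) L \<and> inj_on e (carrier (Dcompl S r2))
     \<and> e (bvar (alpha S)) \<in> Units L
     \<and> (\<forall>r\<in>{r1, r2}.
          (\<forall>x\<in>carrier L. mnorm M r1 r2 r x \<ge> 0 \<and> (mnorm M r1 r2 r x = 0 \<longleftrightarrow> x = \<zero>\<^bsub>L\<^esub>))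
          \<and> (\<forall>x\<in>carrier L. \<forall>y\<in>carrier L.
               mnorm M r1 r2 r (x \<oplus>\<^bsub>L\<^esub> y) \<le> max (mnorm M r1 r2 r x) (mnorm M r1 r2 r y)
               \<and> mnorm M r1 r2 r (x \<otimes>\<^bsub>L\<^esub> y) = mnorm M r1 r2 r x * mnorm M r1 r2 r y)
          \<and> (\<forall>d\<in>carrier (Dcompl S r2). mnorm M r1 r2 r (e d) = dist_norm_at S r d))
     \<and> (\<forall>u::nat \<Rightarrow> 'a. (\<forall>i. u i \<in> carrier L)
          \<and> (\<forall>\<epsilon>>0. \<exists>m. \<forall>i\<ge>m. \<forall>j\<ge>m. mmax r1 r2 (u i \<ominus>\<^bsub>L\<^esub> u j) < \<epsilon>)
          \<longrightarrow> (\<exists>x\<in>carrier L. (\<lambda>i. mmax r1 r2 (u i \<ominus>\<^bsub>L\<^esub> x)) \<longlonglongrightarrow> 0))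
     \<and> (\<forall>x\<in>carrier L. \<forall>\<epsilon>>0. \<exists>l::nat. \<exists>d\<in>carrier (Dcompl S r2).
          mmax r1 r2 (x \<ominus>\<^bsub>L\<^esub> (inv\<^bsub>L\<^esub> e (bvar (alpha S))) [^]\<^bsub>L\<^esub> l \<otimes>\<^bsub>L\<^esub> e d) < \<epsilon>))"

definition intervals :: "(real \<times> real) set" where
  "intervals = {(r1, r2). r1 \<in> radii S \<and> r2 \<in> radii S \<and> r1 < r2}"

definition subinterval :: "real \<times> real \<Rightarrow> real \<times> real \<Rightarrow> bool" where
  "subinterval J I \<longleftrightarrow> fst I \<le> fst J \<and> snd J \<le> snd I"

abbreviation ring_at :: "real \<times> real \<Rightarrow> 'a ring" where
  "ring_at I \<equiv> mring M (fst I) (snd I)"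

text \<open>\<open>mres I J\<close> is the continuous extension to \<open>D\<^sub>I\<close> of the inclusion of \<open>D\<^bsub>[0,snd I]\<^esub>\<close> in
  \<open>D\<^bsub>[0,snd J]\<^esub>\<close>.\<close>

definition valid_restrictions :: bool where
  "valid_restrictions \<longleftrightarrow>
     ind_system intervals (\<lambda>I J. subinterval J I) ring_at (mres M)
     \<and> (\<forall>I\<in>intervals. \<forall>J\<in>intervals. subinterval J I \<longrightarrow>
          (\<forall>d\<in>carrier (Dcompl S (snd I)).
             mres M I J (memb M (fst I) (snd I) d) = memb M (fst J) (snd J) d)
          \<and> (\<exists>C. \<forall>x\<in>carrier (ring_at I).
               mmax (fst J) (snd J) (mres M I J x) \<le> C * mmax (fst I) (snd I) x))"

definition above :: "real \<Rightarrow> real set" where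
  "above r1 = {r2 \<in> radii S. r1 < r2}"

text \<open>\<open>D\<^bsub>[r1,1)\<^esub>(N\<^sub>0,K,\<alpha>)\<close> and \<open>\<RR>\<^sub>0\<close>.\<close>

definition Dopen :: "real \<Rightarrow> (real \<Rightarrow> 'a) ring" where
  "Dopen r1 = proj_lim (above r1) (\<le>) (mring M r1) (\<lambda>r2' r2. mres M (r1, r2') (r1, r2))"

definition Dopen_res :: "real \<Rightarrow> real \<Rightarrow> (real \<Rightarrow> 'a) \<Rightarrow> real \<Rightarrow> 'a" where
  "Dopen_res r1 r1' y = (\<lambda>r2\<in>above r1'. mres M (r1, r2) (r1', r2) (y r2))"

definition R0 :: "'a R0elt ring" where
  "R0 = ind_lim (radii S) (\<le>) Dopen Dopen_res"

definition R0_class :: "real \<Rightarrow> (real \<Rightarrow> 'a) \<Rightarrow> 'a R0elt" where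
  "R0_class = ind_class (radii S) (\<le>) Dopen Dopen_res"

definition R0_incl :: "('q, 'k, 'n) distr \<Rightarrow> 'a R0elt" where
  "R0_incl d = (THE C. \<exists>r1\<in>radii S. C = R0_class r1 (\<lambda>r2\<in>above r1. memb M r1 r2 d))"

text \<open>The \<open>t\<close>-components, as subrings of \<open>\<RR>\<^sub>0\<close>; \<open>D(\<phi>\<^sub>t(N\<^sub>0),K)\<close> is the image of \<open>push t\<close>.\<close>

definition invertible_radius :: "('q, 'n) mat \<Rightarrow> real \<Rightarrow> bool" where
  "invertible_radius t r1 \<longleftrightarrow> r1 \<in> radii S
     \<and> (\<forall>r2\<in>above r1. memb M r1 r2 (push S t (bvar (alpha S))) \<in> Units (mring M r1 r2))"

definition Dclosure :: "('q, 'n) mat \<Rightarrow> real \<Rightarrow> real \<Rightarrow> 'a set" where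
  "Dclosure t r1 r2 = (let L = mring M r1 r2; e = memb M r1 r2 in
     {x \<in> carrier L. \<forall>\<epsilon>>0. \<exists>l::nat. \<exists>d\<in>distN0 S.
        mmax r1 r2 (x \<ominus>\<^bsub>L\<^esub>
          (inv\<^bsub>L\<^esub> e (push S t (bvar (alpha S)))) [^]\<^bsub>L\<^esub> l \<otimes>\<^bsub>L\<^esub> e (push S t d)) < \<epsilon>})"

definition Dopen_t :: "('q, 'n) mat \<Rightarrow> real \<Rightarrow> (real \<Rightarrow> 'a) set" where
  "Dopen_t t r1 = {y \<in> carrier (Dopen r1). \<forall>r2\<in>above r1. y r2 \<in> Dclosure t r1 r2}"

definition R0_t :: "('q, 'n) mat \<Rightarrow> 'a R0elt ring" where
  "R0_t t = R0\<lparr>carrier := {R0_class r1 y | r1 y. invertible_radius t r1 \<and> y \<in> Dopen_t t r1}\<rparr>"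

text \<open>\<open>mtrans t1 t2\<close> is the continuous (for the inductive limit of Frechet topologies) injective
  extension of conjugation by \<open>t2 t1\<^sup>-\<^sup>1\<close>, which maps \<open>push t1 d\<close> to \<open>push t2 d\<close>.\<close>

definition valid_transitions :: bool where
  "valid_transitions \<longleftrightarrow>
     ind_system (Tplus S) (le_alpha S) R0_t (mtrans M)
     \<and> (\<forall>t1\<in>Tplus S. \<forall>t2\<in>Tplus S. le_alpha S t1 t2 \<longrightarrow>
          inj_on (mtrans M t1 t2) (carrier (R0_t t1))
          \<and> (\<forall>d\<in>distN0 S. mtrans M t1 t2 (R0_incl (push S t1 d)) = R0_incl (push S t2 d))
          \<and> (\<forall>r1. invertible_radius t1 r1 \<longrightarrow> (\<exists>r1' h. invertible_radius t2 r1'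
               \<and> (\<forall>y\<in>Dopen_t t1 r1. h y \<in> Dopen_t t2 r1'
                    \<and> mtrans M t1 t2 (R0_class r1 y) = R0_class r1' (h y))
               \<and> (\<forall>r2'\<in>above r1'. \<exists>r2\<in>above r1. \<exists>C. \<forall>y\<in>Dopen_t t1 r1.
                    mmax r1' r2' (h y r2') \<le> C * mmax r1 r2 (y r2)))))"

definition valid_microloc :: bool where
  "valid_microloc \<longleftrightarrow>
     (\<forall>(r1, r2)\<in>intervals. is_microlocalization r1 r2)
     \<and> valid_restrictions \<and> valid_transitions"

text \<open>\<open>\<R>(N\<^sub>1, \<ell>)\<close>, and the inclusions of \<open>\<RR>\<^sub>0\<close> (as component \<open>t = 1\<close>) and of the distributions.\<close>

definition R_N1_ell :: "(('q, 'n) mat \<times> 'a R0elt) set ring" where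
  "R_N1_ell = ind_lim (Tplus S) (le_alpha S) R0_t (mtrans M)"

definition R0_to_R :: "'a R0elt \<Rightarrow> (('q, 'n) mat \<times> 'a R0elt) set" where
  "R0_to_R C = ind_class (Tplus S) (le_alpha S) R0_t (mtrans M) (mat 1) C"

definition dist_to_R :: "('q, 'k, 'n) distr \<Rightarrow> (('q, 'n) mat \<times> 'a R0elt) set" where
  "dist_to_R d = R0_to_R (R0_incl d)"

end


section \<open>The Robba ring and R[[N\_1, l]]\<close>

text \<open>The Robba ring, as Laurent series given by their coefficients.\<close>

definition robba :: "(int \<Rightarrow> 'k::nonarch_field) ring" where
  "robba = \<lparr>carrier = {a. \<exists>r0. 0 < r0 \<and> r0 < 1 \<and>
        (\<forall>r. r0 \<le> r \<and> r < 1 \<longrightarrow> (\<forall>\<epsilon>>0. finite {n. vabs (a n) * r powi n \<ge> \<epsilon>}))},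
     mult = (\<lambda>a b n. infsum (\<lambda>i. a i * b (n - i)) UNIV),
     one = (\<lambda>n. if n = 0 then 1 else 0), zero = (\<lambda>_. 0), add = (\<lambda>a b n. a n + b n)\<rparr>"

definition robba_chi :: "nat \<Rightarrow> int \<Rightarrow> 'k::nonarch_field" where
  "robba_chi i = (\<lambda>n. if n = 0 \<or> n = 1 then 1 else 0) [^]\<^bsub>robba\<^esub> i"

definition robba_phi :: "nat \<Rightarrow> (int \<Rightarrow> 'k::nonarch_field) \<Rightarrow> int \<Rightarrow> 'k" where
  "robba_phi p a = (\<lambda>m. infsum
     (\<lambda>n::int. a n * ((robba_chi p \<ominus>\<^bsub>robba\<^esub> \<one>\<^bsub>robba\<^esub>) [^]\<^bsub>robba\<^esub> n) m) UNIV)"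

text \<open>The components \<open>r\<^sub>i\<close> in \<open>r = \<Sum>\<^sub>i \<chi>(i) \<phi>\<^sup>c(r\<^sub>i)\<close>, \<open>0 \<le> i < p\<^sup>c\<close>.\<close>

definition robba_decomp :: "nat \<Rightarrow> nat \<Rightarrow> (int \<Rightarrow> 'k::nonarch_field) \<Rightarrow> nat \<Rightarrow> int \<Rightarrow> 'k" where
  "robba_decomp p c r = (THE F. F \<in> {..<p ^ c} \<rightarrow>\<^sub>E carrier robba
     \<and> r = (\<lambda>m. \<Sum>i<p ^ c. (robba_chi i \<otimes>\<^bsub>robba\<^esub> (robba_phi p ^^ c) (F i)) m))"

context
  fixes S :: "('q::nonarch_field, 'k::nonarch_field, 'n::finite) setting"
begin

text \<open>\<open>\<R>[N\<^sub>1/N\<^sub>k, \<ell>]\<close>: an element \<open>\<Sum>\<^sub>h r\<^sub>h h\<close> is the function \<open>h \<mapsto> r\<^sub>h\<close> on the cosets; the product is the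
  biadditive extension of the one on the \<open>r h\<close>.\<close>

definition robba_N1 :: "nat \<Rightarrow> (('q, 'n) mat set \<Rightarrow> int \<Rightarrow> 'k) ring" where
  "robba_N1 k = (let Q = N1_mod S k; c = cexp S k; p = prm S in
     \<lparr>carrier = {f \<in> Q \<rightarrow>\<^sub>E carrier robba. finite {h \<in> Q. f h \<noteq> \<zero>\<^bsub>robba\<^esub>}},
      mult = (\<lambda>f g. \<lambda>u\<in>Q. \<lambda>m.
        \<Sum>(h1, h2, i) \<in> {(h1, h2, i). h1 \<in> Q \<and> f h1 \<noteq> \<zero>\<^bsub>robba\<^esub> \<and> h2 \<in> Q \<and> g h2 \<noteq> \<zero>\<^bsub>robba\<^esub>
            \<and> i < p ^ c \<and> conj_coset S (of_nat i) h1 <#>\<^bsub>GLm\<^esub> h2 = u}.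
          (f h1 \<otimes>\<^bsub>robba\<^esub> robba_chi i \<otimes>\<^bsub>robba\<^esub>
             (robba_phi p ^^ c) (robba_decomp p c (g h2) i)) m),
      one = (\<lambda>u\<in>Q. if u = Nk S k then \<one>\<^bsub>robba\<^esub> else \<zero>\<^bsub>robba\<^esub>),
      zero = (\<lambda>u\<in>Q. \<zero>\<^bsub>robba\<^esub>),
      add = (\<lambda>f g. \<lambda>u\<in>Q. f u \<oplus>\<^bsub>robba\<^esub> g u)\<rparr>)"

definition robba_N1_proj :: "nat \<Rightarrow> nat \<Rightarrow> (('q, 'n) mat set \<Rightarrow> int \<Rightarrow> 'k) \<Rightarrow>
    ('q, 'n) mat set \<Rightarrow> int \<Rightarrow> 'k" where
  "robba_N1_proj k' k f = (\<lambda>u\<in>N1_mod S k. \<lambda>m.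
     \<Sum>v\<in>{v \<in> N1_mod S k'. v \<subseteq> u \<and> f v \<noteq> \<zero>\<^bsub>robba\<^esub>}. f v m)"

definition R_bb_N1_ell :: "(nat \<Rightarrow> ('q, 'n) mat set \<Rightarrow> int \<Rightarrow> 'k) ring" where
  "R_bb_N1_ell = proj_lim {1..} (\<le>) robba_N1 robba_N1_proj"

text \<open>The projection \<open>D(N\<^sub>1,K) \<rightarrow> K[N\<^sub>1/N\<^sub>k]\<close>: the coefficient at the coset \<open>u\<close> is the value of the
  distribution at the indicator function of \<open>u\<close>.\<close>

definition proj_coeff :: "('q, 'k, 'n) distr \<Rightarrow> ('q, 'n) mat set \<Rightarrow> 'k" where
  "proj_coeff d u = dist_apply S d (\<lambda>g. if g \<in> u then 1 else 0)"

end

context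
  fixes S :: "('q::nonarch_field, 'k::nonarch_field, 'n::finite) setting"
    and M :: "('q, 'k, 'n, 'a) microloc"
begin

text \<open>The family \<open>y\<close> represents \<open>\<Sum>\<^sub>n b\<^sub>\<alpha>\<^sup>n f\<^sub>n\<close> in \<open>D\<^bsub>[r1,1)\<^esub>(N\<^sub>0,K,\<alpha>)\<close>.\<close>

definition has_expansion :: "real \<Rightarrow> (real \<Rightarrow> 'a) \<Rightarrow> (int \<Rightarrow> ('q, 'k, 'n) distr) \<Rightarrow> bool" where
  "has_expansion r1 y f \<longleftrightarrow> (\<forall>r2\<in>above S r1. let L = mring M r1 r2; e = memb M r1 r2 in
     \<forall>\<epsilon>>0. \<exists>F. finite F \<and> (\<forall>F'. finite F' \<and> F \<subseteq> F' \<longrightarrow>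
       mmax M r1 r2 (y r2 \<ominus>\<^bsub>L\<^esub>
         finsum L (\<lambda>n. e (bvar (alpha S)) [^]\<^bsub>L\<^esub> n \<otimes>\<^bsub>L\<^esub> e (f n)) F') < \<epsilon>))"

definition natural_map ::
    "((('q, 'n) mat \<times> 'a R0elt) set \<Rightarrow> nat \<Rightarrow> ('q, 'n) mat set \<Rightarrow> int \<Rightarrow> 'k) \<Rightarrow> bool" where
  "natural_map j \<longleftrightarrow> j \<in> ring_hom (R_N1_ell S M) (R_bb_N1_ell S)
     \<and> (\<forall>r1\<in>radii S. \<forall>y\<in>carrier (Dopen S M r1). \<forall>f. (\<forall>n. f n \<in> distN1 S) \<and> has_expansion r1 y f \<longrightarrow>
          j (R0_to_R S M (R0_class S M r1 y)) =
            (\<lambda>k\<in>{1..}. \<lambda>u\<in>N1_mod S k. \<lambda>n. proj_coeff S (f n) u))"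

end

end

theory Submission
  imports Defs
begin

text \<open>
  Conjugation by \<open>s\<close> maps \<open>n\<^sub>\<beta>\<close> to the power \<open>n\<^sub>\<beta>\<^sup>q\<close> with \<open>q = \<beta>(\<xi>(p))\<close> a power of \<open>p\<close>, so some power
  of \<open>n\<^sub>\<beta>\<close> lies in \<open>N\<^sub>k\<close> and the function \<open>i \<mapsto> 1\<^sub>u(n\<^sub>\<beta>\<^sup>i)\<close> is periodic for every coset \<open>u\<close> of \<open>N\<^sub>k\<close>. The
  distribution \<open>log n\<^sub>\<beta>\<close> is the derivative at \<open>0\<close> along \<open>z \<mapsto> n\<^sub>\<beta>\<^sup>z\<close>, hence it kills these locally constant
  functions and has image \<open>0\<close> in every \<open>K[N\<^sub>1/N\<^sub>k]\<close>. It is nonzero in the inductive limit because all the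
  structure maps are injective.
\<close>

text \<open>The product and \<open>push\<close> on D(N_0,K) are defined through
  \<open>coords\<close> and \<open>zp_pow\<close>, which are definite descriptions. The proof
  therefore stays with distributions supported on the powers of a single b_\<beta>: for these only
  the values at the natural powers n_\<beta>^i enter, and their coordinates are explicit once
  n_\<beta> is known to be nontrivial. Three inputs are less direct than they look. That \<xi>(p) is
  a rational point, so that s exists at all, has to be extracted from the splitting of T. That
  n_\<beta> lies in N_1 is not part of the setting; for \<beta> not simple it comes from comparing
  the actions of s on N_\<beta> (power p^h, h the height of \<beta>) and on N/[N,N] (power p). That
  log n_\<beta> lies in the component t = 1 requires \<open>push\<close> along the identity to fix
  it, which is the duality of Mahler functions and monomials.\<close>

no_notation fps_nth (infixl "$" 75)


section \<open>Non-archimedean fields\<close>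

lemma vabs_eq_dist: "vabs x = dist x 0" for x :: "'a::nonarch_field"
  by (simp add: dist_vabs)

lemma vabs_ge_0 [simp]: "vabs x \<ge> 0" for x :: "'a::nonarch_field"
  by (simp add: vabs_eq_dist)

lemma vabs_zero [simp]: "vabs (0 :: 'a::nonarch_field) = 0"
  by (simp add: vabs_eq_dist)

lemma vabs_eq_0_iff [simp]: "vabs x = 0 \<longleftrightarrow> x = 0" for x :: "'a::nonarch_field"
  by (simp add: vabs_eq_dist)

lemma vabs_one [simp]: "vabs (1 :: 'a::nonarch_field) = 1"
  using vabs_mult[of "1 :: 'a" 1] by simp

lemma vabs_minus [simp]: "vabs (- x) = vabs x" for x :: "'a::nonarch_field"
  using dist_vabs[of 0 x] dist_vabs[of x 0] by (simp add: dist_commute)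

lemma vabs_diff: "vabs (x - y) \<le> max (vabs x) (vabs y)" for x y :: "'a::nonarch_field"
  using vabs_add[of x "- y"] by simp

lemma vabs_power: "vabs (x ^ n) = vabs x ^ n" for x :: "'a::nonarch_field"
  by (induction n) (auto simp: vabs_mult)

lemma vabs_divide: "vabs (x / y) = vabs x / vabs y" for x y :: "'a::nonarch_field"
proof (cases "y = 0")
  case False
  then have "vabs x = vabs (x / y) * vabs y" by (simp flip: vabs_mult)
  with False show ?thesis by (simp add: field_simps)
qed simp

lemma vabs_sum_le:
  fixes f :: "'b \<Rightarrow> 'a::nonarch_field"
  assumes "\<And>i. i \<in> A \<Longrightarrow> vabs (f i) \<le> B" "0 \<le> B"
  shows "vabs (sum f A) \<le> B"
  using assms
proof (induction A rule: infinite_finite_induct)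
  case (insert x F)
  then show ?case using vabs_add[of "f x" "sum f F"] by fastforce
qed auto

lemma vabs_of_nat_le_1: "vabs (of_nat n :: 'a::nonarch_field) \<le> 1"
proof (induction n)
  case (Suc n)
  then show ?case using vabs_add[of "1 :: 'a" "of_nat n"] by simp
qed simp

lemma vabs_of_int_le_1: "vabs (of_int n :: 'a::nonarch_field) \<le> 1"
  using vabs_of_nat_le_1[of "nat \<bar>n\<bar>", where 'a='a]
  by (cases "n \<ge> 0") auto

text \<open>Continuity of the ring operations makes \<open>tendsto_add\<close>,
  \<open>tendsto_mult\<close> and with them polynomial maps available over
  \<open>nonarch_field\<close>, which is a priori only a metric space. By the ultrametric inequality
  the same e serves for both summands.\<close>

instance nonarch_field \<subseteq> topological_monoid_add
proof
  fix a b :: 'a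
  show "((\<lambda>x. fst x + snd x) \<longlongrightarrow> a + b) (nhds a \<times>\<^sub>F nhds b)"
  proof (rule tendstoI)
    fix e :: real assume e: "e > 0"
    have "eventually (\<lambda>x. dist x a < e) (nhds a)" "eventually (\<lambda>x. dist x b < e) (nhds b)"
      using e by (auto simp: eventually_nhds_metric)
    moreover have "dist (x + y) (a + b) < e" if "dist x a < e" "dist y b < e" for x y
      using that vabs_add[of "x - a" "y - b"] by (simp add: dist_vabs algebra_simps)
    ultimately show "eventually (\<lambda>x. dist (fst x + snd x) (a + b) < e) (nhds a \<times>\<^sub>F nhds b)"
      unfolding eventually_prod_filter by (intro exI conjI) auto
  qed
qed

instance nonarch_field \<subseteq> topological_semigroup_mult
proof
  fix a b :: 'a
  show "((\<lambda>x. fst x * snd x) \<longlongrightarrow> a * b) (nhds a \<times>\<^sub>F nhds b)"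
  proof (rule tendstoI)
    fix e :: real assume e: "e > 0"
    \<comment> \<open>The splitting is x y - a b = x (y - b) + b (x - a). Close to a one has |x|
      \<le> max |a| 1, so B bounds both cofactors.\<close>
    define B where "B = max (vabs a) 1 + vabs b"
    have B: "B > 0" "max (vabs a) 1 \<le> B" "vabs b \<le> B" by (auto simp: B_def add_pos_nonneg)
    define d where "d = min 1 (e / B)"
    have d: "d > 0" "d \<le> 1" "d * B \<le> e" using e B by (auto simp: d_def min_def field_simps)
    have "eventually (\<lambda>x. dist x a < d) (nhds a)" "eventually (\<lambda>x. dist x b < d) (nhds b)"
      using d by (auto simp: eventually_nhds_metric)
    moreover have "dist (x * y) (a * b) < e" if xy: "dist x a < d" "dist y b < d" for x y
    proof -
      have x: "vabs x \<le> max (vabs a) 1"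
        using vabs_add[of a "x - a"] xy d by (auto simp: dist_vabs)
      have aux: "u * v < d * B" if "0 \<le> v" "u \<le> B" "v < d" for u v
      proof -
        have "u * v \<le> B * v" using that by (simp add: mult_right_mono)
        also have "\<dots> < B * d" using that B by simp
        finally show ?thesis by (simp add: mult.commute)
      qed
      have "vabs (x * (y - b)) < d * B"
        unfolding vabs_mult by (rule aux) (use x xy B in \<open>auto simp: dist_vabs\<close>)
      moreover have "vabs (b * (x - a)) < d * B"
        unfolding vabs_mult by (rule aux) (use xy B in \<open>auto simp: dist_vabs\<close>)
      ultimately show ?thesis
        using vabs_add[of "x * (y - b)" "b * (x - a)"] d
        by (simp add: dist_vabs algebra_simps)
    qed
    ultimately show "eventually (\<lambda>x. dist (fst x * snd x) (a * b) < e) (nhds a \<times>\<^sub>F nhds b)"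
      unfolding eventually_prod_filter by (intro exI conjI) auto
  qed
qed

lemma tendsto_poly_nonarch:
  fixes P :: "'a::nonarch_field poly"
  assumes "(u \<longlongrightarrow> z) F"
  shows "((\<lambda>i. poly P (u i)) \<longlongrightarrow> poly P z) F"
  by (induction P) (auto intro!: tendsto_add tendsto_mult assms)

text \<open>In a Bezout relation u m + w p = 1 the second term has absolute value below 1, so the
  ultrametric inequality forces |u m| \<ge> 1, while no integer exceeds 1 in absolute value.\<close>

lemma vabs_of_int_coprime:
  assumes "Factorial_Ring.prime p" "vabs (of_nat p :: 'a::nonarch_field) < 1" "gcd m (int p) = 1"
  shows "vabs (of_int m :: 'a) = 1"
proof -
  obtain u w where "u * m + w * int p = 1"
    using assms(3) bezout_int[of m "int p"] by auto
  then have "(of_int u * of_int m + of_int w * of_nat p :: 'a) = 1"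
    by (metis of_int_1 of_int_add of_int_mult of_int_of_nat_eq)
  then have "1 \<le> max (vabs (of_int u * of_int m :: 'a)) (vabs (of_int w * of_nat p :: 'a))"
    using vabs_add[of "of_int u * of_int m :: 'a" "of_int w * of_nat p"] by simp
  moreover have "vabs (of_int w * of_nat p :: 'a) < 1"
    unfolding vabs_mult using assms(2) vabs_of_int_le_1[of w, where 'a='a]
    by (metis mult_left_le_one_le order_le_less_trans vabs_ge_0)
  moreover have "vabs (of_int u * of_int m :: 'a) \<le> vabs (of_int m :: 'a)"
    unfolding vabs_mult using vabs_of_int_le_1[of u, where 'a='a]
    by (simp add: mult_left_le_one_le)
  ultimately show ?thesis using vabs_of_int_le_1[of m, where 'a='a] by linarith
qed

text \<open>Here |n| = p^(-v) with p^v the exact power of p in n, and p^v \<le> n. The bound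
  controls the denominators k of the logarithm series.\<close>

lemma vabs_of_nat_ge:
  assumes "Factorial_Ring.prime p" "vabs (of_nat p :: 'a::nonarch_field) = 1 / real p" "n > 0"
  shows "1 / real n \<le> vabs (of_nat n :: 'a)"
proof -
  have "\<not> is_unit p" using assms(1) by (meson not_prime_unit)
  then obtain m where m: "n = p ^ multiplicity p n * m" "\<not> p dvd m"
    using multiplicity_decompose'[of n p] assms(3) by (auto simp: mult.commute)
  define v where "v = multiplicity p n"
  have p1: "p > 1" using assms(1) prime_gt_1_nat by blast
  have "gcd (int m) (int p) = 1"
    using m(2) assms(1) prime_imp_coprime[of p m]
    by (metis coprime_iff_gcd_eq_1 coprime_commute gcd_int_int_eq of_nat_1)
  then have "vabs (of_nat m :: 'a) = 1"
    using vabs_of_int_coprime[of p "int m", where 'a='a] assms p1 by simp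
  then have "vabs (of_nat n :: 'a) = (1 / real p) ^ v"
    by (subst m(1)) (simp add: vabs_mult vabs_power assms(2) v_def)
  moreover have "p ^ v \<le> n" using m(1) assms(3) v_def
    by (metis dvd_imp_le multiplicity_dvd)
  then have "real p ^ v \<le> real n" by (metis of_nat_le_iff of_nat_power)
  ultimately show ?thesis using p1 by (simp add: power_divide frac_le)
qed

text \<open>Serves \<open>zp_pow\<close>, which is defined by limits along such sequences. Take a
  rational a/b near z in lowest terms: |a/b| \<le> 1 forces b to be prime to p, so a/b has a residue
  modulo p^M, and that residue is a natural number near z.\<close>

lemma nat_dense_valuation_ring:
  fixes z :: "'q::nonarch_field"
  assumes Q: "is_Qp p TYPE('q)" and z: "vabs z \<le> 1"
  shows "\<exists>e::nat \<Rightarrow> nat. (\<lambda>i. of_nat (e i)) \<longlonglongrightarrow> z"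
proof -
  have p: "Factorial_Ring.prime p" "vabs (of_nat p :: 'q) = 1 / real p" "closure (\<rat> :: 'q set) = UNIV"
    using Q by (auto simp: is_Qp_def)
  have p1: "p > 1" using p(1) prime_gt_1_nat by blast
  have ex: "\<exists>n. dist (of_nat n) z < \<epsilon>" if \<epsilon>: "\<epsilon> > 0" for \<epsilon>
  proof -
    obtain M where M: "(1 / real p) ^ M < \<epsilon>"
      using real_arch_pow_inv[OF \<epsilon>, of "1 / real p"] p1 by auto
    \<comment> \<open>Distance below 1 keeps r in the valuation ring, since |z| \<le> 1.\<close>
    obtain r where r: "r \<in> \<rat>" "dist r z < min \<epsilon> 1"
      using p(3) \<epsilon> by (metis UNIV_I closure_approachable min_less_iff_conj zero_less_one)
    obtain r' where r': "r = of_rat r'" using r(1) by (auto elim: Rats_cases)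
    obtain a b where ab: "quotient_of r' = (a, b)" by fastforce
    have b: "b > 0" "gcd a b = 1" using ab quotient_of_denom_pos quotient_of_coprime by (auto simp: coprime_iff_gcd_eq_1)
    have rab: "r = of_int a / of_int b"
      using quotient_of_div[OF ab] r' by (simp add: of_rat_divide)
    have r1: "vabs r \<le> 1"
      using vabs_add[of "r - z" z] r(2) z by (auto simp: dist_vabs)
    have cop: "gcd b (int p) = 1"
    proof (rule ccontr)
      assume "gcd b (int p) \<noteq> 1"
      then have pb: "int p dvd b"
        using p(1) by (metis gcd.commute coprime_iff_gcd_eq_1 prime_imp_coprime prime_nat_int_transfer)
      then obtain c where c: "b = int p * c" by blast
      have "gcd a (int p) = 1" using b(2) pb by (metis coprime_divisors coprime_iff_gcd_eq_1 dvd_refl)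
      then have "vabs (of_int a :: 'q) = 1" using vabs_of_int_coprime[where 'a='q, OF p(1)] p p1 by simp
      moreover have "vabs (of_int b :: 'q) < 1"
      proof -
        have "vabs (of_int b :: 'q) = vabs (of_int c :: 'q) / real p"
          by (simp add: c vabs_mult p(2))
        also have "\<dots> \<le> 1 / real p" using vabs_of_int_le_1[of c, where 'a='q] by (simp add: divide_right_mono)
        also have "\<dots> < 1" using p1 by simp
        finally show ?thesis .
      qed
      moreover have "vabs (of_int b :: 'q) > 0" using b(1) by (simp add: order_less_le)
      ultimately have "vabs r > 1" by (simp add: rab vabs_divide)
      with r1 show False by simp
    qed
    then have "gcd b (int p ^ M) = 1"
      by (metis coprime_iff_gcd_eq_1 coprime_power_right_iff)
    then obtain u w where uw: "u * b + w * int p ^ M = 1"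
      using bezout_int[of b "int p ^ M"] by auto
    \<comment> \<open>By Bezout u is the inverse of b modulo p^M, so b n and a agree modulo
      p^M.\<close>
    define n where "n = nat ((a * u) mod (int p ^ M))"
    have n: "int n = (a * u) mod (int p ^ M)" using p1 by (simp add: n_def)
    have "int p ^ M dvd int n - a * u" by (metis mod_eq_dvd_iff mod_mod_trivial n)
    then obtain c where c: "int n - a * u = int p ^ M * c" by blast
    have "b * int n - a = b * (int n - a * u) - a * (1 - u * b)" by (simp add: algebra_simps)
    also have "\<dots> = int p ^ M * (b * c - a * w)"
    proof -
      have "1 - u * b = w * int p ^ M" using uw by simp
      then show ?thesis by (simp only: c) (simp add: algebra_simps)
    qed
    finally have eq: "b * int n - a = int p ^ M * (b * c - a * w)" .
    have vb: "vabs (of_int b :: 'q) = 1" using vabs_of_int_coprime[where 'a='q, OF p(1)] cop p p1 by simp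
    have "vabs (of_nat n - r) = vabs ((of_int b * of_nat n - of_int a) / of_int b :: 'q)"
      using b(1) by (simp add: rab field_simps)
    also have "\<dots> = vabs (of_int (b * int n - a) :: 'q)" by (simp add: vabs_divide vb)
    also have "\<dots> = (1 / real p) ^ M * vabs (of_int (b * c - a * w) :: 'q)"
      unfolding eq by (simp add: vabs_mult vabs_power p(2) del: of_int_diff)
    also have "\<dots> \<le> (1 / real p) ^ M" by (intro mult_left_le vabs_of_int_le_1) simp
    finally have "vabs (of_nat n - r) < \<epsilon>" using M by linarith
    then show ?thesis
      using r(2) vabs_add[of "of_nat n - r" "r - z"] by (intro exI[of _ n]) (auto simp: dist_vabs)
  qed
  have "\<forall>i. \<exists>n. dist (of_nat n) z < 1 / real (Suc i)" using ex by simp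
  then obtain e where e: "\<And>i. dist (of_nat (e i)) z < 1 / real (Suc i)" by metis
  have "(\<lambda>i. dist (of_nat (e i)) z) \<longlonglongrightarrow> 0"
    by (rule tendsto_sandwich[OF _ _ tendsto_const lim_1_over_n[THEN LIMSEQ_Suc]])
       (use less_imp_le[OF e] in auto)
  then show ?thesis by (subst (asm) tendsto_dist_iff[symmetric]) blast
qed

section \<open>Finite differences\<close>

text \<open>The matrices binom(k,i) and (-1)^(k-i) binom(k,i) are inverse to each other. Trinomial
  revision pulls out binom(k,j) and leaves an alternating row sum of Pascal's triangle, which
  vanishes except in row 0.\<close>

lemma binomial_orthogonality:
  "(\<Sum>i\<le>k. (-1) ^ (k - i) * of_nat (k choose i) * of_nat (i choose j)) = (if k = j then 1 else 0 :: 'a::comm_ring_1)"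
proof (cases "j \<le> k")
  case True
  have "(\<Sum>i\<le>k. (-1) ^ (k - i) * of_nat (k choose i) * of_nat (i choose j) :: 'a)
      = (\<Sum>i\<in>{j..k}. (-1) ^ (k - i) * of_nat (k choose i) * of_nat (i choose j))"
    by (rule sum.mono_neutral_right) (auto simp: binomial_eq_0)
  also have "\<dots> = (\<Sum>i\<in>{j..k}. of_nat (k choose j) * ((-1) ^ (k - i) * of_nat ((k - j) choose (k - i))))"
  proof (rule sum.cong)
    fix i assume "i \<in> {j..k}"
    then have i: "j \<le> i" "i \<le> k" by auto
    have "(k choose i) * (i choose j) = (k choose j) * ((k - j) choose (i - j))"
      using choose_mult[OF i] .
    also have "(k - j) choose (i - j) = (k - j) choose (k - i)"
      using binomial_symmetric[of "i - j" "k - j"] i by simp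
    finally have "(of_nat (k choose i) * of_nat (i choose j) :: 'a)
        = of_nat (k choose j) * of_nat ((k - j) choose (k - i))" by (metis of_nat_mult)
    then show "(-1) ^ (k - i) * of_nat (k choose i) * of_nat (i choose j)
        = (of_nat (k choose j) * ((-1) ^ (k - i) * of_nat ((k - j) choose (k - i))) :: 'a)"
      by (simp add: mult.assoc)
  qed simp
  also have "\<dots> = (\<Sum>i\<le>k - j. of_nat (k choose j) * ((-1) ^ i * of_nat ((k - j) choose i)))"
    by (rule sum.reindex_bij_witness[of _ "\<lambda>i. k - i" "\<lambda>i. k - i"]) (use True in auto)
  also have "\<dots> = of_nat (k choose j) * (\<Sum>i\<le>k - j. ((-1) ^ i * of_nat ((k - j) choose i)))"
    by (simp add: sum_distrib_left)
  also have "\<dots> = (if k = j then 1 else 0)"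
    using choose_alternating_sum[of "k - j", where 'a='a] True by auto
  finally show ?thesis .
next
  case False
  then show ?thesis by (auto intro!: sum.neutral simp: binomial_eq_0)
qed

text \<open>The k-th forward difference of f at 0, that is, the value on f of (n - 1)^k in the group
  ring when f is a function of the exponent of n. This is the inner sum of \<open>dist_apply\<close>
  along a single root.\<close>

definition mahler_coeff :: "(nat \<Rightarrow> 'a::comm_ring_1) \<Rightarrow> nat \<Rightarrow> 'a" where
  "mahler_coeff f k = (\<Sum>i\<le>k. (-1) ^ (k - i) * of_nat (k choose i) * f i)"

lemma mahler_coeff_0 [simp]: "mahler_coeff f 0 = f 0"
  by (simp add: mahler_coeff_def)

lemma mahler_coeff_binomial:
  "mahler_coeff (\<lambda>i. of_nat (i choose j)) k = (if k = j then 1 else 0)"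
  unfolding mahler_coeff_def by (rule binomial_orthogonality)

text \<open>Orthogonality becomes inversion by exchanging the sums. The range of i is first enlarged
  to {..N}, at no cost because the added binomials vanish.\<close>

lemma newton_forward: "f N = (\<Sum>k\<le>N. of_nat (N choose k) * mahler_coeff f k)"
proof -
  have "(\<Sum>k\<le>N. of_nat (N choose k) * mahler_coeff f k)
      = (\<Sum>k\<le>N. \<Sum>i\<le>N. of_nat (N choose k) * ((-1) ^ (k - i) * of_nat (k choose i) * f i))"
    unfolding mahler_coeff_def sum_distrib_left
    by (intro sum.cong refl sum.mono_neutral_left) (auto simp: binomial_eq_0)
  also have "\<dots> = (\<Sum>i\<le>N. \<Sum>k\<le>N. of_nat (N choose k) * ((-1) ^ (k - i) * of_nat (k choose i) * f i))"
    by (rule sum.swap)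
  also have "\<dots> = (\<Sum>i\<le>N. (-1) ^ (N - i) * f i * (\<Sum>k\<le>N. (-1) ^ (N - k) * of_nat (N choose k) * of_nat (k choose i)))"
    unfolding sum_distrib_left
  proof (intro sum.cong refl)
    fix i k assume ik: "i \<in> {..N}" "k \<in> {..N}"
    show "of_nat (N choose k) * ((-1) ^ (k - i) * of_nat (k choose i) * f i)
      = (-1) ^ (N - i) * f i * ((-1) ^ (N - k) * of_nat (N choose k) * of_nat (k choose i))"
    proof (cases "i \<le> k")
      case True
      then have "N - i = (N - k) + (k - i)" using ik by auto
      then have "(-1 :: 'a) ^ (N - i) = (-1) ^ (N - k) * (-1) ^ (k - i)" by (simp add: power_add)
      then have "(-1 :: 'a) ^ (k - i) = (-1) ^ (N - i) * (-1) ^ (N - k)"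
        by (metis left_minus_one_mult_self mult.commute)
      then show ?thesis by (simp add: mult_ac)
    qed (simp add: binomial_eq_0)
  qed
  also have "\<dots> = f N" by (simp add: binomial_orthogonality if_distrib cong: if_cong)
  finally show ?thesis ..
qed

text \<open>The upper index tends to -1, and binom(-1,k) = (-1)^k. In the induction, Pascal's rule
  gives binom(N,k) + binom(N,k+1) = (N+1)/(k+1) binom(N,k) with N + 1 = q p^j, which tends to
  0.\<close>

lemma binomial_pred_tendsto:
  assumes p: "Factorial_Ring.prime p" "vabs (of_nat p :: 'a::nonarch_field) = 1 / real p" and q: "q > 0"
  shows "(\<lambda>j. of_nat ((q * p ^ j - 1) choose k) :: 'a) \<longlonglongrightarrow> (-1) ^ k"
proof (induction k)
  case (Suc k)
  have p1: "p > 1" using p(1) prime_gt_1_nat by blast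
  have *: "of_nat ((q * p ^ j - 1) choose Suc k)
      = of_nat q / of_nat (Suc k) * of_nat p ^ j * of_nat ((q * p ^ j - 1) choose k)
        + (- 1) * (of_nat ((q * p ^ j - 1) choose k) :: 'a)" for j
  proof -
    define N where "N = q * p ^ j - 1"
    have N: "Suc N = q * p ^ j" using q p1 by (simp add: N_def)
    have "Suc k * (Suc N choose Suc k) = Suc N * (N choose k)" by (metis Suc_times_binomial_eq mult.commute)
    then have "of_nat (Suc k) * (of_nat (N choose k) + of_nat (N choose Suc k) :: 'a)
        = of_nat (q * p ^ j) * of_nat (N choose k)"
      unfolding N[symmetric] by (metis binomial_Suc_Suc of_nat_add of_nat_mult)
    then have "of_nat (N choose k) + of_nat (N choose Suc k)
        = (of_nat (q * p ^ j) * of_nat (N choose k) / of_nat (Suc k) :: 'a)"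
      by (simp add: eq_divide_eq mult.commute del: of_nat_Suc)
    then show ?thesis unfolding N_def[symmetric] by (simp add: algebra_simps)
  qed
  have "(\<lambda>j. (1 / real p) ^ j) \<longlonglongrightarrow> 0" using p1 by (intro LIMSEQ_realpow_zero) auto
  then have "(\<lambda>j. (of_nat p :: 'a) ^ j) \<longlonglongrightarrow> 0"
    by (simp add: tendsto_dist_iff[where l = "0 :: 'a"] flip: vabs_eq_dist) (simp add: vabs_power p)
  then have "(\<lambda>j. of_nat q / of_nat (Suc k) * of_nat p ^ j * of_nat ((q * p ^ j - 1) choose k)
        + (- 1) * (of_nat ((q * p ^ j - 1) choose k) :: 'a)) \<longlonglongrightarrow>
      of_nat q / of_nat (Suc k) * 0 * (-1) ^ k + (-1) * (-1) ^ k"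
    by (intro tendsto_add tendsto_mult tendsto_const Suc)
  then show ?case unfolding * by simp
qed simp

text \<open>This is the derivative at \<open>0\<close> of the locally constant function extending \<open>f\<close>: dividing
  \<open>f N - f 0 = 0\<close> by \<open>N\<close> gives \<open>\<Sum>\<^sub>k binom(N-1,k-1) a\<^sub>k / k = 0\<close>, and the binomials tend to
  \<open>(-1)\<^bsup>k-1\<^esup>\<close> for \<open>N = q p\<^sup>j\<close>. If the series did not converge, \<open>infsum\<close> would be \<open>0\<close> anyway.\<close>

lemma log_functional_periodic:
  fixes f :: "nat \<Rightarrow> 'a::nonarch_field"
  assumes p: "Factorial_Ring.prime p" "vabs (of_nat p :: 'a) = 1 / real p" and q: "q > 0"
    and f: "\<And>j. f (q * j) = f 0"
  shows "infsum (\<lambda>k. (if k \<ge> 1 then (-1) ^ (k + 1) / of_nat k else 0) * mahler_coeff f k) UNIV = 0"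
proof -
  define t where "t k = (if k \<ge> 1 then (-1) ^ (k + 1) / of_nat k else 0) * mahler_coeff f k" for k
  have p1: "p > 1" using p(1) prime_gt_1_nat by blast
  \<comment> \<open>c N k measures how far t k is from the k-th term of (f N - f 0) / N, which
    equals t k (1 - c N k). It is an integer, hence of absolute value at most 1, and for fixed k
    \<ge> 1 it tends to 0 along N = q p^j.\<close>
  define c where "c N k = (1 - (-1) ^ (k + 1) * of_nat ((N - 1) choose (k - 1)) :: 'a)" for N k
  have cint: "vabs (c N k) \<le> 1" for N k
  proof -
    have "c N k = of_int (1 - (-1) ^ (k + 1) * int ((N - 1) choose (k - 1)))" by (simp add: c_def)
    then show ?thesis using vabs_of_int_le_1 by metis
  qed
  have key: "(\<Sum>k\<in>F. t k) = (\<Sum>k\<in>F. t k * c (q * p ^ j) k)"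
    if F: "finite F" "{..q * p ^ j} \<subseteq> F" for F j
  proof -
    define N where "N = q * p ^ j"
    have N: "N > 0" using q p1 by (simp add: N_def)
    have "0 = f N - f 0" using f by (simp add: N_def)
    also have "\<dots> = (\<Sum>k\<in>{1..N}. of_nat (N choose k) * mahler_coeff f k)"
    proof -
      have "{..N} = insert 0 {1..N}" by auto
      then show ?thesis using newton_forward[of f N] by simp
    qed
    also have "\<dots> = (\<Sum>k\<in>{1..N}. of_nat N * (t k - t k * c N k))"
    proof (rule sum.cong)
      fix k assume "k \<in> {1..N}"
      then have k: "k \<ge> 1" by auto
      have "k * (N choose k) = N * ((N - 1) choose (k - 1))"
        using times_binomial_minus1_eq[of k N] k by simp
      then have "of_nat k * of_nat (N choose k) = (of_nat N * of_nat ((N - 1) choose (k - 1)) :: 'a)"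
        by (metis of_nat_mult)
      then have "of_nat (N choose k) = (of_nat N * of_nat ((N - 1) choose (k - 1)) / of_nat k :: 'a)"
        using k by (simp add: field_simps)
      moreover have "t k - t k * c N k = of_nat ((N - 1) choose (k - 1)) / of_nat k * mahler_coeff f k * ((-1) ^ (k + 1) * (-1) ^ (k + 1))"
      proof -
        have "e / l * m - e / l * m * (1 - e * B) = B / l * m * (e * e)" for e l m B :: 'a
          by (simp add: algebra_simps flip: add_divide_distrib)
        then show ?thesis unfolding t_def c_def using k by (simp only: if_True)
      qed
      ultimately show "of_nat (N choose k) * mahler_coeff f k = of_nat N * (t k - t k * c N k)"
        by simp
    qed simp
    also have "\<dots> = of_nat N * (\<Sum>k\<in>{1..N}. (t k - t k * c N k))" by (simp add: sum_distrib_left)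
    finally have "(\<Sum>k\<in>{1..N}. (t k - t k * c N k)) = 0" using N by simp
    moreover have "(\<Sum>k\<in>{1..N}. (t k - t k * c N k)) = (\<Sum>k\<in>F. (t k - t k * c N k))"
    proof (rule sum.mono_neutral_left)
      \<comment> \<open>The term k = 0 vanishes by t 0 = 0. For k > N the binomial in c is 0, so c N
        k = 1 and the difference vanishes.\<close>
      show "\<forall>k\<in>F - {1..N}. t k - t k * c N k = 0"
      proof
        fix k assume "k \<in> F - {1..N}"
        then consider "k = 0" | "k > N" by fastforce
        then show "t k - t k * c N k = 0"
          using N by cases (auto simp: t_def c_def binomial_eq_0)
      qed
    qed (use F in \<open>auto simp: N_def\<close>)
    ultimately show ?thesis by (simp add: sum_subtractf N_def)
  qed
  have "infsum t UNIV = 0"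
  proof (cases "t summable_on UNIV")
    case True
    then have hs: "(t has_sum infsum t UNIV) UNIV" by simp
    have "vabs (infsum t UNIV) \<le> \<epsilon>" if \<epsilon>: "\<epsilon> > 0" for \<epsilon>
    proof -
      obtain F0 where F0: "finite F0" "\<And>F. finite F \<Longrightarrow> F0 \<subseteq> F \<Longrightarrow> dist (sum t F) (infsum t UNIV) < \<epsilon>"
        using tendstoD[OF hs[unfolded has_sum_def] \<epsilon>] unfolding eventually_finite_subsets_at_top by auto
      \<comment> \<open>Adding one index to F0 hardly moves the partial sum, so every term outside
        F0 is small and |c| \<le> 1 suffices there. Only the finitely many indices in F0 need c to
        tend to 0.\<close>
      have small: "vabs (t k) < \<epsilon>" if "k \<notin> F0" for k
      proof -
        have "t k = (sum t (insert k F0) - infsum t UNIV) - (sum t F0 - infsum t UNIV)"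
          using F0(1) that by simp
        then show ?thesis
          using F0(2)[of F0] F0(2)[of "insert k F0"] F0(1) subset_insertI[of F0 k]
            vabs_diff[of "sum t (insert k F0) - infsum t UNIV" "sum t F0 - infsum t UNIV"]
          by (auto simp: dist_vabs)
      qed
      have "eventually (\<lambda>j. vabs (t k * c (q * p ^ j) k) < \<epsilon>) sequentially" for k
      proof (cases "k = 0")
        case False
        have "(\<lambda>j. t k * (1 + (- ((-1) ^ (k + 1))) * of_nat ((q * p ^ j - 1) choose (k - 1)))) \<longlonglongrightarrow>
            t k * (1 + (- ((-1) ^ (k + 1))) * (-1) ^ (k - 1))"
          by (intro tendsto_add tendsto_mult tendsto_const binomial_pred_tendsto p q)
        moreover have "(1 + (- ((-1) ^ (k + 1))) * (-1) ^ (k - 1) :: 'a) = 0"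
          using False by (cases k) auto
        ultimately have "(\<lambda>j. t k * c (q * p ^ j) k) \<longlonglongrightarrow> 0" by (simp add: c_def)
        from tendstoD[OF this \<epsilon>] show ?thesis by (simp add: dist_vabs)
      qed (use \<epsilon> in \<open>simp add: t_def\<close>)
      then have "eventually (\<lambda>j. \<forall>k\<in>F0. vabs (t k * c (q * p ^ j) k) < \<epsilon>) sequentially"
        using F0(1) by (simp add: eventually_ball_finite)
      then obtain j where j: "\<forall>k\<in>F0. vabs (t k * c (q * p ^ j) k) < \<epsilon>"
        by (auto simp: eventually_sequentially)
      define F where "F = F0 \<union> {..q * p ^ j}"
      have F: "finite F" "F0 \<subseteq> F" "{..q * p ^ j} \<subseteq> F" using F0(1) by (auto simp: F_def)
      have "vabs (\<Sum>k\<in>F. t k * c (q * p ^ j) k) \<le> \<epsilon>"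
      proof (rule vabs_sum_le)
        fix k assume "k \<in> F"
        show "vabs (t k * c (q * p ^ j) k) \<le> \<epsilon>"
        proof (cases "k \<in> F0")
          case False
          have "vabs (t k) * vabs (c (q * p ^ j) k) \<le> vabs (t k) * 1"
            by (rule mult_left_mono[OF cint]) simp
          then show ?thesis using small[OF False] by (simp add: vabs_mult)
        qed (use j in auto)
      qed (use \<epsilon> in auto)
      moreover have "sum t F = (\<Sum>k\<in>F. t k * c (q * p ^ j) k)" by (rule key) (use F in auto)
      ultimately have "vabs (sum t F) \<le> \<epsilon>" by simp
      then show ?thesis
        using F0(2)[OF F(1,2)] vabs_diff[of "sum t F" "sum t F - infsum t UNIV"]
        by (simp add: dist_vabs)
    qed
    then have "vabs (infsum t UNIV) \<le> 0" by (rule field_le_epsilon[of _ 0, simplified]) auto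
    then show ?thesis using vabs_ge_0[of "infsum t UNIV"] by (metis order_antisym vabs_eq_0_iff)
  qed (simp add: infsum_not_exists)
  then show ?thesis unfolding t_def .
qed


section \<open>Matrix groups and rational points\<close>

lemma carrier_GLm [simp]: "A \<in> carrier GLm \<longleftrightarrow> invertible A"
  and mult_GLm [simp]: "A \<otimes>\<^bsub>GLm\<^esub> B = A ** B"
  and one_GLm [simp]: "\<one>\<^bsub>GLm\<^esub> = mat 1"
  by (simp_all add: GLm_def)

lemma invertible_mat_1: "invertible (mat 1 :: ('e::field, 'n::finite) mat)"
  unfolding invertible_def by (rule exI[of _ "mat 1"]) simp

lemma group_GLm: "group (GLm :: ('e::field, 'n::finite) mat monoid)"
proof (rule groupI)
  fix A :: "('e, 'n) mat"
  assume "A \<in> carrier GLm"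
  then obtain B where B: "A ** B = mat 1" "B ** A = mat 1" by (auto simp: invertible_def)
  then have "B \<in> carrier GLm" by (auto simp: invertible_def)
  with B show "\<exists>B\<in>carrier GLm. B \<otimes>\<^bsub>GLm\<^esub> A = \<one>\<^bsub>GLm\<^esub>" by auto
qed (auto simp: invertible_mat_1 invertible_mult matrix_mul_assoc)

interpretation GL: group "GLm :: ('e::field, 'n::finite) mat monoid"
  by (rule group_GLm)

lemma inv_GLm_one [simp]: "inv\<^bsub>GLm\<^esub> (mat 1) = (mat 1 :: ('e::field, 'n::finite) mat)"
  by (metis GL.inv_one one_GLm)

lemma conj_by_one [simp]: "conj_by (mat 1) g = g"
  by (simp add: conj_by_def)

lemma group_hom_conj_by:
  fixes t :: "('e::field, 'n::finite) mat"
  assumes "invertible t"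
  shows "group_hom GLm GLm (conj_by t)"
proof -
  have "conj_by t (A ** B) = conj_by t A ** conj_by t B" if "invertible A" "invertible B" for A B
    using GL.m_assoc GL.inv_closed[of t] GL.l_inv[of t] assms that
    by (simp add: conj_by_def matrix_mul_assoc[symmetric])
       (metis (no_types, lifting) carrier_GLm matrix_mul_assoc matrix_mul_lid one_GLm mult_GLm)
  moreover have "invertible (conj_by t A)" if "invertible A" for A
    using GL.inv_closed[of t] assms that by (simp add: conj_by_def invertible_mult)
  ultimately show ?thesis
    by (intro group_hom.intro group_GLm group_hom_axioms.intro homI) auto
qed

lemma conj_by_mult:
  assumes "invertible t" "invertible u" "invertible g"
  shows "conj_by t (conj_by u g) = conj_by (t ** u) g"
  using GL.inv_mult_group[of t u] assms by (simp add: conj_by_def matrix_mul_assoc)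

lemma conj_by_inv:
  assumes "invertible t" "invertible g"
  shows "conj_by t (conj_by (inv\<^bsub>GLm\<^esub> t) g) = g"
  using GL.inv_closed[of t] GL.r_inv[of t] assms by (simp add: conj_by_mult)

lemma of_mat_mult: "of_mat (A ** B) = of_mat A ** of_mat B"
  by (simp add: of_mat_def matrix_matrix_mult_def vec_eq_iff to_ac_sum)

lemma of_mat_one [simp]: "of_mat (mat 1) = mat 1"
  by (simp add: of_mat_def mat_def vec_eq_iff)

lemma of_mat_eq_iff [simp]: "of_mat A = of_mat B \<longleftrightarrow> A = B"
  by (simp add: of_mat_def vec_eq_iff)

lemma invertible_of_mat [simp]: "invertible (of_mat A) \<longleftrightarrow> invertible A"
proof -
  have "det (of_mat A) = to_ac (det A)"
    by (simp add: det_def of_mat_def to_ac_sum to_ac_prod)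
  then show ?thesis by (simp add: invertible_det_nz)
qed

lemma of_mat_in_hom: "group_hom GLm GLm (of_mat :: ('q::field, 'n::finite) mat \<Rightarrow> _)"
  by (intro group_hom.intro group_GLm group_hom_axioms.intro homI) (auto simp: of_mat_mult)

lemma of_mat_inv: "invertible A \<Longrightarrow> of_mat (inv\<^bsub>GLm\<^esub> A) = inv\<^bsub>GLm\<^esub> (of_mat A)"
  using group_hom.hom_inv[OF of_mat_in_hom] by auto

lemma of_mat_pow: "invertible A \<Longrightarrow> of_mat (A [^]\<^bsub>GLm\<^esub> (k::nat)) = of_mat A [^]\<^bsub>GLm\<^esub> k"
  by (induction k) (auto simp: of_mat_mult)

lemma of_mat_conj_by: "invertible t \<Longrightarrow> of_mat (conj_by t g) = conj_by (of_mat t) (of_mat g)"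
  by (simp add: conj_by_def of_mat_mult of_mat_inv)

lemma subgroup_rational_points:
  assumes "subgroup H GLm"
  shows "subgroup (rational_points H) GLm"
proof (rule GL.subgroupI)
  show "rational_points H \<subseteq> carrier GLm"
    using subgroup.subset[OF assms] by (auto simp: rational_points_def)
  show "rational_points H \<noteq> {}"
    using subgroup.one_closed[OF assms] by (auto simp: rational_points_def intro!: exI[of _ "mat 1"])
  fix A assume A: "A \<in> rational_points H"
  then have "invertible A" using subgroup.subset[OF assms] by (auto simp: rational_points_def)
  with A show "inv\<^bsub>GLm\<^esub> A \<in> rational_points H"
    using subgroup.m_inv_closed[OF assms] by (auto simp: rational_points_def of_mat_inv)
  fix B assume "B \<in> rational_points H"
  with A show "A \<otimes>\<^bsub>GLm\<^esub> B \<in> rational_points H"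
    using subgroup.m_closed[OF assms] by (auto simp: rational_points_def of_mat_mult)
qed

text \<open>Induction by splitting off a point a of A: the quotient (P - P(a)) / (X - a) has smaller
  degree and still takes values in the base field on A without a. Later A consists of the natural
  numbers.\<close>

lemma poly_descent:
  fixes P :: "'q::field alg_closure poly"
  assumes "infinite A" "\<And>a. a \<in> A \<Longrightarrow> poly P (to_ac a) \<in> range to_ac"
  shows "\<exists>Q. \<forall>z. poly P (to_ac z) = to_ac (poly Q z)"
  using assms
proof (induction "Polynomial.degree P" arbitrary: P A rule: less_induct)
  case less
  obtain a where a: "a \<in> A" using less.prems(1) by fastforce
  obtain c where c: "poly P (to_ac a) = to_ac c" using less.prems(2)[OF a] by auto
  show ?case
  proof (cases "Polynomial.degree P = 0")
    case True
    then obtain d where d: "P = [:d:]" by (rule degree_eq_zeroE)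
    show ?thesis by (rule exI[of _ "[:c:]"]) (use c d in auto)
  next
    case False
    define R where "R = synthetic_div P (to_ac a)"
    have PR: "poly P z = (z - to_ac a) * poly R z + to_ac c" for z
      using arg_cong[OF synthetic_div_correct'[of "to_ac a" P], of "\<lambda>p. poly p z"]
      by (simp add: R_def c algebra_simps)
    have "poly R (to_ac b) \<in> range to_ac" if b: "b \<in> A - {a}" for b
    proof -
      obtain d where d: "poly P (to_ac b) = to_ac d" using less.prems(2) b by blast
      have "to_ac (b - a) * poly R (to_ac b) = to_ac (d - c)" using PR[of "to_ac b"] d by simp
      moreover have "to_ac (b - a) \<noteq> 0" using b by auto
      ultimately have "poly R (to_ac b) = to_ac ((d - c) / (b - a))"
        unfolding to_ac_divide by (simp add: nonzero_eq_divide_eq mult.commute)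
      then show ?thesis by (metis rangeI)
    qed
    moreover have "Polynomial.degree R < Polynomial.degree P"
      using False by (simp add: R_def degree_synthetic_div)
    ultimately obtain Q where "\<forall>z. poly R (to_ac z) = to_ac (poly Q z)"
      using less.hyps[of R "A - {a}"] less.prems(1) by auto
    then show ?thesis by (intro exI[of _ "[:- a, 1:] * Q + [:c:]"]) (simp add: PR algebra_simps)
  qed
qed

section \<open>Root subgroups\<close>

locale valid_setting_loc =
  fixes S :: "('q::nonarch_field, 'k::nonarch_field, 'n::finite) setting"
  assumes valid: "valid_setting S"
begin

lemma Qp: "is_Qp (prm S) TYPE('q)"
  and emb: "finite_extension_embedding (coeff_emb S)"
  and vgroup: "valid_group S"
  and vN0: "valid_N0 S"
  and vell: "valid_ell_proj S"
  and alpha_simple: "alpha S \<in> simple S"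
  using valid by (auto simp: valid_setting_def)

lemma prime_p: "Factorial_Ring.prime (prm S)"
  and vabs_p: "vabs (of_nat (prm S) :: 'q) = 1 / real (prm S)"
  using Qp by (auto simp: is_Qp_def)

lemma p_gt_1: "prm S > 1"
  using prime_p prime_gt_1_nat by blast

lemma alpha_pos: "alpha S \<in> pos_roots S"
  using vgroup alpha_simple by (auto simp: valid_group_def simple_roots_def)

lemma finite_pos: "finite (pos_roots S)"
  and root_order: "distinct (root_order S)" "set (root_order S) = pos_roots S"
  using valid List.finite_set[of "root_order S"] by (auto simp: valid_setting_def)

lemma top_gen_in: "b \<in> pos_roots S \<Longrightarrow> top_gen S b \<in> N0 S \<inter> root_pts S b"
  using valid by (auto simp: valid_setting_def)

lemma sub_N0: "subgroup (N0 S) GLm"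
  using vN0 by (auto simp: valid_N0_def)

lemma N0_invertible: "g \<in> N0 S \<Longrightarrow> invertible g"
  using subgroup.subset[OF sub_N0] by auto

lemma one_in_N0: "mat 1 \<in> N0 S"
  using subgroup.one_closed[OF sub_N0] by simp

lemma N0_pow: "g \<in> N0 S \<Longrightarrow> g [^]\<^bsub>GLm\<^esub> (k::nat) \<in> N0 S"
  using subgroup.m_closed[OF sub_N0] one_in_N0 by (induction k) auto

lemma top_gen_invertible: "b \<in> pos_roots S \<Longrightarrow> invertible (top_gen S b)"
  using top_gen_in N0_invertible by auto

lemma root_sub: "b \<in> pos_roots S \<Longrightarrow> root_subgroup (torusT S) b (root_grp S b)"
  using vgroup by (auto simp: valid_group_def)

lemma root_parametrization:
  assumes b: "b \<in> pos_roots S"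
  obtains x :: "'q alg_closure \<Rightarrow> ('q, 'n) gmat" and f where "range x = root_grp S b"
    "\<And>i j. \<exists>q. \<forall>a. x a $ i $ j = poly q a" "\<And>a. f (x a) = a"
    "\<And>a a'. x (a + a') = x a ** x a'" "x 0 = mat 1"
    "\<And>t a. t \<in> torusT S \<Longrightarrow> conj_by t (x a) = x (b t * a)"
    "\<And>a. invertible (x a)" "\<And>a k. x a [^]\<^bsub>GLm\<^esub> (k::nat) = x (of_nat k * a)"
proof -
  obtain x :: "'q alg_closure \<Rightarrow> ('q, 'n) gmat" and f where x: "range x = root_grp S b"
    "\<And>i j. \<exists>q. \<forall>a. x a $ i $ j = poly q a" "\<And>a. f (x a) = a"
    "\<And>a a'. x (a + a') = x a ** x a'"
    "\<And>t a. t \<in> torusT S \<Longrightarrow> conj_by t (x a) = x (b t * a)"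
    using root_sub[OF b] unfolding root_subgroup_def by metis
  have "subgroup (root_grp S b) GLm"
    using root_sub[OF b] by (auto simp: root_subgroup_def alg_group_def)
  then have inv: "invertible (x a)" for a
    using subgroup.subset x(1) by (metis carrier_GLm rangeI subsetD)
  have x0: "x 0 = mat 1"
  proof -
    have "x 0 \<otimes>\<^bsub>GLm\<^esub> x 0 = x 0" using x(4)[of 0 0] by simp
    then show ?thesis using GL.l_cancel_one[of "x 0" "x 0"] inv by simp
  qed
  have "x a [^]\<^bsub>GLm\<^esub> k = x (of_nat k * a)" for a and k :: nat
    by (induction k) (auto simp: x0 algebra_simps simp flip: x(4))
  with x inv x0 that show ?thesis by blast
qed

text \<open>The one-parameter group \<open>z \<mapsto> n\<^sub>b\<^sup>z\<close> is polynomial: its entries are polynomials over the algebraic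
  closure that take rational values at all natural numbers.\<close>

lemma top_gen_one_parameter:
  assumes b: "b \<in> pos_roots S"
  obtains Y :: "'q \<Rightarrow> ('q, 'n) mat" where
    "\<And>u z. u \<longlonglongrightarrow> z \<Longrightarrow> (\<lambda>i. Y (u i)) \<longlonglongrightarrow> Y z"
    "\<And>k. Y (of_nat k) = top_gen S b [^]\<^bsub>GLm\<^esub> (k::nat)"
    "\<And>z. Y z \<in> root_pts S b"
    "top_gen S b \<noteq> mat 1 \<Longrightarrow> inj Y"
proof -
  obtain x :: "'q alg_closure \<Rightarrow> ('q, 'n) gmat" and f where x: "range x = root_grp S b"
    "\<And>i j. \<exists>q. \<forall>a. x a $ i $ j = poly q a" "\<And>a. f (x a) = a"
    "\<And>a a'. x (a + a') = x a ** x a'" "x 0 = mat 1"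
    "\<And>a. invertible (x a)" "\<And>a k. x a [^]\<^bsub>GLm\<^esub> (k::nat) = x (of_nat k * a)"
    by (rule root_parametrization[OF b]) metis
  obtain a where a: "of_mat (top_gen S b) = x a"
    using top_gen_in[OF b] x(1) by (auto simp: root_pts_def rational_points_def)
  have pow: "of_mat (top_gen S b [^]\<^bsub>GLm\<^esub> k) = x (a * to_ac (of_nat k))" for k :: nat
    using x(7)[of a k] by (simp add: of_mat_pow top_gen_invertible[OF b] a mult.commute)
  have "\<exists>Q. \<forall>z. x (a * to_ac z) $ i $ j = to_ac (poly Q z)" for i j
  proof -
    obtain q where q: "\<And>a. x a $ i $ j = poly q a" using x(2) by blast
    \<comment> \<open>With n_b = x(a), the substitution of a z turns an entry of x into a polynomial
      in z whose values at natural k are the entries of n_b^k.\<close>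
    have "\<exists>Q. \<forall>z. poly (pcompose q [:0, a:]) (to_ac z) = to_ac (poly Q z)"
    proof (rule poly_descent)
      show "infinite (range of_nat :: 'q set)" by (simp add: range_inj_infinite inj_of_nat)
      fix c :: 'q assume "c \<in> range of_nat"
      then obtain k where k: "c = of_nat k" by auto
      have "poly (pcompose q [:0, a:]) (to_ac c) = x (a * to_ac (of_nat k)) $ i $ j"
        by (simp add: poly_pcompose q k mult.commute)
      also have "\<dots> = to_ac ((top_gen S b [^]\<^bsub>GLm\<^esub> k) $ i $ j)"
        by (simp only: pow[symmetric]) (simp add: of_mat_def)
      finally show "poly (pcompose q [:0, a:]) (to_ac c) \<in> range to_ac" by simp
    qed
    then show ?thesis by (simp add: poly_pcompose q mult.commute)
  qed
  then obtain Q where Q: "\<And>i j z. x (a * to_ac z) $ i $ j = to_ac (poly (Q i j) z)" by metis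
  define Y where "Y z = (\<chi> i j. poly (Q i j) z)" for z
  have Y: "of_mat (Y z) = x (a * to_ac z)" for z
    by (simp add: vec_eq_iff of_mat_def Y_def Q)
  show ?thesis
  proof (rule that)
    show "(\<lambda>i. Y (u i)) \<longlonglongrightarrow> Y z" if "u \<longlonglongrightarrow> z" for u z
      unfolding Y_def by (intro vec_tendstoI) (auto intro!: tendsto_poly_nonarch that)
    show "Y (of_nat k) = top_gen S b [^]\<^bsub>GLm\<^esub> k" for k :: nat
      using pow[of k] Y by (metis of_mat_eq_iff)
    show "Y z \<in> root_pts S b" for z
      using Y x(1) by (auto simp: root_pts_def rational_points_def)
    assume "top_gen S b \<noteq> mat 1"
    \<comment> \<open>Nontriviality of the generator means a \<noteq> 0; then f, a left inverse of
      x, recovers z from Y z.\<close>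
    then have "a \<noteq> 0" using a x(5) by (metis of_mat_eq_iff of_mat_one)
    show "inj Y"
    proof (rule injI)
      fix z w assume "Y z = Y w"
      then have "f (x (a * to_ac z)) = f (x (a * to_ac w))" by (simp flip: Y)
      with \<open>a \<noteq> 0\<close> show "z = w" by (simp add: x(3))
    qed
  qed
qed

text \<open>Continuity of Y handles all sequences at once. Uniqueness of g rests on the existence of
  at least one sequence of natural numbers tending to z; otherwise the description would hold
  vacuously for every g.\<close>

lemma zp_pow_eqI:
  assumes cont: "\<And>u. u \<longlonglongrightarrow> z \<Longrightarrow> (\<lambda>i. Y (u i)) \<longlonglongrightarrow> Y z"
    and pow: "\<And>k. Y (of_nat k) = n [^]\<^bsub>GLm\<^esub> (k::nat)" and z: "vabs (z :: 'q) \<le> 1"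
  shows "zp_pow n z = Y z"
  unfolding zp_pow_def
proof (rule the_equality)
  show "\<forall>e. (\<lambda>i. of_nat (e i)) \<longlonglongrightarrow> z \<longrightarrow> (\<lambda>i. n [^]\<^bsub>GLm\<^esub> e i) \<longlonglongrightarrow> Y z"
    using cont by (simp flip: pow)
  obtain e :: "nat \<Rightarrow> nat" where e: "(\<lambda>i. of_nat (e i)) \<longlonglongrightarrow> z"
    using nat_dense_valuation_ring[OF Qp z] by blast
  fix g assume "\<forall>e. (\<lambda>i. of_nat (e i)) \<longlonglongrightarrow> z \<longrightarrow> (\<lambda>i. n [^]\<^bsub>GLm\<^esub> e i) \<longlonglongrightarrow> g"
  then have "(\<lambda>i. n [^]\<^bsub>GLm\<^esub> e i) \<longlonglongrightarrow> g" using e by blast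
  with cont[OF e] show "g = Y z" unfolding pow by (rule LIMSEQ_unique[symmetric])
qed

lemma zp_pow_nat:
  assumes b: "b \<in> pos_roots S"
  shows "zp_pow (top_gen S b) (of_nat k) = top_gen S b [^]\<^bsub>GLm\<^esub> (k::nat)"
proof -
  obtain Y :: "'q \<Rightarrow> ('q, 'n) mat" where Y:
    "\<And>u z. u \<longlonglongrightarrow> z \<Longrightarrow> (\<lambda>i. Y (u i)) \<longlonglongrightarrow> Y z"
    "\<And>k. Y (of_nat k) = top_gen S b [^]\<^bsub>GLm\<^esub> (k::nat)"
    by (rule top_gen_one_parameter[OF b]) blast
  have "zp_pow (top_gen S b) (of_nat k) = Y (of_nat k)"
    by (rule zp_pow_eqI[OF Y vabs_of_nat_le_1])
  then show ?thesis unfolding Y(2) .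
qed

text \<open>The limit stays in N_0 because N_0 is compact, hence closed.\<close>

lemma zp_pow_mem:
  assumes b: "b \<in> pos_roots S" and z: "vabs z \<le> 1"
  shows "zp_pow (top_gen S b) z \<in> N0 S \<inter> root_pts S b"
proof -
  obtain Y :: "'q \<Rightarrow> ('q, 'n) mat" where Y:
    "\<And>u z. u \<longlonglongrightarrow> z \<Longrightarrow> (\<lambda>i. Y (u i)) \<longlonglongrightarrow> Y z"
    "\<And>k. Y (of_nat k) = top_gen S b [^]\<^bsub>GLm\<^esub> (k::nat)"
    "\<And>z. Y z \<in> root_pts S b"
    by (rule top_gen_one_parameter[OF b]) blast
  have eq: "zp_pow (top_gen S b) z = Y z" by (rule zp_pow_eqI[OF Y(1) Y(2) z])
  obtain e :: "nat \<Rightarrow> nat" where e: "(\<lambda>i. of_nat (e i)) \<longlonglongrightarrow> z"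
    using nat_dense_valuation_ring[OF Qp z] by blast
  have "closed (N0 S)" using vN0 by (auto simp: valid_N0_def compact_imp_closed)
  moreover have "Y (of_nat (e i)) \<in> N0 S" for i
    unfolding Y(2) using top_gen_in[OF b] by (simp add: N0_pow)
  ultimately have "Y z \<in> N0 S"
    using closed_sequentially[of "N0 S" "\<lambda>i. Y (of_nat (e i))" "Y z"] Y(1)[OF e] by metis
  with Y(3) eq show ?thesis by auto
qed

lemma zp_pow_inj:
  assumes b: "b \<in> pos_roots S" and "top_gen S b \<noteq> mat 1"
  shows "inj_on (zp_pow (top_gen S b)) {z. vabs z \<le> 1}"
proof -
  obtain Y :: "'q \<Rightarrow> ('q, 'n) mat" where Y:
    "\<And>u z. u \<longlonglongrightarrow> z \<Longrightarrow> (\<lambda>i. Y (u i)) \<longlonglongrightarrow> Y z"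
    "\<And>k. Y (of_nat k) = top_gen S b [^]\<^bsub>GLm\<^esub> (k::nat)"
    "inj Y"
    using assms(2) by (rule_tac top_gen_one_parameter[OF b]) blast
  show ?thesis
    using zp_pow_eqI[OF Y(1) Y(2)] Y(3) by (auto simp: inj_on_def)
qed

section \<open>Coordinates of the second kind\<close>

lemma ordered_prod_cong:
  "(\<And>b. b \<in> set bs \<Longrightarrow> f b = g b) \<Longrightarrow> ordered_prod bs f = ordered_prod bs g"
  by (induction bs) (auto simp: ordered_prod_def)

lemma ordered_prod_single:
  assumes "distinct bs" "b \<in> set bs" "\<And>b'. b' \<in> set bs \<Longrightarrow> b' \<noteq> b \<Longrightarrow> f b' = mat 1"
  shows "ordered_prod bs f = f b"
proof -
  have one: "ordered_prod cs f = mat 1" if "\<And>b'. b' \<in> set cs \<Longrightarrow> f b' = mat 1" for cs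
    using that by (induction cs) (auto simp: ordered_prod_def)
  show ?thesis using assms
  proof (induction bs)
    case (Cons c cs)
    show ?case
    proof (cases "c = b")
      case True
      then have "ordered_prod cs f = mat 1" using Cons.prems by (intro one) auto
      then show ?thesis using True by (simp add: ordered_prod_def)
    next
      case False
      then have "ordered_prod cs f = f b" using Cons by auto
      then show ?thesis using False Cons.prems(3)[of c] by (simp add: ordered_prod_def)
    qed
  qed simp
qed

text \<open>Two injectivities pin the description down: the ordered product decomposition of N_0
  recovers the factors, and \<open>zp_pow_inj\<close> recovers the exponents. A trivial generator
  would leave its exponent undetermined, whence the hypothesis \<open>nontriv\<close>, which
  \<open>top_gen_neq_one\<close> supplies later.\<close>

lemma coords_unique:
  assumes nontriv: "\<And>b. b \<in> pos_roots S \<Longrightarrow> top_gen S b \<noteq> mat 1"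
    and x: "x \<in> (\<Pi>\<^sub>E b\<in>pos_roots S. {z. vabs z \<le> 1})"
  shows "coords S (ordered_prod (root_order S) (\<lambda>b. zp_pow (top_gen S b) (x b))) = x"
  unfolding coords_def
proof (rule the_equality)
  let ?z = "\<lambda>x. \<lambda>b\<in>pos_roots S. zp_pow (top_gen S b) (x b)"
  have bij: "bij_betw (ordered_prod (root_order S)) (\<Pi>\<^sub>E b\<in>pos_roots S. N0 S \<inter> root_pts S b) (N0 S)"
    using vN0 root_order by (auto simp: valid_N0_def)
  show "x \<in> (\<Pi>\<^sub>E b\<in>pos_roots S. {z. vabs z \<le> 1}) \<and>
      ordered_prod (root_order S) (\<lambda>b. zp_pow (top_gen S b) (x b))
        = ordered_prod (root_order S) (\<lambda>b. zp_pow (top_gen S b) (x b))"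
    using x by blast
  fix y assume y: "y \<in> (\<Pi>\<^sub>E b\<in>pos_roots S. {z. vabs z \<le> 1}) \<and>
      ordered_prod (root_order S) (\<lambda>b. zp_pow (top_gen S b) (x b))
        = ordered_prod (root_order S) (\<lambda>b. zp_pow (top_gen S b) (y b))"
  then have "ordered_prod (root_order S) (?z x) = ordered_prod (root_order S) (?z y)"
    using ordered_prod_cong[of "root_order S" "?z x" "\<lambda>b. zp_pow (top_gen S b) (x b)"]
      ordered_prod_cong[of "root_order S" "?z y" "\<lambda>b. zp_pow (top_gen S b) (y b)"]
    by (simp add: root_order)
  moreover have "?z x \<in> (\<Pi>\<^sub>E b\<in>pos_roots S. N0 S \<inter> root_pts S b)"
    "?z y \<in> (\<Pi>\<^sub>E b\<in>pos_roots S. N0 S \<inter> root_pts S b)"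
    using x y zp_pow_mem by (auto simp: PiE_iff)
  ultimately have eq: "?z x = ?z y" using bij by (auto simp: bij_betw_def inj_on_def)
  show "y = x"
  proof (rule PiE_ext)
    show "y \<in> (\<Pi>\<^sub>E b\<in>pos_roots S. {z. vabs z \<le> 1})" using y by blast
    show "x \<in> (\<Pi>\<^sub>E b\<in>pos_roots S. {z. vabs z \<le> 1})" by fact
    fix b assume b: "b \<in> pos_roots S"
    have "zp_pow (top_gen S b) (x b) = zp_pow (top_gen S b) (y b)"
      using fun_cong[OF eq, of b] b by simp
    then show "y b = x b"
      using zp_pow_inj[OF b nontriv[OF b]] x y b by (auto simp: inj_on_def PiE_iff)
  qed
qed

lemma coords_top_gen_pow:
  assumes nontriv: "\<And>b. b \<in> pos_roots S \<Longrightarrow> top_gen S b \<noteq> mat 1" and b: "b \<in> pos_roots S"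
  shows "coords S (top_gen S b [^]\<^bsub>GLm\<^esub> (k::nat)) = (\<lambda>b'\<in>pos_roots S. if b' = b then of_nat k else 0)"
proof -
  define x where "x = (\<lambda>b'\<in>pos_roots S. if b' = b then of_nat k else 0 :: 'q)"
  have "ordered_prod (root_order S) (\<lambda>b. zp_pow (top_gen S b) (x b)) = zp_pow (top_gen S b) (x b)"
  proof (rule ordered_prod_single[where b = b])
    fix b' assume b': "b' \<in> set (root_order S)" "b' \<noteq> b"
    then have "b' \<in> pos_roots S" using root_order by auto
    from zp_pow_nat[OF this, of 0] have "zp_pow (top_gen S b') 0 = mat 1" by simp
    then show "zp_pow (top_gen S b') (x b') = mat 1"
      using b' \<open>b' \<in> pos_roots S\<close> by (simp add: x_def)
  qed (use root_order b in auto)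
  also have "x b = of_nat k" using b by (simp add: x_def)
  also have "zp_pow (top_gen S b) (of_nat k) = top_gen S b [^]\<^bsub>GLm\<^esub> k" by (rule zp_pow_nat[OF b])
  finally have "top_gen S b [^]\<^bsub>GLm\<^esub> k = ordered_prod (root_order S) (\<lambda>b. zp_pow (top_gen S b) (x b))" ..
  also have "coords S \<dots> = x"
    by (rule coords_unique[OF nontriv]) (auto simp: vabs_of_nat_le_1 x_def)
  finally show ?thesis unfolding x_def .
qed

end


section \<open>Distributions along one root\<close>

context valid_setting_loc
begin

lemma emb_of_nat: "coeff_emb S (of_nat k) = of_nat k"
proof -
  have e: "coeff_emb S (x + y) = coeff_emb S x + coeff_emb S y" "coeff_emb S 1 = 1" for x y
    using emb by (auto simp: finite_extension_embedding_def)
  have "coeff_emb S 0 = 0" using e(1)[of 0 0] by simp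
  then show ?thesis by (induction k) (auto simp: e)
qed

lemma vabs_p_coeff: "vabs (of_nat (prm S) :: 'k) = 1 / real (prm S)"
  using emb vabs_p unfolding finite_extension_embedding_def by (metis emb_of_nat)

lemma single_in_midxs: "b \<in> pos_roots S \<Longrightarrow> (\<lambda>_. 0)(b := k) \<in> midxs S"
  by (auto simp: midxs_def)

lemma deg_single:
  assumes "b \<in> pos_roots S"
  shows "Defs.deg S ((\<lambda>_. 0)(b := k)) = k"
proof -
  have "Defs.deg S ((\<lambda>_. 0)(b := k)) = (\<Sum>b'\<in>pos_roots S. if b' = b then k else 0)"
    unfolding deg_def by (intro sum.cong) auto
  then show ?thesis using assms finite_pos by simp
qed

lemma gen_monomial_single:
  assumes "b \<in> pos_roots S"
  shows "gen_monomial S ((\<lambda>_. 0)(b := i)) = top_gen S b [^]\<^bsub>GLm\<^esub> i"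
  using ordered_prod_single[of "root_order S" b "\<lambda>b'. top_gen S b' [^]\<^bsub>GLm\<^esub> ((\<lambda>_. 0)(b := i)) b'"]
    assms root_order by (simp add: gen_monomial_def)

text \<open>The multi-indices below a multiple of one basis index are again such multiples, so the
  sum over \<open>midxs\<close> collapses to one variable and its inner sum becomes a
  \<open>mahler_coeff\<close>. Everything reduces to the function sending i to f(n_b^i).\<close>

lemma dist_apply_single:
  assumes b: "b \<in> pos_roots S" and d: "\<And>k. k \<noteq> (\<lambda>_. 0)(b := k b) \<Longrightarrow> d k = 0"
  shows "dist_apply S d f =
    infsum (\<lambda>k. d ((\<lambda>_. 0)(b := k)) * mahler_coeff (\<lambda>i. f (top_gen S b [^]\<^bsub>GLm\<^esub> i)) k) UNIV"
proof -
  define s where "s k = (\<lambda>_. 0 :: nat)(b := k)" for k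
  have s_eq: "s i = s j \<longleftrightarrow> i = j" for i j by (auto simp: s_def fun_eq_iff)
  then have inj: "inj s" by (auto intro: injI)
  have [simp]: "s k b' = (if b' = b then k else 0)" for k b' by (simp add: s_def)
  have smid: "s k \<in> midxs S" for k using single_in_midxs[OF b] by (simp add: s_def)
  define J where "J k = (\<Sum>i\<in>{i\<in>midxs S. \<forall>b. i b \<le> k b}.
      (-1) ^ (Defs.deg S k - Defs.deg S i) * (\<Prod>b\<in>pos_roots S. of_nat (k b choose i b)) * f (gen_monomial S i))" for k
  have J: "J (s k) = mahler_coeff (\<lambda>i. f (top_gen S b [^]\<^bsub>GLm\<^esub> i)) k" for k
  proof -
    have set_eq: "{i\<in>midxs S. \<forall>b'. i b' \<le> s k b'} = s ` {..k}"
    proof (intro equalityI subsetI)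
      fix i assume i: "i \<in> {i\<in>midxs S. \<forall>b'. i b' \<le> s k b'}"
      then have ib: "i b' \<le> s k b'" for b' by blast
      have "i b \<le> k" using ib[of b] by simp
      moreover have "i = s (i b)"
      proof
        fix b' show "i b' = s (i b) b'" using ib[of b'] by auto
      qed
      ultimately show "i \<in> s ` {..k}" by blast
    qed (use smid in auto)
    have "J (s k) = (\<Sum>i\<le>k. (-1) ^ (Defs.deg S (s k) - Defs.deg S (s i)) *
        (\<Prod>b'\<in>pos_roots S. of_nat (s k b' choose s i b')) * f (gen_monomial S (s i)))"
      unfolding J_def set_eq using inj by (subst sum.reindex) (auto intro: inj_on_subset)
    also have "\<dots> = mahler_coeff (\<lambda>i. f (top_gen S b [^]\<^bsub>GLm\<^esub> i)) k"
      unfolding mahler_coeff_def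
    proof (rule sum.cong)
      fix i assume "i \<in> {..k}"
      have "(\<Prod>b'\<in>pos_roots S. of_nat (s k b' choose s i b') :: 'k)
          = (\<Prod>b'\<in>pos_roots S. if b' = b then of_nat (k choose i) else 1)"
        by (intro prod.cong) auto
      also have "\<dots> = of_nat (k choose i)" using finite_pos b by simp
      finally show "(-1) ^ (Defs.deg S (s k) - Defs.deg S (s i)) *
          (\<Prod>b'\<in>pos_roots S. of_nat (s k b' choose s i b')) * f (gen_monomial S (s i))
        = (-1) ^ (k - i) * of_nat (k choose i) * f (top_gen S b [^]\<^bsub>GLm\<^esub> i)"
        by (simp only: s_def deg_single[OF b] gen_monomial_single[OF b])
    qed simp
    finally show ?thesis .
  qed
  have "dist_apply S d f = infsum (\<lambda>k. d k * J k) (midxs S)"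
    unfolding dist_apply_def J_def ..
  also have "\<dots> = infsum (\<lambda>k. d k * J k) (range s)"
  proof (rule infsum_cong_neutral)
    fix k assume "k \<in> midxs S - range s"
    then have "k \<noteq> s (k b)" by blast
    then show "d k * J k = 0" using d[of k] by (simp add: s_def)
  qed (use smid in auto)
  also have "\<dots> = infsum (\<lambda>k. d (s k) * J (s k)) UNIV"
    using infsum_reindex[OF inj, of "\<lambda>k. d k * J k"] by (simp add: comp_def)
  finally show ?thesis unfolding J unfolding s_def .
qed

text \<open>This is the binomial expansion of n_b^i = (1 + b_b)^i: only monomials in b_b occur,
  because the other coordinates are 0 and 0 gchoose m = 0 for m > 0.\<close>

lemma mahler_fun_top_gen_pow:
  assumes nontriv: "\<And>b. b \<in> pos_roots S \<Longrightarrow> top_gen S b \<noteq> mat 1"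
    and b: "b \<in> pos_roots S" and m: "m \<in> midxs S"
  shows "mahler_fun S m (top_gen S b [^]\<^bsub>GLm\<^esub> (i::nat))
    = (if m = (\<lambda>_. 0)(b := m b) then of_nat (i choose m b) else 0)"
proof -
  have eq: "mahler_fun S m (top_gen S b [^]\<^bsub>GLm\<^esub> i)
      = coeff_emb S (\<Prod>b'\<in>pos_roots S. (if b' = b then of_nat i else 0) gchoose m b')"
    unfolding mahler_fun_def
    by (intro arg_cong[where f = "coeff_emb S"] prod.cong)
       (auto simp: coords_top_gen_pow[OF nontriv b])
  show ?thesis
  proof (cases "m = (\<lambda>_. 0)(b := m b)")
    case True
    then have m0: "m b' = 0" if "b' \<noteq> b" for b' using that by (metis fun_upd_other)
    have "(\<Prod>b'\<in>pos_roots S. (if b' = b then of_nat i else 0 :: 'q) gchoose m b')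
        = (\<Prod>b'\<in>pos_roots S. if b' = b then of_nat (i choose m b) else 1)"
      by (intro prod.cong) (auto simp: m0 binomial_gbinomial)
    also have "\<dots> = of_nat (i choose m b)" using finite_pos b by simp
    finally show ?thesis using True by (simp add: eq emb_of_nat)
  next
    case False
    then obtain b' where "m b' \<noteq> ((\<lambda>_. 0)(b := m b)) b'" by (meson ext)
    then have b': "b' \<noteq> b" "m b' \<noteq> 0" by (metis fun_upd_same, metis fun_upd_apply)
    then have "b' \<in> pos_roots S" using m by (auto simp: midxs_def)
    moreover have "(if b' = b then of_nat i else 0 :: 'q) gchoose m b' = 0"
      using b' by (cases "m b'") auto
    ultimately have "\<exists>a\<in>pos_roots S. (if a = b then of_nat i else 0 :: 'q) gchoose m a = 0" by blast
    then have "(\<Prod>b'\<in>pos_roots S. (if b' = b then of_nat i else 0 :: 'q) gchoose m b') = of_nat 0"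
      using prod_zero[OF finite_pos] by simp
    then have "mahler_fun S m (top_gen S b [^]\<^bsub>GLm\<^esub> i) = of_nat 0"
      unfolding eq by (simp only: emb_of_nat)
    then show ?thesis using False by simp
  qed
qed

text \<open>Even along the identity, \<open>push\<close> recomputes every coefficient by pairing d
  with a Mahler function, so this is the duality between monomials and Mahler functions. It puts d
  into the component t = 1, whose definition goes through \<open>push\<close>.\<close>

lemma push_one_single:
  assumes nontriv: "\<And>b. b \<in> pos_roots S \<Longrightarrow> top_gen S b \<noteq> mat 1"
    and b: "b \<in> pos_roots S" and d: "\<And>k. k \<noteq> (\<lambda>_. 0)(b := k b) \<Longrightarrow> d k = 0"
  shows "push S (mat 1) d = d"
proof
  fix m
  show "push S (mat 1) d m = d m"
  proof (cases "m \<in> midxs S")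
    case True
    have p: "push S (mat 1) d m = infsum (\<lambda>k. d ((\<lambda>_. 0)(b := k)) *
        mahler_coeff (\<lambda>i. if m = (\<lambda>_. 0)(b := m b) then of_nat (i choose m b) else 0) k) UNIV"
    proof -
      have "push S (mat 1) d m = dist_apply S d (\<lambda>g. mahler_fun S m g)"
        using True by (simp add: push_def)
      also have "\<dots> = infsum (\<lambda>k. d ((\<lambda>_. 0)(b := k)) *
          mahler_coeff (\<lambda>i. mahler_fun S m (top_gen S b [^]\<^bsub>GLm\<^esub> i)) k) UNIV"
        by (rule dist_apply_single[OF b d])
      finally show ?thesis using mahler_fun_top_gen_pow[OF nontriv b True] by simp
    qed
    show ?thesis
    proof (cases "m = (\<lambda>_. 0)(b := m b)")
      case True
      have "push S (mat 1) d m = infsum (\<lambda>k. d ((\<lambda>_. 0)(b := k)) * (if k = m b then 1 else 0)) UNIV"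
        unfolding p by (simp only: if_P[OF True] mahler_coeff_binomial)
      also have "\<dots> = infsum (\<lambda>k. d ((\<lambda>_. 0)(b := k))) {m b}"
        by (rule infsum_cong_neutral) auto
      also have "\<dots> = d ((\<lambda>_. 0)(b := m b))" by simp
      finally show ?thesis using True by simp
    next
      case False
      then have "push S (mat 1) d m = 0" unfolding p by (simp add: mahler_coeff_def)
      then show ?thesis using d[OF False] by simp
    qed
  next
    case False
    then have "m \<noteq> (\<lambda>_. 0)(b := m b)" using single_in_midxs[OF b] by metis
    then show ?thesis using False d[of m] by (simp add: push_def)
  qed
qed

section \<open>The logarithm as a locally analytic distribution\<close>

lemma log_gen_single: "k \<noteq> (\<lambda>_. 0)(b := k b) \<Longrightarrow> log_gen b k = 0"
  by (simp add: log_gen_def)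

lemma bvar_single: "k \<noteq> (\<lambda>_. 0)(b := k b) \<Longrightarrow> bvar b k = 0"
  by (auto simp: bvar_def)

lemma log_gen_at: "log_gen b ((\<lambda>_. 0)(b := k)) = (if k \<ge> 1 then (-1) ^ (k + 1) / of_nat k else 0)"
  by (simp add: log_gen_def)

lemma zero_in_distN1: "(\<lambda>_. 0) \<in> distN1 S"
  by (auto simp: distN1_def distN0_def)

lemma bvar_in_distN0:
  assumes "b \<in> pos_roots S"
  shows "bvar b \<in> distN0 S"
  unfolding distN0_def
proof (intro CollectI conjI allI impI)
  fix k :: "('q, 'n) midx" assume "k \<notin> midxs S"
  then show "bvar b k = 0" using single_in_midxs[OF assms, of 1] by (auto simp: bvar_def)
next
  fix r :: real assume "0 < r \<and> r < 1"
  then show "bdd_above (range (\<lambda>k. vabs (bvar b k :: 'k) * r ^ Defs.deg S k))"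
    by (intro bdd_aboveI[of _ 1]) (auto simp: bvar_def power_le_one)
qed

text \<open>The coefficient 1/k has absolute value at most k by \<open>vabs_of_nat_ge\<close>, and k
  r^k is bounded for r < 1.\<close>

lemma log_gen_in_distN0:
  assumes b: "b \<in> pos_roots S"
  shows "log_gen b \<in> distN0 S"
  unfolding distN0_def
proof (intro CollectI conjI allI impI)
  fix k :: "('q, 'n) midx" assume "k \<notin> midxs S"
  then have "k \<noteq> (\<lambda>_. 0)(b := k b)" using single_in_midxs[OF b] by metis
  then show "log_gen b k = 0" by (rule log_gen_single)
next
  fix r :: real assume r: "0 < r \<and> r < 1"
  then have "(\<lambda>n. real n * r ^ n) \<longlonglongrightarrow> 0" by (intro powser_times_n_limit_0) auto
  then have "Bseq (\<lambda>n. real n * r ^ n)" by (intro convergent_imp_Bseq) (auto simp: convergent_def)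
  then obtain B where B: "B > 0" "\<And>n. norm (real n * r ^ n) \<le> B" by (auto simp: Bseq_def)
  show "bdd_above (range (\<lambda>k. vabs (log_gen b k :: 'k) * r ^ Defs.deg S k))"
  proof (rule bdd_aboveI2)
    fix k :: "('q, 'n) midx"
    show "vabs (log_gen b k :: 'k) * r ^ Defs.deg S k \<le> B"
    proof (cases "k b \<ge> 1 \<and> k = (\<lambda>_. 0)(b := k b)")
      case True
      then have deg: "Defs.deg S k = k b" using deg_single[OF b, of "k b"] by simp
      have pos: "0 < vabs (of_nat (k b) :: 'k)" using True by (simp add: order_less_le)
      have "vabs (log_gen b k :: 'k) = 1 / vabs (of_nat (k b) :: 'k)"
        using True by (simp add: log_gen_def vabs_divide vabs_mult vabs_power)
      also have "\<dots> \<le> 1 / (1 / real (k b))"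
        using vabs_of_nat_ge[OF prime_p vabs_p_coeff, of "k b"] True pos
        by (intro divide_left_mono) auto
      finally have "vabs (log_gen b k :: 'k) * r ^ Defs.deg S k \<le> real (k b) * r ^ k b"
        unfolding deg using r by (intro mult_right_mono) auto
      also have "\<dots> \<le> B" using B(2)[of "k b"] by simp
      finally show ?thesis .
    next
      case False
      then have "log_gen b k = (0 :: 'k)" by (auto simp: log_gen_def)
      then show ?thesis using B by simp
    qed
  qed
qed

lemma log_gen_in_distN1:
  assumes "b \<in> pos_roots S" "b \<noteq> alpha S"
  shows "log_gen b \<in> distN1 S"
  unfolding distN1_def
proof (intro CollectI conjI allI impI log_gen_in_distN0 assms)
  fix k :: "('q, 'n) midx" assume "k (alpha S) \<noteq> 0"
  then have "k \<noteq> (\<lambda>_. 0)(b := k b)" using assms(2) by (metis fun_upd_other)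
  then show "log_gen b k = 0" by (rule log_gen_single)
qed

lemma distN1_subset: "distN1 S \<subseteq> distN0 S"
  by (auto simp: distN1_def)

lemma log_gen_nonzero: "log_gen b \<noteq> (\<lambda>_. 0 :: 'k)"
proof
  assume "log_gen b = (\<lambda>_. 0 :: 'k)"
  from fun_cong[OF this, of "(\<lambda>_. 0)(b := 1)"] show False by (simp add: log_gen_def)
qed

lemma finite_bounded_deg: "finite {k \<in> midxs S. Defs.deg S k \<le> N}"
proof (rule finite_subset)
  show "{k \<in> midxs S. Defs.deg S k \<le> N} \<subseteq>
      {k. \<forall>b. (b \<in> pos_roots S \<longrightarrow> k b \<in> {..N}) \<and> (b \<notin> pos_roots S \<longrightarrow> k b = 0)}"
  proof (intro subsetI CollectI allI conjI impI)
    fix k b assume k: "k \<in> {k \<in> midxs S. Defs.deg S k \<le> N}"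
    show "k b = 0" if "b \<notin> pos_roots S" using k that by (auto simp: midxs_def)
    show "k b \<in> {..N}" if "b \<in> pos_roots S"
      using k member_le_sum[OF that, of k] finite_pos by (auto simp: deg_def)
  qed
  show "finite {k. \<forall>b. (b \<in> pos_roots S \<longrightarrow> k b \<in> {..N}) \<and> (b \<notin> pos_roots S \<longrightarrow> k b = 0)}"
    by (rule finite_set_of_finite_funs) (use finite_pos in auto)
qed

text \<open>Boundedness at a radius q strictly between r and 1 gives decay like (r/q)^deg at r, and
  only finitely many multi-indices have bounded degree.\<close>

lemma distN0_in_Dcompl:
  assumes d: "d \<in> distN0 S" and r: "0 < r" "r < 1"
  shows "d \<in> carrier (Dcompl S r)"
proof -
  define q where "q = (r + 1) / 2"
  have q: "r < q" "0 < q" "q < 1" using r by (auto simp: q_def)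
  obtain B where B: "\<And>k. vabs (d k) * q ^ Defs.deg S k \<le> B"
    using d q unfolding distN0_def bdd_above_def by blast
  have "finite {k. \<epsilon> \<le> vabs (d k) * r ^ Defs.deg S k}" if \<epsilon>: "\<epsilon> > 0" for \<epsilon>
  proof -
    have "(\<lambda>n. B * (r / q) ^ n) \<longlonglongrightarrow> B * 0"
      using r q by (intro tendsto_mult tendsto_const LIMSEQ_realpow_zero) auto
    then have "eventually (\<lambda>n. B * (r / q) ^ n < \<epsilon>) sequentially"
      using \<epsilon> by (auto intro: order_tendstoD)
    then obtain N where N: "\<And>n. n \<ge> N \<Longrightarrow> B * (r / q) ^ n < \<epsilon>" by (auto simp: eventually_sequentially)
    have "{k. \<epsilon> \<le> vabs (d k) * r ^ Defs.deg S k} \<subseteq> {k \<in> midxs S. Defs.deg S k \<le> N}"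
    proof
      fix k assume k: "k \<in> {k. \<epsilon> \<le> vabs (d k) * r ^ Defs.deg S k}"
      then have "d k \<noteq> 0" using \<epsilon> by auto
      then have "k \<in> midxs S" using d by (auto simp: distN0_def)
      moreover have "Defs.deg S k \<le> N"
      proof (rule ccontr)
        assume "\<not> Defs.deg S k \<le> N"
        have "vabs (d k) * r ^ Defs.deg S k = vabs (d k) * q ^ Defs.deg S k * (r / q) ^ Defs.deg S k"
          using q by (simp add: power_divide)
        also have "\<dots> \<le> B * (r / q) ^ Defs.deg S k"
          using r q by (intro mult_right_mono B) auto
        also have "\<dots> < \<epsilon>" using N \<open>\<not> Defs.deg S k \<le> N\<close> by simp
        finally show False using k by simp
      qed
      ultimately show "k \<in> {k \<in> midxs S. Defs.deg S k \<le> N}" by simp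
    qed
    then show ?thesis using finite_bounded_deg by (rule finite_subset)
  qed
  then show ?thesis using d by (simp add: Dcompl_def distN0_def)
qed

lemma dist_norm_at_zero: "dist_norm_at S r (\<lambda>_. 0) = 0"
  by (simp add: dist_norm_at_def)

lemma dist_norm_at_pos:
  assumes d: "d \<in> distN0 S" and r: "0 < r" "r < 1" and k: "d k \<noteq> 0"
  shows "dist_norm_at S r d > 0"
proof -
  have "0 < vabs (d k) * r ^ Defs.deg S k" using k r vabs_ge_0[of "d k"] vabs_eq_0_iff[of "d k"]
    by (metis order_less_le mult_pos_pos zero_less_power)
  also have "\<dots> \<le> dist_norm_at S r d"
    unfolding dist_norm_at_def using d r by (intro cSUP_upper) (auto simp: distN0_def)
  finally show ?thesis .
qed

section \<open>Existence of radii and intervals\<close>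

lemma radii_bounds: "r \<in> radii S \<Longrightarrow> 0 < r \<and> r < 1"
proof -
  assume "r \<in> radii S"
  then have "1 / real (prm S) < r" "r < 1" by (auto simp: radii_def)
  moreover have "0 \<le> 1 / real (prm S)" by simp
  ultimately show ?thesis by linarith
qed

lemma powr_in_radii:
  assumes "-1 < x" "x < (0 :: rat)"
  shows "real (prm S) powr of_rat x \<in> radii S"
proof -
  have "real (prm S) powr (-1) < real (prm S) powr of_rat x"
    using assms p_gt_1 of_rat_less[of "-1" x, where 'a=real] by (intro powr_less_mono) auto
  moreover have "real (prm S) powr of_rat x < real (prm S) powr 0"
    using assms p_gt_1 of_rat_less[of x 0, where 'a=real] by (intro powr_less_mono) auto
  ultimately show ?thesis using p_gt_1 by (auto simp: radii_def powr_minus inverse_eq_divide)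
qed

lemma radii_nonempty: "\<exists>r. r \<in> radii S"
  using powr_in_radii[of "-1 / 2"] by auto

lemma above_nonempty:
  assumes "r1 \<in> radii S"
  shows "\<exists>r2. r2 \<in> above S r1"
proof -
  obtain x :: rat where x: "r1 = real (prm S) powr of_rat x" "1 / real (prm S) < r1" "r1 < 1"
    using assms by (auto simp: radii_def)
  have "x < 0"
  proof (rule ccontr)
    assume "\<not> x < 0"
    then have "1 \<le> real (prm S) powr of_rat x" using p_gt_1 by (intro ge_one_powr_ge_zero) auto
    then show False using x by simp
  qed
  moreover have "-1 < x"
  proof (rule ccontr)
    assume "\<not> -1 < x"
    then have "of_rat x \<le> (of_rat (-1) :: real)" by (simp only: of_rat_less_eq)
    then have "real (prm S) powr of_rat x \<le> real (prm S) powr (-1)"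
      using p_gt_1 by (intro powr_mono) auto
    then show False using x p_gt_1 by (simp add: powr_minus inverse_eq_divide)
  qed
  \<comment> \<open>Halving the exponent moves the radius closer to 1 without leaving the rational
    powers of p.\<close>
  ultimately have "real (prm S) powr of_rat (x / 2) \<in> radii S" by (intro powr_in_radii) auto
  moreover have "r1 < real (prm S) powr of_rat (x / 2)"
    unfolding x(1) using p_gt_1 \<open>x < 0\<close> of_rat_less[of x "x / 2", where 'a=real]
    by (intro powr_less_mono) auto
  ultimately show ?thesis by (auto simp: above_def)
qed

lemma above_interval: "r1 \<in> radii S \<Longrightarrow> r2 \<in> above S r1 \<Longrightarrow> (r1, r2) \<in> intervals S"
  by (simp add: above_def intervals_def)

lemma distN0_in_Dcompl_above: "d \<in> distN0 S \<Longrightarrow> r2 \<in> above S r1 \<Longrightarrow> d \<in> carrier (Dcompl S r2)"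
  using distN0_in_Dcompl radii_bounds by (auto simp: above_def)

end

section \<open>Norms and embeddings of the microlocalizations\<close>

locale valid_microloc_loc = valid_setting_loc S
  for S :: "('q::nonarch_field, 'k::nonarch_field, 'n::finite) setting" +
  fixes M :: "('q, 'k, 'n, 'a) microloc"
  assumes vmicro: "valid_microloc S M"
begin

lemma microloc:
  assumes "r1 \<in> radii S" "r2 \<in> above S r1"
  shows "ring (mring M r1 r2)"
    "memb M r1 r2 \<in> ring_hom (Dcompl S r2) (mring M r1 r2)"
    "inj_on (memb M r1 r2) (carrier (Dcompl S r2))"
    "memb M r1 r2 (bvar (alpha S)) \<in> Units (mring M r1 r2)"
    "\<And>r x. r \<in> {r1, r2} \<Longrightarrow> x \<in> carrier (mring M r1 r2) \<Longrightarrow> mnorm M r1 r2 r x = 0 \<longleftrightarrow> x = \<zero>\<^bsub>mring M r1 r2\<^esub>"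
    "\<And>r x y. r \<in> {r1, r2} \<Longrightarrow> x \<in> carrier (mring M r1 r2) \<Longrightarrow> y \<in> carrier (mring M r1 r2) \<Longrightarrow>
       mnorm M r1 r2 r (x \<otimes>\<^bsub>mring M r1 r2\<^esub> y) = mnorm M r1 r2 r x * mnorm M r1 r2 r y"
    "\<And>r d. r \<in> {r1, r2} \<Longrightarrow> d \<in> carrier (Dcompl S r2) \<Longrightarrow> mnorm M r1 r2 r (memb M r1 r2 d) = dist_norm_at S r d"
proof -
  have "is_microlocalization S M r1 r2"
    using vmicro above_interval[OF assms] by (auto simp: valid_microloc_def)
  then show "ring (mring M r1 r2)"
    "memb M r1 r2 \<in> ring_hom (Dcompl S r2) (mring M r1 r2)"
    "inj_on (memb M r1 r2) (carrier (Dcompl S r2))"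
    "memb M r1 r2 (bvar (alpha S)) \<in> Units (mring M r1 r2)"
    "\<And>r x. r \<in> {r1, r2} \<Longrightarrow> x \<in> carrier (mring M r1 r2) \<Longrightarrow> mnorm M r1 r2 r x = 0 \<longleftrightarrow> x = \<zero>\<^bsub>mring M r1 r2\<^esub>"
    "\<And>r x y. r \<in> {r1, r2} \<Longrightarrow> x \<in> carrier (mring M r1 r2) \<Longrightarrow> y \<in> carrier (mring M r1 r2) \<Longrightarrow>
       mnorm M r1 r2 r (x \<otimes>\<^bsub>mring M r1 r2\<^esub> y) = mnorm M r1 r2 r x * mnorm M r1 r2 r y"
    "\<And>r d. r \<in> {r1, r2} \<Longrightarrow> d \<in> carrier (Dcompl S r2) \<Longrightarrow> mnorm M r1 r2 r (memb M r1 r2 d) = dist_norm_at S r d"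
    unfolding is_microlocalization_def Let_def by blast+
qed

lemma memb_closed:
  assumes "r1 \<in> radii S" "r2 \<in> above S r1" "d \<in> distN0 S"
  shows "memb M r1 r2 d \<in> carrier (mring M r1 r2)"
  using ring_hom_closed[OF microloc(2)[OF assms(1,2)]] distN0_in_Dcompl_above[OF assms(3,2)] by blast

lemma zero_in_distN0: "(\<lambda>_. 0) \<in> distN0 S"
  using zero_in_distN1 distN1_subset by blast

text \<open>The norm detects 0. A \<open>ring_hom\<close> by definition preserves products, sums and
  1; deducing 0 from that would require \<open>Dcompl\<close> to be known as a ring.\<close>

lemma memb_zero:
  assumes "r1 \<in> radii S" "r2 \<in> above S r1"
  shows "memb M r1 r2 (\<lambda>_. 0) = \<zero>\<^bsub>mring M r1 r2\<^esub>"
proof -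
  have "mnorm M r1 r2 r1 (memb M r1 r2 (\<lambda>_. 0)) = 0"
    using microloc(7)[OF assms, of r1 "\<lambda>_. 0"] distN0_in_Dcompl_above[OF zero_in_distN0 assms(2)]
    by (simp add: dist_norm_at_zero)
  then show ?thesis using microloc(5)[OF assms, of r1] memb_closed[OF assms zero_in_distN0] by simp
qed

text \<open>If \<open>n\<^sub>b = 1\<close>, then \<open>b\<^sub>b\<close> would square to \<open>0\<close>, contradicting the multiplicativity of the norms.\<close>

lemma top_gen_neq_one:
  assumes b: "b \<in> pos_roots S"
  shows "top_gen S b \<noteq> mat 1"
proof
  assume one: "top_gen S b = mat 1"
  have pow: "top_gen S b [^]\<^bsub>GLm\<^esub> i = mat 1" for i :: nat
    unfolding one by (induction i) auto
  \<comment> \<open>A constant function is c binom(i,0), so its higher differences vanish by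
    \<open>mahler_coeff_binomial\<close>. As all powers of n_b are 1, the distribution
    \<open>bvar b\<close> then kills every function.\<close>
  have const: "mahler_coeff (\<lambda>_. c) (Suc k) = (0 :: 'k)" for c k
  proof -
    have "mahler_coeff (\<lambda>_. c) (Suc k) = mahler_coeff (\<lambda>i. of_nat (i choose 0)) (Suc k) * c"
      unfolding mahler_coeff_def by (simp only: sum_distrib_right binomial_n_0 of_nat_1 mult_1_right)
    then show ?thesis by (simp only: mahler_coeff_binomial) simp
  qed
  have app: "dist_apply S (bvar b) f = 0" for f
  proof -
    have "bvar b ((\<lambda>_. 0)(b := k)) * mahler_coeff (\<lambda>i. f (top_gen S b [^]\<^bsub>GLm\<^esub> i)) k = 0" for k
      unfolding pow by (cases k) (auto simp: const bvar_def fun_eq_iff)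
    note zero = this
    have "dist_apply S (bvar b) f = infsum (\<lambda>k. bvar b ((\<lambda>_. 0)(b := k)) *
        mahler_coeff (\<lambda>i. f (top_gen S b [^]\<^bsub>GLm\<^esub> i)) k) UNIV"
      by (rule dist_apply_single[OF b bvar_single])
    also have "\<dots> = 0" by (rule infsum_0) (rule zero)
    finally show ?thesis .
  qed
  then have sq: "dist_mult S (bvar b) (bvar b) = (\<lambda>_. 0)"
    unfolding dist_mult_def app by simp
  obtain r1 where r1: "r1 \<in> radii S" using radii_nonempty by blast
  obtain r2 where r2: "r2 \<in> above S r1" using above_nonempty[OF r1] by blast
  have bc: "bvar b \<in> carrier (Dcompl S r2)"
    by (rule distN0_in_Dcompl_above[OF bvar_in_distN0[OF b] r2])
  have ec: "memb M r1 r2 (bvar b) \<in> carrier (mring M r1 r2)"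
    by (rule memb_closed[OF r1 r2 bvar_in_distN0[OF b]])
  have "memb M r1 r2 (\<lambda>_. 0) = memb M r1 r2 (bvar b) \<otimes>\<^bsub>mring M r1 r2\<^esub> memb M r1 r2 (bvar b)"
    using ring_hom_mult[OF microloc(2)[OF r1 r2] bc bc] by (simp add: Dcompl_def sq)
  then have "mnorm M r1 r2 r1 (memb M r1 r2 (\<lambda>_. 0)) = dist_norm_at S r1 (bvar b) * dist_norm_at S r1 (bvar b)"
    using microloc(6)[OF r1 r2 _ ec ec, of r1] microloc(7)[OF r1 r2 _ bc, of r1] by simp
  moreover have "mnorm M r1 r2 r1 (memb M r1 r2 (\<lambda>_. 0)) = 0"
    using microloc(7)[OF r1 r2, of r1 "\<lambda>_. 0"] distN0_in_Dcompl_above[OF zero_in_distN0 r2]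
    by (simp add: dist_norm_at_zero)
  \<comment> \<open>As a coefficient function \<open>bvar b\<close> is still nonzero, so its norm is
    positive although its square has norm 0.\<close>
  moreover have "dist_norm_at S r1 (bvar b :: ('q, 'k, 'n) distr) > 0"
    using dist_norm_at_pos[OF bvar_in_distN0[OF b], of r1 "(\<lambda>_. 0)(b := 1)"] radii_bounds[OF r1]
    by (simp add: bvar_def)
  ultimately show False by simp
qed

lemma push_one:
  assumes "b \<in> pos_roots S" "\<And>k. k \<noteq> (\<lambda>_. 0)(b := k b) \<Longrightarrow> d k = 0"
  shows "push S (mat 1) d = d"
  by (rule push_one_single[OF top_gen_neq_one assms])

end


section \<open>The element s and the map l\<close>

text \<open>Comparing coefficients in q(b X) = q(b) q(X) shows that b^j = q(b) for every j with
  nonzero coefficient. Taking b = 2, whose powers are distinct in characteristic 0, leaves a single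
  j.\<close>

lemma multiplicative_poly_is_power:
  fixes q :: "'e::field_char_0 poly"
  assumes mult: "\<And>a b. a \<noteq> 0 \<Longrightarrow> b \<noteq> 0 \<Longrightarrow> poly q (a * b) = poly q a * poly q b" and one: "poly q 1 = 1"
  shows "\<exists>i. q = Polynomial.monom 1 i"
proof -
  have "q \<noteq> 0" using one by auto
  define i where "i = Polynomial.degree q"
  have eq: "pcompose q [:0, b:] = Polynomial.smult (poly q b) q" if b: "b \<noteq> 0" for b
  proof -
    have "infinite (UNIV - {0 :: 'e})" by (simp add: infinite_UNIV_char_0)
    moreover have "UNIV - {0} \<subseteq> {a. poly (pcompose q [:0, b:] - Polynomial.smult (poly q b) q) a = 0}"
      using mult[OF _ b] by (auto simp: poly_pcompose mult.commute)
    ultimately have "infinite {a. poly (pcompose q [:0, b:] - Polynomial.smult (poly q b) q) a = 0}"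
      using finite_subset by blast
    then have "pcompose q [:0, b:] - Polynomial.smult (poly q b) q = 0"
      using poly_roots_finite by blast
    then show ?thesis by simp
  qed
  have cf: "Polynomial.coeff q j * b ^ j = poly q b * Polynomial.coeff q j" if "b \<noteq> 0" for j b
    using arg_cong[OF eq[OF that], of "\<lambda>p. Polynomial.coeff p j"] by (simp add: coeff_pcompose_linear mult.commute)
  have nz: "Polynomial.coeff q j = 0" if "j \<noteq> i" for j
  proof (rule ccontr)
    assume j: "Polynomial.coeff q j \<noteq> 0"
    have "Polynomial.coeff q i \<noteq> 0" using \<open>q \<noteq> 0\<close> by (simp add: i_def)
    then have "(2 :: 'e) ^ i = poly q 2" "(2 :: 'e) ^ j = poly q 2"
      using cf[of 2 i] cf[of 2 j] j by auto
    then have "(of_nat (2 ^ i) :: 'e) = of_nat (2 ^ j)" by simp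
    then have "(2::nat) ^ i = 2 ^ j" by (simp only: of_nat_eq_iff)
    then show False using that by simp
  qed
  then have q: "q = Polynomial.monom (Polynomial.coeff q i) i" by (intro poly_eqI) auto
  have "poly (Polynomial.monom (Polynomial.coeff q i) i) 1 = 1" using one q by simp
  then have "Polynomial.coeff q i = 1" by (simp add: poly_monom)
  with q show ?thesis by metis
qed

text \<open>Used to carry conjugation by s through the product over the simple roots in
  N/[N,N].\<close>

lemma hom_finprod_comm_group:
  assumes "comm_group G" "comm_group H" "h \<in> hom G H" "finite A" "f \<in> A \<rightarrow> carrier G"
  shows "h (finprod G f A) = finprod H (\<lambda>a. h (f a)) A"
proof -
  interpret G: comm_group G by fact
  interpret H: comm_group H by fact
  have one: "h \<one>\<^bsub>G\<^esub> = \<one>\<^bsub>H\<^esub>" using assms(3) by (simp add: hom_one G.is_group H.is_group)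
  show ?thesis using assms(4,5)
  proof (induction A)
    case (insert a A)
    have "f \<in> A \<rightarrow> carrier G" "f a \<in> carrier G" using insert.prems by auto
    moreover have "(\<lambda>a. h (f a)) \<in> A \<rightarrow> carrier H" "h (f a) \<in> carrier H"
      using insert.prems hom_in_carrier[OF assms(3)] by auto
    ultimately show ?case
      using insert.hyps insert.IH hom_mult[OF assms(3) \<open>f a \<in> carrier G\<close> G.finprod_closed[of f A]]
      by simp
  qed (simp add: one)
qed

context valid_setting_loc
begin

lemma group_structure:
  shows max_torus: "maximal_torus (grpG S) (torusT S)"
    and split_torusT: "split_torus (torusT S)"
    and borel: "borel_subgroup (grpG S) (borelP S)"
    and unip_radical: "unipotent_radical (borelP S) (unipN S)"
    and borel_eq: "borelP S = torusT S <#>\<^bsub>GLm\<^esub> unipN S"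
    and simple_roots: "simple_roots (torusT S) (pos_roots S) (simple S)"
    and root_grps: "\<forall>b\<in>pos_roots S. root_subgroup (torusT S) b (root_grp S b) \<and> root_grp S b \<subseteq> unipN S"
  using vgroup unfolding valid_group_def by - (elim conjE, assumption)+

lemma cochar: "cocharacter (torusT S) (xi S)"
  and simple_xi: "\<forall>b\<in>simple S. \<forall>a. a \<noteq> 0 \<longrightarrow> b (xi S a) = a"
  and iota_add': "\<forall>x\<in>root_pts S (alpha S). \<forall>y\<in>root_pts S (alpha S).
      iota_alpha S (x ** y) = iota_alpha S x + iota_alpha S y"
  using valid unfolding valid_setting_def by - (elim conjE, assumption)+

lemma sub_unipN: "subgroup (unipN S) GLm" and normal_unipN: "unipN S \<lhd> subgrp (borelP S)"
  using unip_radical by (simp_all only: unipotent_radical_def normal_unipotent_def alg_group_def)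

lemma sub_torus: "subgroup (torusT S) GLm"
  using max_torus by (simp only: maximal_torus_def torus_def alg_group_def)

lemma torus_invertible: "t \<in> torusT S \<Longrightarrow> invertible t"
  using subgroup.subset[OF sub_torus] by auto

lemma of_nat_p_nonzero: "of_nat (prm S) \<noteq> (0 :: 'q alg_closure)"
  using p_gt_1 by simp

lemma xi_torus: "xi S (of_nat (prm S)) \<in> torusT S"
  using cochar of_nat_p_nonzero unfolding cocharacter_def by blast

lemma xi_mult: "a \<noteq> 0 \<Longrightarrow> b \<noteq> 0 \<Longrightarrow> xi S (a * b) = xi S a ** xi S b"
  using cochar unfolding cocharacter_def by blast

lemma xi_one: "xi S 1 = mat 1"
proof -
  have "invertible (xi S 1)"
    using cochar torus_invertible one_neq_zero unfolding cocharacter_def by blast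
  moreover have "xi S 1 \<otimes>\<^bsub>GLm\<^esub> xi S 1 = xi S 1" using xi_mult[of 1 1] by simp
  ultimately show ?thesis using GL.l_cancel_one[of "xi S 1" "xi S 1"] by simp
qed

text \<open>Diagonalized over the base field, \<open>\<xi>\<close> becomes a tuple of powers \<open>a\<^sup>n\<close>.\<close>

lemma xi_p_rational: "\<exists>t. of_mat t = xi S (of_nat (prm S))"
proof -
  obtain A where A: "of_mat A \<in> carrier GLm" "\<And>t. t \<in> torusT S \<Longrightarrow> is_diagonal (conj_by (of_mat A) t)"
  proof -
    obtain A where "A \<in> carrier GLm" "\<forall>t\<in>torusT S. is_diagonal (conj_by (of_mat A) t)"
      using split_torusT unfolding split_torus_def by blast
    then show ?thesis by (intro that[of A]) auto
  qed
  define A' where "A' = inv\<^bsub>GLm\<^esub> A"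
  have invA: "invertible A" "invertible A'"
    using A(1) GL.inv_closed[of A] by (auto simp: A'_def)
  have A'A: "A' ** A = mat 1" "A ** A' = mat 1"
    using GL.l_inv[of A] GL.r_inv[of A] invA by (auto simp: A'_def)
  define B where "B = of_mat A"
  define B' where "B' = of_mat A'"
  have BB: "B' ** B = mat 1" "B ** B' = mat 1" by (simp_all add: B_def B'_def A'A flip: of_mat_mult)
  have conj: "conj_by B t = B ** t ** B'" for t
    using invA by (simp add: conj_by_def B_def B'_def A'_def of_mat_inv)
  define E where "E a = conj_by B (xi S a)" for a
  have E1: "E 1 = mat 1" by (simp add: E_def xi_one conj BB)
  have Emult: "E (a * b) = E a ** E b" if "a \<noteq> 0" "b \<noteq> 0" for a b
  proof -
    have "E a ** E b = B ** xi S a ** (B' ** B) ** xi S b ** B'"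
      by (simp only: E_def conj matrix_mul_assoc)
    then show ?thesis unfolding BB E_def conj xi_mult[OF that] by (simp add: matrix_mul_assoc)
  qed
  have xi_in: "xi S a \<in> torusT S" if "a \<noteq> 0" for a
    using cochar that unfolding cocharacter_def by blast
  have Ediag: "E a $ i $ j = 0" if "a \<noteq> 0" "i \<noteq> j" for a i j
    using A(2)[OF xi_in[OF that(1)]] that(2) by (auto simp: E_def B_def is_diagonal_def)
  have Emult_ii: "E (a * b) $ i $ i = E a $ i $ i * E b $ i $ i" if "a \<noteq> 0" "b \<noteq> 0" for a b i
  proof -
    have "E (a * b) $ i $ i = (\<Sum>k\<in>UNIV. E a $ i $ k * E b $ k $ i)"
      by (simp add: Emult[OF that] matrix_matrix_mult_def)
    also have "\<dots> = (\<Sum>k\<in>UNIV. if k = i then E a $ i $ i * E b $ i $ i else 0)"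
      by (intro sum.cong) (auto simp: Ediag that)
    finally show ?thesis by simp
  qed
  have "\<exists>q m. \<forall>a. a \<noteq> 0 \<longrightarrow> E a $ i $ i = poly q a / a ^ m" for i
  proof -
    have "\<forall>k l. \<exists>q m. \<forall>a. a \<noteq> 0 \<longrightarrow> xi S a $ k $ l = poly q a / a ^ m"
      using cochar unfolding cocharacter_def by blast
    then obtain q m where qm: "\<And>k l a. a \<noteq> 0 \<Longrightarrow> xi S a $ k $ l = poly (q k l) a / a ^ m k l" by metis
    \<comment> \<open>A common exponent for the denominators of all entries of \<xi>: the sum of the
      individual exponents bounds each of them.\<close>
    define M where "M = (\<Sum>k\<in>UNIV. \<Sum>l\<in>UNIV. m k l)"
    have mM: "m k l \<le> M" for k l
    proof -
      have "m k l \<le> (\<Sum>l\<in>UNIV. m k l)" by (rule member_le_sum) auto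
      also have "\<dots> \<le> M" unfolding M_def by (rule member_le_sum[where f = "\<lambda>k. \<Sum>l\<in>UNIV. m k l"]) auto
      finally show ?thesis .
    qed
    define Q where "Q = (\<Sum>l\<in>UNIV. \<Sum>k\<in>UNIV. Polynomial.smult (B $ i $ k * B' $ l $ i) (q k l * Polynomial.monom 1 (M - m k l)))"
    have "E a $ i $ i = poly Q a / a ^ M" if a: "a \<noteq> 0" for a
    proof -
      have "E a $ i $ i = (\<Sum>l\<in>UNIV. (\<Sum>k\<in>UNIV. B $ i $ k * xi S a $ k $ l) * B' $ l $ i)"
        by (simp add: E_def conj matrix_matrix_mult_def)
      also have "\<dots> = (\<Sum>l\<in>UNIV. \<Sum>k\<in>UNIV. B $ i $ k * B' $ l $ i * (poly (q k l) a * a ^ (M - m k l)) / a ^ M)"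
        unfolding sum_distrib_right
      proof (intro sum.cong refl)
        fix k l
        have "a ^ M = a ^ (M - m k l) * a ^ m k l" using mM[of k l] by (simp flip: power_add)
        then show "B $ i $ k * xi S a $ k $ l * B' $ l $ i
            = B $ i $ k * B' $ l $ i * (poly (q k l) a * a ^ (M - m k l)) / a ^ M"
          using a by (simp add: qm[OF a] field_simps)
      qed
      also have "\<dots> = poly Q a / a ^ M"
        by (simp add: Q_def poly_sum poly_monom sum_divide_distrib)
      finally show ?thesis .
    qed
    then show ?thesis by blast
  qed
  then obtain q m where qm: "\<And>i a. a \<noteq> 0 \<Longrightarrow> E a $ i $ i = poly (q i) a / a ^ m i" by metis
  have "E (of_nat (prm S)) $ i $ i \<in> range to_ac" for i
  proof -
    have "\<exists>n. q i = Polynomial.monom 1 n"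
    proof (rule multiplicative_poly_is_power)
      \<comment> \<open>The diagonal entries of E are multiplicative and so are the denominators,
        hence the numerators are multiplicative as well.\<close>
      fix a b :: "'q alg_closure" assume ab: "a \<noteq> 0" "b \<noteq> 0"
      then have "poly (q i) (a * b) / (a * b) ^ m i = (poly (q i) a / a ^ m i) * (poly (q i) b / b ^ m i)"
        using Emult_ii[OF ab, of i] qm[of a i] qm[of b i] qm[of "a * b" i] by simp
      then show "poly (q i) (a * b) = poly (q i) a * poly (q i) b"
        using ab by (simp add: power_mult_distrib)
    next
      show "poly (q i) 1 = 1" using qm[of 1 i] E1 by (simp add: mat_def)
    qed
    then obtain n where n: "q i = Polynomial.monom 1 n" by blast
    have "E (of_nat (prm S)) $ i $ i = to_ac (of_nat (prm S) ^ n / of_nat (prm S) ^ m i)"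
      using qm[OF of_nat_p_nonzero, of i] n by (simp add: poly_monom)
    then show ?thesis by (metis rangeI)
  qed
  then have e: "E (of_nat (prm S)) $ i $ i = to_ac (of_ac (E (of_nat (prm S)) $ i $ i))" for i
    by (simp add: to_ac_of_ac)
  define e where "e i = of_ac (E (of_nat (prm S)) $ i $ i)" for i
  note e = e[folded e_def]
  define D where "D = (\<chi> i j. if i = j then e i else 0)"
  have D: "of_mat D = E (of_nat (prm S))"
    by (auto simp: vec_eq_iff of_mat_def D_def e Ediag[OF of_nat_p_nonzero])
  \<comment> \<open>The diagonalizing matrix is itself rational, so undoing the conjugation keeps
    the entries in the base field.\<close>
  have "of_mat (A' ** D ** A) = B' ** (B ** xi S (of_nat (prm S)) ** B') ** B"
    by (simp only: of_mat_mult D E_def conj B_def[symmetric] B'_def[symmetric])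
  also have "\<dots> = (B' ** B) ** xi S (of_nat (prm S)) ** (B' ** B)" by (simp only: matrix_mul_assoc)
  finally show ?thesis by (auto simp: BB)
qed

section \<open>The action of s on root subgroups\<close>

lemma of_mat_s: "of_mat (s_elt S) = xi S (of_nat (prm S))"
proof -
  obtain t where t: "of_mat t = xi S (of_nat (prm S))" using xi_p_rational by blast
  then have "s_elt S = t" unfolding s_elt_def by (intro the_equality) (auto intro: of_mat_eq_iff[THEN iffD1])
  with t show ?thesis by simp
qed

lemma s_invertible: "invertible (s_elt S)"
  using torus_invertible[OF xi_torus] unfolding of_mat_s[symmetric] by simp

text \<open>In the parametrization x of the root subgroup, conjugation multiplies the parameter by
  b(\<xi>(p)) = N, and multiplying the parameter by a natural number N is taking the N-th
  power.\<close>

lemma conj_root_pts: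
  assumes b: "b \<in> pos_roots S" and bs: "b (xi S (of_nat (prm S))) = of_nat N" and g: "g \<in> root_pts S b"
  shows "conj_by (s_elt S) g = g [^]\<^bsub>GLm\<^esub> (N :: nat)"
proof -
  obtain x :: "'q alg_closure \<Rightarrow> ('q, 'n) gmat" where x: "range x = root_grp S b"
    "\<And>t a. t \<in> torusT S \<Longrightarrow> conj_by t (x a) = x (b t * a)"
    "\<And>a. invertible (x a)" "\<And>a k. x a [^]\<^bsub>GLm\<^esub> (k::nat) = x (of_nat k * a)"
    by (rule root_parametrization[OF b]) metis
  obtain a where a: "of_mat g = x a" using g x(1) by (auto simp: root_pts_def rational_points_def)
  have "invertible g" using x(3)[of a] by (simp flip: a)
  then have "of_mat (conj_by (s_elt S) g) = of_mat (g [^]\<^bsub>GLm\<^esub> N)"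
    by (simp add: of_mat_conj_by[OF s_invertible] of_mat_pow of_mat_s a x(2)[OF xi_torus] bs x(4))
  then show ?thesis by simp
qed

lemma simple_root_xi: "b \<in> simple S \<Longrightarrow> b (xi S (of_nat (prm S))) = of_nat (prm S)"
  using simple_xi of_nat_p_nonzero by blast

lemma finite_simple: "finite (simple S)" and simple_pos: "simple S \<subseteq> pos_roots S"
  using simple_roots by (simp_all only: simple_roots_def)

lemma characters_extensional: "b \<in> pos_roots S \<Longrightarrow> b \<in> extensional (torusT S)"
  by (auto simp: pos_roots_def weights_on_def characters_def)

text \<open>h is the height of b, because every simple root takes the value p on \<xi>(p). Height 1
  leaves one simple root with multiplicity one; it equals b as a function because characters are
  extensional.\<close>

lemma pos_root_height:
  assumes b: "b \<in> pos_roots S"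
  obtains h where "b (xi S (of_nat (prm S))) = of_nat (prm S ^ h)" "h = 1 \<Longrightarrow> b \<in> simple S"
proof -
  obtain m where m: "\<And>t. t \<in> torusT S \<Longrightarrow> b t = (\<Prod>d\<in>simple S. d t ^ m d)"
  proof -
    have "\<forall>b\<in>pos_roots S. \<exists>m. \<forall>t\<in>torusT S. b t = (\<Prod>d\<in>simple S. d t ^ m d)"
      using simple_roots unfolding simple_roots_def by (elim conjE)
    from bspec[OF this b] show ?thesis using that by blast
  qed
  define h where "h = (\<Sum>d\<in>simple S. m d)"
  have "b (xi S (of_nat (prm S))) = (\<Prod>d\<in>simple S. of_nat (prm S) ^ m d)"
    using m[OF xi_torus] by (simp add: simple_root_xi)
  also have "\<dots> = of_nat (prm S ^ h)" by (simp add: h_def power_sum)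
  finally have "b (xi S (of_nat (prm S))) = of_nat (prm S ^ h)" .
  moreover have "b \<in> simple S" if h1: "h = 1"
  proof -
    have "\<exists>d\<in>simple S. m d = 1 \<and> (\<forall>d'\<in>simple S. d \<noteq> d' \<longrightarrow> m d' = 0)"
      using h1 sum_eq_1_iff[OF finite_simple, of m] by (simp add: h_def)
    then obtain d where d: "d \<in> simple S" "m d = 1" and m0: "\<forall>d'\<in>simple S. d \<noteq> d' \<longrightarrow> m d' = 0"
      by (elim bexE conjE)
    have "b t = d t" if t: "t \<in> torusT S" for t
    proof -
      have "b t = (\<Prod>d'\<in>simple S. if d' = d then d t else 1)"
        unfolding m[OF t]
      proof (rule prod.cong)
        fix d' assume "d' \<in> simple S"
        then show "d' t ^ m d' = (if d' = d then d t else 1)"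
          using bspec[OF m0, of d'] d(2) by (cases "d' = d") simp_all
      qed simp
      then show ?thesis using finite_simple d(1) by simp
    qed
    then have "b = d"
      using characters_extensional[OF b] characters_extensional[of d] d(1) simple_pos
      by (intro extensionalityI[of _ "torusT S"]) auto
    then show ?thesis using d(1) by simp
  qed
  ultimately show ?thesis by (rule that)
qed

lemma sub_Npts: "subgroup (Npts S) GLm"
  unfolding Npts_def
  by (rule subgroup_rational_points[OF sub_unipN])

lemma root_pts_subset: "b \<in> pos_roots S \<Longrightarrow> root_pts S b \<subseteq> Npts S"
  using root_grps unfolding root_pts_def Npts_def rational_points_def by blast

lemma sub_root_pts: "b \<in> pos_roots S \<Longrightarrow> subgroup (root_pts S b) GLm"
  unfolding root_pts_def
  by (rule subgroup_rational_points) (use root_sub in \<open>auto simp: root_subgroup_def alg_group_def\<close>)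

lemma Npts_invertible: "g \<in> Npts S \<Longrightarrow> invertible g"
  using subgroup.subset[OF sub_Npts] by auto

text \<open>T normalizes N, since N is normal in P = TN. Equality rather than inclusion comes from
  applying this to the inverse of s as well.\<close>

lemma conj_s_Npts: "conj_by (s_elt S) ` Npts S = Npts S"
proof -
  have subP: "subgroup (borelP S) GLm"
    using borel by (simp only: borel_subgroup_def connected_solvable_def alg_group_def)
  have TP: "torusT S \<subseteq> borelP S"
  proof
    fix t assume "t \<in> torusT S"
    then have "t ** mat 1 \<in> torusT S <#>\<^bsub>GLm\<^esub> unipN S"
      using subgroup.one_closed[OF sub_unipN] unfolding set_mult_def mult_GLm one_GLm by blast
    then show "t \<in> borelP S" by (simp add: borel_eq)
  qed
  have *: "conj_by u g \<in> Npts S" if u: "of_mat u \<in> torusT S" and g: "g \<in> Npts S" for u g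
  proof -
    have inv: "invertible u" using torus_invertible[OF u] by simp
    have uP: "of_mat u \<in> borelP S" using u TP by blast
    have "of_mat u ** of_mat g ** inv\<^bsub>subgrp (borelP S)\<^esub> (of_mat u) \<in> unipN S"
      using normal.inv_op_closed2[OF normal_unipN, of "of_mat u" "of_mat g"] u g TP
      by (auto simp: Npts_def rational_points_def)
    then have "of_mat (conj_by u g) \<in> unipN S"
      unfolding of_mat_conj_by[OF inv] unfolding conj_by_def GL.m_inv_consistent[OF subP uP] .
    then show ?thesis by (simp add: Npts_def rational_points_def)
  qed
  have sT: "of_mat (s_elt S) \<in> torusT S" using xi_torus by (simp add: of_mat_s)
  then have sT': "of_mat (inv\<^bsub>GLm\<^esub> (s_elt S)) \<in> torusT S"
    using subgroup.m_inv_closed[OF sub_torus] by (simp add: of_mat_inv s_invertible)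
  show ?thesis
  proof (intro equalityI subsetI)
    fix g assume g: "g \<in> Npts S"
    have "g = conj_by (s_elt S) (conj_by (inv\<^bsub>GLm\<^esub> (s_elt S)) g)"
      by (rule conj_by_inv[OF s_invertible Npts_invertible[OF g], symmetric])
    then show "g \<in> conj_by (s_elt S) ` Npts S" using *[OF sT' g] by blast
  qed (use *[OF sT] in auto)
qed

section \<open>The abelianization of N and the homomorphism \<open>ell\<close>\<close>

abbreviation "DN \<equiv> derived GLm (Npts S)"
abbreviation "ab \<equiv> subgrp (Npts S) Mod DN"

lemma normal_DN: "DN \<lhd> subgrp (Npts S)"
  by (rule GL.derived_subgroup_is_normal[OF sub_Npts])

lemma comm_group_ab: "comm_group ab"
  by (rule GL.derived_quot_of_subgroup_is_comm_group[OF sub_Npts])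

lemma rcoset_subgrp: "A #>\<^bsub>subgrp H\<^esub> x = A #>\<^bsub>GLm\<^esub> x"
  by (simp add: r_coset_def)

lemma ab_hom: "(\<lambda>n. DN #>\<^bsub>GLm\<^esub> n) \<in> hom (subgrp (Npts S)) ab"
  using normal.r_coset_hom_Mod[OF normal_DN] by (simp add: rcoset_subgrp)

lemma ab_closed: "n \<in> Npts S \<Longrightarrow> DN #>\<^bsub>GLm\<^esub> n \<in> carrier ab"
  using hom_in_carrier[OF ab_hom] by simp

lemma ab_mult: "n \<in> Npts S \<Longrightarrow> n' \<in> Npts S \<Longrightarrow>
    DN #>\<^bsub>GLm\<^esub> (n ** n') = (DN #>\<^bsub>GLm\<^esub> n) \<otimes>\<^bsub>ab\<^esub> (DN #>\<^bsub>GLm\<^esub> n')"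
  using hom_mult[OF ab_hom] by simp

lemma simple_pts_Npts: "a \<in> (\<Pi>\<^sub>E b\<in>simple S. root_pts S b) \<Longrightarrow> b \<in> simple S \<Longrightarrow> a b \<in> Npts S"
  using root_pts_subset simple_pos by (auto simp: PiE_iff)

lemma ell_proj_mem: "n \<in> Npts S \<Longrightarrow> ell_proj S n \<in> (\<Pi>\<^sub>E b\<in>simple S. root_pts S b)"
  using vell by (auto simp: valid_ell_proj_def)

lemma ell_proj_iff: "n \<in> Npts S \<Longrightarrow> a \<in> (\<Pi>\<^sub>E b\<in>simple S. root_pts S b) \<Longrightarrow>
    ell_proj S n = a \<longleftrightarrow> DN #>\<^bsub>GLm\<^esub> n = finprod ab (\<lambda>b. DN #>\<^bsub>GLm\<^esub> a b) (simple S)"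
  using vell by (auto simp: valid_ell_proj_def)

lemma iota_add: "x \<in> root_pts S (alpha S) \<Longrightarrow> y \<in> root_pts S (alpha S) \<Longrightarrow>
    iota_alpha S (x ** y) = iota_alpha S x + iota_alpha S y"
  using iota_add' by blast

lemma iota_one: "iota_alpha S (mat 1) = 0"
proof -
  have "mat 1 \<in> root_pts S (alpha S)"
    using subgroup.one_closed[OF sub_root_pts[OF alpha_pos]] by simp
  from iota_add[OF this this] show ?thesis by simp
qed

lemma iota_pow: "x \<in> root_pts S (alpha S) \<Longrightarrow> iota_alpha S (x [^]\<^bsub>GLm\<^esub> (k::nat)) = of_nat k * iota_alpha S x"
proof (induction k)
  case (Suc k)
  have "x [^]\<^bsub>GLm\<^esub> k \<in> root_pts S (alpha S)"
    using subgroup.m_closed[OF sub_root_pts[OF alpha_pos]] subgroup.one_closed[OF sub_root_pts[OF alpha_pos]] Suc.prems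
    by (induction k) auto
  then show ?case using Suc iota_add by (simp add: algebra_simps)
qed (simp add: iota_one)

text \<open>\<open>ell_proj\<close> is characterized by a factorization in N/[N,N]. As this group is
  commutative, the componentwise product of two factorizations is one of the product.\<close>

lemma ell_mult:
  assumes n: "n \<in> Npts S" "n' \<in> Npts S"
  shows "ell S (n ** n') = ell S n + ell S n'"
proof -
  interpret ab: comm_group ab by (rule comm_group_ab)
  define a where "a = ell_proj S n"
  define a' where "a' = ell_proj S n'"
  have a: "a \<in> (\<Pi>\<^sub>E b\<in>simple S. root_pts S b)" "a' \<in> (\<Pi>\<^sub>E b\<in>simple S. root_pts S b)"
    using ell_proj_mem n by (auto simp: a_def a'_def)
  define c where "c = (\<lambda>b\<in>simple S. a b ** a' b)"
  have c: "c \<in> (\<Pi>\<^sub>E b\<in>simple S. root_pts S b)"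
    using a subgroup.m_closed[OF sub_root_pts] simple_pos by (auto simp: c_def PiE_iff)
  have nn: "n ** n' \<in> Npts S" using subgroup.m_closed[OF sub_Npts] n by simp
  have "DN #>\<^bsub>GLm\<^esub> (n ** n') = finprod ab (\<lambda>b. DN #>\<^bsub>GLm\<^esub> a b) (simple S) \<otimes>\<^bsub>ab\<^esub> finprod ab (\<lambda>b. DN #>\<^bsub>GLm\<^esub> a' b) (simple S)"
    using ell_proj_iff[OF n(1) a(1)] ell_proj_iff[OF n(2) a(2)] ab_mult[OF n] a_def a'_def by simp
  also have "\<dots> = finprod ab (\<lambda>b. (DN #>\<^bsub>GLm\<^esub> a b) \<otimes>\<^bsub>ab\<^esub> (DN #>\<^bsub>GLm\<^esub> a' b)) (simple S)"
    by (rule ab.finprod_multf[symmetric]) (use a simple_pts_Npts ab_closed in blast)+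
  also have "\<dots> = finprod ab (\<lambda>b. DN #>\<^bsub>GLm\<^esub> c b) (simple S)"
  proof (rule ab.finprod_cong')
    fix b assume b: "b \<in> simple S"
    show "(DN #>\<^bsub>GLm\<^esub> a b) \<otimes>\<^bsub>ab\<^esub> (DN #>\<^bsub>GLm\<^esub> a' b) = DN #>\<^bsub>GLm\<^esub> c b"
      using ab_mult[OF simple_pts_Npts[OF a(1) b] simple_pts_Npts[OF a(2) b]] b by (simp add: c_def)
  qed (use c simple_pts_Npts ab_closed in blast)+
  finally have "ell_proj S (n ** n') = c" using ell_proj_iff[OF nn c] by simp
  then show ?thesis
    using iota_add a alpha_simple by (simp add: ell_def c_def PiE_iff a_def a'_def)
qed

lemma Npts_pow: "n \<in> Npts S \<Longrightarrow> n [^]\<^bsub>GLm\<^esub> (k::nat) \<in> Npts S"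
  using subgroup.m_closed[OF sub_Npts] subgroup.one_closed[OF sub_Npts] by (induction k) auto

lemma ell_pow:
  assumes n: "n \<in> Npts S"
  shows "ell S (n [^]\<^bsub>GLm\<^esub> (k::nat)) = of_nat k * ell S n"
proof (induction k)
  case 0
  have one: "mat 1 \<in> Npts S" using subgroup.one_closed[OF sub_Npts] by simp
  show ?case using ell_mult[OF one one] by simp
next
  case (Suc k)
  then show ?case using ell_mult[OF Npts_pow[OF n, of k] n] by (simp add: algebra_simps)
qed

text \<open>Conjugation by s maps N onto N, hence [N,N] onto itself, and so acts on N/[N,N]. There
  it is the p-th power on each simple root factor, and \<open>iota_alpha\<close> turns the p-th
  power into multiplication by p.\<close>

lemma ell_conj_s:
  assumes n: "n \<in> Npts S"
  shows "ell S (conj_by (s_elt S) n) = of_nat (prm S) * ell S n"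
proof -
  interpret ab: comm_group ab by (rule comm_group_ab)
  let ?c = "conj_by (s_elt S)"
  interpret c: group_hom GLm GLm ?c by (rule group_hom_conj_by[OF s_invertible])
  have cN: "?c g \<in> Npts S" if "g \<in> Npts S" for g using conj_s_Npts that by blast
  have sub: "Npts S \<subseteq> carrier GLm" using subgroup.subset[OF sub_Npts] .
  have DNsub: "DN \<subseteq> carrier GLm" using GL.derived_in_carrier[OF sub] .
  have cD: "?c ` DN = DN" using c.derived_img[OF sub] conj_s_Npts by simp
  have ccoset: "?c ` (DN #>\<^bsub>GLm\<^esub> g) = DN #>\<^bsub>GLm\<^esub> ?c g" if g: "g \<in> Npts S" for g
  proof -
    have "?c ` (DN #>\<^bsub>GLm\<^esub> g) = (\<lambda>d. ?c d ** ?c g) ` DN"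
      unfolding r_coset_def using DNsub sub g c.hom_mult by (auto simp: image_iff subset_iff)
    also have "\<dots> = (?c ` DN) #>\<^bsub>GLm\<^esub> ?c g" unfolding r_coset_def by auto
    finally show ?thesis unfolding cD .
  qed
  have carr: "\<exists>g\<in>Npts S. x = DN #>\<^bsub>GLm\<^esub> g" if "x \<in> carrier ab" for x
    using that by (auto simp: carrier_FactGroup rcoset_subgrp)
  have hom: "(\<lambda>x. ?c ` x) \<in> hom ab ab"
  proof (rule homI)
    fix x y assume x: "x \<in> carrier ab" and y: "y \<in> carrier ab"
    obtain g where g: "g \<in> Npts S" "x = DN #>\<^bsub>GLm\<^esub> g" using carr[OF x] by blast
    obtain g' where g': "g' \<in> Npts S" "y = DN #>\<^bsub>GLm\<^esub> g'" using carr[OF y] by blast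
    show "?c ` x \<in> carrier ab" using g ccoset cN ab_closed by simp
    have "g ** g' \<in> Npts S" using subgroup.m_closed[OF sub_Npts] g g' by simp
    then have "?c ` (x \<otimes>\<^bsub>ab\<^esub> y) = DN #>\<^bsub>GLm\<^esub> ?c (g ** g')"
      unfolding g(2) g'(2) ab_mult[OF g(1) g'(1), symmetric] by (rule ccoset)
    also have "?c (g ** g') = ?c g ** ?c g'" using c.hom_mult[of g g'] Npts_invertible g g' by simp
    finally show "?c ` (x \<otimes>\<^bsub>ab\<^esub> y) = ?c ` x \<otimes>\<^bsub>ab\<^esub> ?c ` y"
      using g g' ccoset ab_mult cN by simp
  qed
  define a where "a = ell_proj S n"
  have a: "a \<in> (\<Pi>\<^sub>E b\<in>simple S. root_pts S b)" using ell_proj_mem n by (auto simp: a_def)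
  define d where "d = (\<lambda>b\<in>simple S. a b [^]\<^bsub>GLm\<^esub> prm S)"
  have root_pow: "g [^]\<^bsub>GLm\<^esub> (k::nat) \<in> root_pts S b" if "b \<in> simple S" "g \<in> root_pts S b" for g b k
    using subgroup.m_closed[OF sub_root_pts] subgroup.one_closed[OF sub_root_pts] that simple_pos
    by (induction k) auto
  have d: "d \<in> (\<Pi>\<^sub>E b\<in>simple S. root_pts S b)"
    using a root_pow by (auto simp: d_def PiE_iff)
  have "DN #>\<^bsub>GLm\<^esub> ?c n = ?c ` finprod ab (\<lambda>b. DN #>\<^bsub>GLm\<^esub> a b) (simple S)"
    using ell_proj_iff[OF n a] a_def ccoset[OF n] by simp
  also have "\<dots> = finprod ab (\<lambda>b. ?c ` (DN #>\<^bsub>GLm\<^esub> a b)) (simple S)"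
    by (rule hom_finprod_comm_group[OF comm_group_ab comm_group_ab hom finite_simple])
       (use a simple_pts_Npts ab_closed in blast)
  also have "\<dots> = finprod ab (\<lambda>b. DN #>\<^bsub>GLm\<^esub> d b) (simple S)"
  proof (rule ab.finprod_cong')
    fix b assume b: "b \<in> simple S"
    have "?c (a b) = a b [^]\<^bsub>GLm\<^esub> prm S"
      using conj_root_pts[of b "prm S" "a b"] simple_root_xi[OF b] b simple_pos a by (auto simp: PiE_iff)
    then show "?c ` (DN #>\<^bsub>GLm\<^esub> a b) = DN #>\<^bsub>GLm\<^esub> d b"
      using ccoset[OF simple_pts_Npts[OF a b]] b by (simp add: d_def)
  qed (use d simple_pts_Npts ab_closed in blast)+
  finally have "ell_proj S (?c n) = d" using ell_proj_iff[OF cN[OF n] d] by simp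
  then show ?thesis
    using iota_pow a alpha_simple by (simp add: ell_def d_def PiE_iff a_def)
qed

text \<open>For \<open>b\<close> not simple: on \<open>N/[N,N]\<close>, conjugation by \<open>s\<close> is the \<open>p\<close>-th power map, but it raises
  \<open>n\<^sub>b\<close> to the power \<open>p\<^sup>h\<close> with \<open>h \<noteq> 1\<close>.\<close>

lemma ell_top_gen:
  assumes b: "b \<in> pos_roots S" "b \<noteq> alpha S"
  shows "ell S (top_gen S b) = 0"
proof (cases "b \<in> simple S")
  case True
  interpret ab: comm_group ab by (rule comm_group_ab)
  have g: "top_gen S b \<in> root_pts S b" "top_gen S b \<in> Npts S"
    using top_gen_in[OF b(1)] root_pts_subset[OF b(1)] by auto
  \<comment> \<open>For b simple the factorization of n_b is concentrated at b, so its component at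
    \<alpha> is trivial.\<close>
  define a where "a = (\<lambda>b'\<in>simple S. if b' = b then top_gen S b else mat 1)"
  have a: "a \<in> (\<Pi>\<^sub>E b\<in>simple S. root_pts S b)"
    using g subgroup.one_closed[OF sub_root_pts] simple_pos by (auto simp: a_def)
  have one: "DN #>\<^bsub>GLm\<^esub> mat 1 = \<one>\<^bsub>ab\<^esub>"
    using GL.coset_mult_one[of DN] GL.derived_in_carrier[OF subgroup.subset[OF sub_Npts]] by simp
  have "finprod ab (\<lambda>b'. DN #>\<^bsub>GLm\<^esub> a b') (simple S)
      = finprod ab (\<lambda>b'. if b' = b then DN #>\<^bsub>GLm\<^esub> top_gen S b else \<one>\<^bsub>ab\<^esub>) (simple S)"
    by (rule ab.finprod_cong') (use one ab_closed[OF g(2)] ab.one_closed in \<open>auto simp: a_def\<close>)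
  also have "\<dots> = DN #>\<^bsub>GLm\<^esub> top_gen S b"
    by (rule ab.finprod_singleton_swap[OF True finite_simple]) (use ab_closed[OF g(2)] in auto)
  finally have "ell_proj S (top_gen S b) = a" using ell_proj_iff[OF g(2) a] by simp
  then show ?thesis using alpha_simple b(2) by (simp add: ell_def a_def iota_one)
next
  case False
  obtain h where h: "b (xi S (of_nat (prm S))) = of_nat (prm S ^ h)" "h = 1 \<Longrightarrow> b \<in> simple S"
    by (rule pos_root_height[OF b(1)]) blast
  have g: "top_gen S b \<in> root_pts S b" "top_gen S b \<in> Npts S"
    using top_gen_in[OF b(1)] root_pts_subset[OF b(1)] by auto
  have "of_nat (prm S ^ h) * ell S (top_gen S b) = of_nat (prm S) * ell S (top_gen S b)"
    using ell_conj_s[OF g(2)] conj_root_pts[OF b(1) h(1) g(1)] ell_pow[OF g(2)] by simp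
  moreover have "prm S ^ h \<noteq> prm S ^ 1" using h(2) False p_gt_1 by (metis power_inject_exp)
  then have "(of_nat (prm S ^ h) :: 'q) \<noteq> of_nat (prm S)" by (metis of_nat_eq_iff power_one_right)
  ultimately show ?thesis by (simp del: of_nat_power)
qed

lemma top_gen_in_N1:
  assumes "b \<in> pos_roots S" "b \<noteq> alpha S"
  shows "top_gen S b \<in> N1 S"
  using ell_top_gen[OF assms] top_gen_in[OF assms(1)] by (simp add: N1_def)

section \<open>The subgroups N_k and the image of the logarithm in K[N_1/N_k]\<close>

lemma sub_Nk: "subgroup (Nk S k) GLm"
  unfolding Nk_def
proof (rule GL.generate_is_subgroup, safe)
  fix g x assume g: "g \<in> N0 S" and x: "x \<in> N1 S"
  have "invertible ((conj_by (s_elt S) ^^ j) x)" for j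
  proof (induction j)
    case 0
    show ?case using x N0_invertible by (auto simp: N1_def)
  next
    case (Suc j)
    then show ?case using group_hom.hom_closed[OF group_hom_conj_by[OF s_invertible]] by simp
  qed
  then show "conj_by g ((conj_by (s_elt S) ^^ (k - 1)) x) \<in> carrier GLm"
    using group_hom.hom_closed[OF group_hom_conj_by[OF N0_invertible[OF g]]] by simp
qed

lemma top_gen_pow_in_Nk:
  assumes b: "b \<in> pos_roots S" "b \<noteq> alpha S"
  obtains q where "q > 0" "top_gen S b [^]\<^bsub>GLm\<^esub> (q::nat) \<in> Nk S k"
proof -
  obtain h where h: "b (xi S (of_nat (prm S))) = of_nat (prm S ^ h)"
    by (rule pos_root_height[OF b(1)]) blast
  interpret c: group_hom GLm GLm "conj_by (s_elt S)" by (rule group_hom_conj_by[OF s_invertible])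
  let ?n = "top_gen S b"
  have inv: "invertible ?n" using top_gen_invertible[OF b(1)] .
  have one: "conj_by (s_elt S) ?n = ?n [^]\<^bsub>GLm\<^esub> (prm S ^ h)"
    using conj_root_pts[OF b(1) h] top_gen_in[OF b(1)] by simp
  have "(conj_by (s_elt S) ^^ j) ?n = ?n [^]\<^bsub>GLm\<^esub> (prm S ^ (h * j))" for j
  proof (induction j)
    case (Suc j)
    have "(conj_by (s_elt S) ^^ Suc j) ?n = conj_by (s_elt S) (?n [^]\<^bsub>GLm\<^esub> (prm S ^ (h * j)))"
      using Suc by simp
    also have "\<dots> = conj_by (s_elt S) ?n [^]\<^bsub>GLm\<^esub> (prm S ^ (h * j))"
      using inv by (simp add: c.hom_nat_pow)
    also have "\<dots> = ?n [^]\<^bsub>GLm\<^esub> (prm S ^ h * prm S ^ (h * j))"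
      unfolding one using inv by (simp add: GL.nat_pow_pow)
    finally show ?case by (simp add: power_add)
  qed (use inv in \<open>simp add: GL.nat_pow_eone\<close>)
  \<comment> \<open>The (k-1)-st iterate of n_b is itself a generator of \<open>Nk\<close>, with 1
    in N_0 as conjugating element; hence q = p^(h (k-1)).\<close>
  then have "conj_by (mat 1) ((conj_by (s_elt S) ^^ (k - 1)) ?n) = ?n [^]\<^bsub>GLm\<^esub> (prm S ^ (h * (k - 1)))"
    by simp
  then have "?n [^]\<^bsub>GLm\<^esub> (prm S ^ (h * (k - 1))) \<in> Nk S k"
    unfolding Nk_def using one_in_N0 top_gen_in_N1[OF b] by (metis (mono_tags, lifting) generate.incl mem_Collect_eq)
  then show ?thesis using p_gt_1 by (intro that[of "prm S ^ (h * (k - 1))"]) auto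
qed

lemma proj_coeff_log_gen:
  assumes b: "b \<in> pos_roots S" "b \<noteq> alpha S" and u: "u \<in> N1_mod S k"
  shows "proj_coeff S (log_gen b) u = 0"
proof -
  let ?n = "top_gen S b"
  obtain q where q: "q > 0" "?n [^]\<^bsub>GLm\<^esub> (q::nat) \<in> Nk S k" by (rule top_gen_pow_in_Nk[OF b])
  obtain g where g: "g \<in> N1 S" "u = Nk S k #>\<^bsub>GLm\<^esub> g"
    using u by (auto simp: N1_mod_def RCOSETS_def rcoset_subgrp)
  have inv: "invertible ?n" using top_gen_invertible[OF b(1)] .
  define f :: "nat \<Rightarrow> 'k" where "f i = (if ?n [^]\<^bsub>GLm\<^esub> i \<in> u then 1 else 0)" for i
  have "f (q * j) = f 0" for j
  proof -
    let ?m = "?n [^]\<^bsub>GLm\<^esub> (q * j)"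
    have m: "?m \<in> Nk S k"
    proof -
      have "?m = (?n [^]\<^bsub>GLm\<^esub> q) [^]\<^bsub>GLm\<^esub> j" using inv by (simp add: GL.nat_pow_pow)
      moreover have "x [^]\<^bsub>GLm\<^esub> i \<in> Nk S k" if "x \<in> Nk S k" for x and i :: nat
        using subgroup.m_closed[OF sub_Nk] subgroup.one_closed[OF sub_Nk] that by (induction i) auto
      ultimately show ?thesis using q(2) by simp
    qed
    \<comment> \<open>u is a right coset of N_k, hence stable under left multiplication by elements
      of N_k and by their inverses.\<close>
    have "?m \<in> u \<longleftrightarrow> mat 1 \<in> u"
    proof
      assume "mat 1 \<in> u"
      then obtain x where x: "x \<in> Nk S k" "mat 1 = x ** g" unfolding g(2) r_coset_def by auto
      then have "?m = (?m ** x) ** g" by (metis matrix_mul_assoc matrix_mul_rid)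
      moreover have "?m ** x \<in> Nk S k" using subgroup.m_closed[OF sub_Nk m x(1)] by simp
      ultimately show "?m \<in> u" unfolding g(2) r_coset_def by auto
    next
      assume "?m \<in> u"
      then obtain x where x: "x \<in> Nk S k" "?m = x ** g" unfolding g(2) r_coset_def by auto
      have m': "inv\<^bsub>GLm\<^esub> ?m \<in> Nk S k" using subgroup.m_inv_closed[OF sub_Nk m] .
      have "inv\<^bsub>GLm\<^esub> ?m ** ?m = mat 1"
        using GL.l_inv[OF subgroup.mem_carrier[OF sub_Nk m]] by simp
      then have "mat 1 = (inv\<^bsub>GLm\<^esub> ?m ** x) ** g" by (metis x(2) matrix_mul_assoc)
      moreover have "inv\<^bsub>GLm\<^esub> ?m ** x \<in> Nk S k" using subgroup.m_closed[OF sub_Nk m' x(1)] by simp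
      ultimately show "mat 1 \<in> u" unfolding g(2) r_coset_def by auto
    qed
    then show ?thesis by (simp add: f_def)
  qed
  then have "infsum (\<lambda>k. (if k \<ge> 1 then (-1) ^ (k + 1) / of_nat k else 0) * mahler_coeff f k) UNIV = 0"
    by (rule log_functional_periodic[OF prime_p vabs_p_coeff q(1)])
  moreover have "proj_coeff S (log_gen b) u
      = infsum (\<lambda>k. log_gen b ((\<lambda>_. 0)(b := k)) * mahler_coeff f k) UNIV"
    unfolding proj_coeff_def f_def by (rule dist_apply_single[OF b(1) log_gen_single])
  ultimately show ?thesis by (simp only: log_gen_at)
qed

end


section \<open>Distributions in the microlocalizations\<close>

context valid_microloc_loc
begin

text \<open>The coherent family representing d in D_[r1,1), and the representative chosen in
  \<open>R0_incl\<close>.\<close>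

definition memb_family :: "('q, 'k, 'n) distr \<Rightarrow> real \<Rightarrow> real \<Rightarrow> 'a" where
  "memb_family d r1 = (\<lambda>r2\<in>above S r1. memb M r1 r2 d)"

lemma restrictions: "valid_restrictions S M"
  using vmicro by (simp add: valid_microloc_def)

lemma transitions: "valid_transitions S M"
  using vmicro by (simp add: valid_microloc_def)

lemma mres_memb:
  assumes "(r1, r2) \<in> intervals S" "(s1, s2) \<in> intervals S" "r1 \<le> s1" "s2 \<le> r2" "d \<in> distN0 S"
  shows "mres M (r1, r2) (s1, s2) (memb M r1 r2 d) = memb M s1 s2 d"
proof -
  have "d \<in> carrier (Dcompl S r2)"
    using distN0_in_Dcompl[OF assms(5)] radii_bounds assms(1) by (auto simp: intervals_def)
  then show ?thesis
    using restrictions assms(1-4) unfolding valid_restrictions_def subinterval_def by fastforce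
qed

lemma mres_comp:
  assumes "(r1, r2) \<in> intervals S" "(s1, s2) \<in> intervals S" "(t1, t2) \<in> intervals S"
    "r1 \<le> s1" "s2 \<le> r2" "s1 \<le> t1" "t2 \<le> s2" "x \<in> carrier (mring M r1 r2)"
  shows "mres M (s1, s2) (t1, t2) (mres M (r1, r2) (s1, s2) x) = mres M (r1, r2) (t1, t2) x"
proof -
  have "\<forall>i\<in>intervals S. \<forall>j\<in>intervals S. \<forall>k\<in>intervals S. subinterval j i \<and> subinterval k j \<longrightarrow>
      (\<forall>x\<in>carrier (mring M (fst i) (snd i)). mres M j k (mres M i j x) = mres M i k x)"
    using restrictions unfolding valid_restrictions_def ind_system_def by blast
  from bspec[OF bspec[OF bspec[OF this assms(1)] assms(2)] assms(3)] show ?thesis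
    using assms by (simp add: subinterval_def)
qed

lemma above_mono: "r1 \<le> k \<Longrightarrow> r2 \<in> above S k \<Longrightarrow> r2 \<in> above S r1"
  by (auto simp: above_def)

lemma memb_family_in_Dopen:
  assumes r1: "r1 \<in> radii S" and d: "d \<in> distN0 S"
  shows "memb_family d r1 \<in> carrier (Dopen S M r1)"
proof -
  have "mres M (r1, s) (r1, r) (memb M r1 s d) = memb M r1 r d"
    if "r \<in> above S r1" "s \<in> above S r1" "r \<le> s" for r s
    by (rule mres_memb) (use that r1 d above_interval in auto)
  then show ?thesis
    using memb_closed[OF r1 _ d] by (simp add: Dopen_def proj_lim_def memb_family_def)
qed

lemma Dopen_res_memb_family:
  assumes "r1 \<in> radii S" "k \<in> radii S" "r1 \<le> k" "d \<in> distN0 S"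
  shows "Dopen_res S M r1 k (memb_family d r1) = memb_family d k"
proof
  fix r2
  show "Dopen_res S M r1 k (memb_family d r1) r2 = memb_family d k r2"
  proof (cases "r2 \<in> above S k")
    case True
    have "r2 \<in> above S r1" by (rule above_mono[OF assms(3) True])
    moreover have "mres M (r1, r2) (k, r2) (memb M r1 r2 d) = memb M k r2 d"
      by (rule mres_memb) (use assms True \<open>r2 \<in> above S r1\<close> above_interval in auto)
    ultimately show ?thesis using True by (simp add: Dopen_res_def memb_family_def)
  qed (simp add: Dopen_res_def memb_family_def)
qed

lemma Dopen_res_comp:
  assumes "r1 \<in> radii S" "k \<in> radii S" "k' \<in> radii S" "r1 \<le> k" "k \<le> k'" "z \<in> carrier (Dopen S M r1)"
  shows "Dopen_res S M k k' (Dopen_res S M r1 k z) = Dopen_res S M r1 k' z"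
proof
  fix r2
  show "Dopen_res S M k k' (Dopen_res S M r1 k z) r2 = Dopen_res S M r1 k' z r2"
  proof (cases "r2 \<in> above S k'")
    case True
    have r2: "r2 \<in> above S k" "r2 \<in> above S r1" using above_mono True assms by auto
    have "z r2 \<in> carrier (mring M r1 r2)"
      using assms(6) r2 by (auto simp: Dopen_def proj_lim_def)
    then have "mres M (k, r2) (k', r2) (mres M (r1, r2) (k, r2) (z r2)) = mres M (r1, r2) (k', r2) (z r2)"
      using mres_comp[of r1 r2 k r2 k' r2 "z r2"] above_interval assms r2 True by simp
    then show ?thesis using True r2 by (simp add: Dopen_res_def)
  qed (simp add: Dopen_res_def)
qed

text \<open>The right-hand side does not mention r1, so the class does not depend on the radius.
  This is what makes the description in \<open>R0_incl\<close> well-defined.\<close>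

lemma R0_class_memb_family:
  assumes r1: "r1 \<in> radii S" and d: "d \<in> distN0 S"
  shows "R0_class S M r1 (memb_family d r1) = {(i, z). i \<in> radii S \<and> z \<in> carrier (Dopen S M i)
     \<and> (\<exists>k\<in>radii S. i \<le> k \<and> memb_family d k = Dopen_res S M i k z)}" (is "?L = ?R")
proof (intro equalityI subsetI)
  fix p assume "p \<in> ?L"
  then obtain i z k where "p = (i, z)" "i \<in> radii S" "z \<in> carrier (Dopen S M i)" "k \<in> radii S"
    "r1 \<le> k" "i \<le> k" "Dopen_res S M r1 k (memb_family d r1) = Dopen_res S M i k z"
    unfolding R0_class_def ind_class_def by blast
  then show "p \<in> ?R" using Dopen_res_memb_family[OF r1 _ _ d] by auto
next
  fix p assume "p \<in> ?R"
  then obtain i z k where p: "p = (i, z)" "i \<in> radii S" "z \<in> carrier (Dopen S M i)" "k \<in> radii S"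
    "i \<le> k" "memb_family d k = Dopen_res S M i k z"
    by blast
  \<comment> \<open>Everything is compared at the larger of the two radii, where the restriction
    maps compose.\<close>
  define m where "m = max k r1"
  have m: "m \<in> radii S" "k \<le> m" "r1 \<le> m" "i \<le> m" using p r1 by (auto simp: m_def max_def)
  have "Dopen_res S M i m z = Dopen_res S M k m (memb_family d k)"
    unfolding p(6) by (rule Dopen_res_comp[symmetric]) (use p m in auto)
  also have "\<dots> = memb_family d m" by (rule Dopen_res_memb_family) (use p m d in auto)
  also have "\<dots> = Dopen_res S M r1 m (memb_family d r1)"
    by (rule Dopen_res_memb_family[symmetric]) (use r1 m d in auto)
  finally show "p \<in> ?L" unfolding R0_class_def ind_class_def using p m by auto
qed

lemma R0_incl_eq:
  assumes r1: "r1 \<in> radii S" and d: "d \<in> distN0 S"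
  shows "R0_incl S M d = R0_class S M r1 (memb_family d r1)"
  unfolding R0_incl_def
proof (rule the_equality)
  show "\<exists>r\<in>radii S. R0_class S M r1 (memb_family d r1) = R0_class S M r (\<lambda>r2\<in>above S r. memb M r r2 d)"
    using r1 unfolding memb_family_def by blast
  fix C assume "\<exists>r\<in>radii S. C = R0_class S M r (\<lambda>r2\<in>above S r. memb M r r2 d)"
  then obtain r where r: "r \<in> radii S" "C = R0_class S M r (memb_family d r)"
    unfolding memb_family_def by blast
  show "C = R0_class S M r1 (memb_family d r1)"
    unfolding r(2) R0_class_memb_family[OF r(1) d] R0_class_memb_family[OF r1 d] ..
qed

text \<open>Equality in the inductive limit already holds over some D_[k,r2], into which D_[0,r2]
  embeds.\<close>

lemma R0_incl_inj:
  assumes d: "d \<in> distN0 S" "d' \<in> distN0 S" and eq: "R0_incl S M d = R0_incl S M d'"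
  shows "d = d'"
proof -
  obtain r1 where r1: "r1 \<in> radii S" using radii_nonempty by blast
  have "(r1, memb_family d' r1) \<in> R0_class S M r1 (memb_family d' r1)"
    unfolding R0_class_memb_family[OF r1 d(2)]
    using Dopen_res_memb_family[OF r1 r1 order_refl d(2)] memb_family_in_Dopen[OF r1 d(2)] r1 by auto
  then have "(r1, memb_family d' r1) \<in> R0_class S M r1 (memb_family d r1)"
    using eq by (simp add: R0_incl_eq[OF r1] d)
  then obtain k where k: "k \<in> radii S" "r1 \<le> k" "memb_family d k = Dopen_res S M r1 k (memb_family d' r1)"
    unfolding R0_class_memb_family[OF r1 d(1)] by blast
  obtain r2 where r2: "r2 \<in> above S k" using above_nonempty[OF k(1)] by blast
  have "memb_family d k = memb_family d' k"
    using k(3) Dopen_res_memb_family[OF r1 k(1,2) d(2)] by simp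
  from fun_cong[OF this, of r2] have "memb M k r2 d = memb M k r2 d'"
    using r2 by (simp add: memb_family_def)
  then show ?thesis
    using microloc(3)[OF k(1) r2] distN0_in_Dcompl_above[OF _ r2] d by (auto dest: inj_onD)
qed

text \<open>The zero of \<open>ind_lim\<close> is defined as the set of all representatives that
  become zero. The form of the class without r1 identifies it with the class of the zero
  family.\<close>

lemma R0_incl_zero: "R0_incl S M (\<lambda>_. 0) = \<zero>\<^bsub>R0 S M\<^esub>"
proof -
  obtain r1 where r1: "r1 \<in> radii S" using radii_nonempty by blast
  have zero: "\<zero>\<^bsub>Dopen S M k\<^esub> = memb_family (\<lambda>_. 0) k" if "k \<in> radii S" for k
    using memb_zero[OF that] by (auto simp: Dopen_def proj_lim_def memb_family_def fun_eq_iff)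
  have "\<zero>\<^bsub>R0 S M\<^esub> = {(i, z). i \<in> radii S \<and> z \<in> carrier (Dopen S M i)
     \<and> (\<exists>k\<in>radii S. i \<le> k \<and> Dopen_res S M i k z = \<zero>\<^bsub>Dopen S M k\<^esub>)}"
    by (simp add: R0_def ind_lim_def)
  also have "\<dots> = R0_class S M r1 (memb_family (\<lambda>_. 0) r1)"
    unfolding R0_class_memb_family[OF r1 zero_in_distN0] using zero by auto
  finally show ?thesis using R0_incl_eq[OF r1 zero_in_distN0] by simp
qed

section \<open>The component t = 1 and its map to the inductive limit over
  \<open>Tplus\<close>\<close>

lemma one_in_Tplus: "mat 1 \<in> Tplus S"
  using subgroup.one_closed[OF sub_torus]
  by (auto simp: Tplus_def Tpts_def rational_points_def)

lemma char_val_one: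
  assumes "b \<in> pos_roots S"
  shows "char_val b (mat 1) = 1"
proof -
  have "mat 1 \<in> torusT S" using subgroup.one_closed[OF sub_torus] by simp
  moreover have "b \<in> characters (torusT S)" using assms unfolding pos_roots_def weights_on_def by blast
  ultimately have "b (mat 1) \<noteq> 0" "b (mat 1 ** mat 1) = b (mat 1) * b (mat 1)"
    unfolding characters_def by blast+
  then have "b (mat 1) = 1" by simp
  then show ?thesis by (simp add: char_val_def)
qed

lemma le_alpha_one: "le_alpha S (mat 1) (mat 1)"
  using char_val_one alpha_pos by (simp add: le_alpha_def)

lemma mmax_zero:
  assumes "r1 \<in> radii S" "r2 \<in> above S r1"
  shows "mmax M r1 r2 \<zero>\<^bsub>mring M r1 r2\<^esub> = 0"
proof -
  interpret L: ring "mring M r1 r2" by (rule microloc(1)[OF assms])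
  show ?thesis
    using microloc(5)[OF assms, of r1 "\<zero>\<^bsub>mring M r1 r2\<^esub>"] microloc(5)[OF assms, of r2 "\<zero>\<^bsub>mring M r1 r2\<^esub>"]
    by (simp add: mmax_def)
qed

text \<open>Membership in the closure is witnessed by l = 0 and d itself, with error exactly 0,
  since \<open>push\<close> fixes d. Any starting radius works because b_\<alpha> is fixed by
  \<open>push\<close> too and is invertible in every microlocalization.\<close>

lemma R0_incl_in_R0_t:
  assumes d: "d \<in> distN0 S" and push: "push S (mat 1) d = d"
  shows "R0_incl S M d \<in> carrier (R0_t S M (mat 1))"
proof -
  obtain r1 where r1: "r1 \<in> radii S" using radii_nonempty by blast
  have pa: "push S (mat 1) (bvar (alpha S)) = bvar (alpha S)"
    by (rule push_one[OF alpha_pos bvar_single])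
  have "invertible_radius S M (mat 1) r1"
    unfolding invertible_radius_def pa using r1 microloc(4)[OF r1] by blast
  moreover have "memb_family d r1 r2 \<in> Dclosure S M (mat 1) r1 r2" if r2: "r2 \<in> above S r1" for r2
  proof -
    interpret L: ring "mring M r1 r2" by (rule microloc(1)[OF r1 r2])
    have c: "memb M r1 r2 d \<in> carrier (mring M r1 r2)" by (rule memb_closed[OF r1 r2 d])
    then have "memb M r1 r2 d \<ominus>\<^bsub>mring M r1 r2\<^esub> (x [^]\<^bsub>mring M r1 r2\<^esub> (0::nat)) \<otimes>\<^bsub>mring M r1 r2\<^esub> memb M r1 r2 (push S (mat 1) d)
        = \<zero>\<^bsub>mring M r1 r2\<^esub>" for x
      unfolding push by (simp add: L.r_right_minus_eq)
    then have "\<exists>l::nat. \<exists>d'\<in>distN0 S. mmax M r1 r2 (memb M r1 r2 d \<ominus>\<^bsub>mring M r1 r2\<^esub>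
        (x [^]\<^bsub>mring M r1 r2\<^esub> l) \<otimes>\<^bsub>mring M r1 r2\<^esub> memb M r1 r2 (push S (mat 1) d')) < \<epsilon>" if "\<epsilon> > 0" for x \<epsilon>
      using mmax_zero[OF r1 r2] that d by (intro exI[of _ "0::nat"] bexI[of _ d]) auto
    then show ?thesis using c r2 by (simp add: Dclosure_def Let_def memb_family_def)
  qed
  then have "memb_family d r1 \<in> Dopen_t S M (mat 1) r1"
    using memb_family_in_Dopen[OF r1 d] by (simp add: Dopen_t_def)
  ultimately show ?thesis using R0_incl_eq[OF r1 d] by (auto simp: R0_t_def)
qed

lemma mtrans_inj:
  assumes "k \<in> Tplus S" "le_alpha S (mat 1) k"
  shows "inj_on (mtrans M (mat 1) k) (carrier (R0_t S M (mat 1)))"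
    and "d \<in> distN0 S \<Longrightarrow> mtrans M (mat 1) k (R0_incl S M (push S (mat 1) d)) = R0_incl S M (push S k d)"
proof -
  note V = mp[OF bspec[OF bspec[OF conjunct2[OF transitions[unfolded valid_transitions_def]]
    one_in_Tplus] assms(1)] assms(2)]
  show "inj_on (mtrans M (mat 1) k) (carrier (R0_t S M (mat 1)))" by (rule conjunct1[OF V])
  show "mtrans M (mat 1) k (R0_incl S M (push S (mat 1) d)) = R0_incl S M (push S k d)" if "d \<in> distN0 S"
    by (rule bspec[OF conjunct1[OF conjunct2[OF V]] that])
qed

lemma dist_to_R_in_carrier:
  assumes "d \<in> distN0 S" "push S (mat 1) d = d"
  shows "dist_to_R S M d \<in> carrier (R_N1_ell S M)"
  unfolding dist_to_R_def R0_to_R_def R_N1_ell_def ind_lim_def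
  using R0_incl_in_R0_t[OF assms] one_in_Tplus by (simp, intro exI conjI) (rule refl)

lemma R0_incl_in_dist_to_R:
  assumes "d \<in> distN0 S" "push S (mat 1) d = d"
  shows "(mat 1, R0_incl S M d) \<in> dist_to_R S M d"
  unfolding dist_to_R_def R0_to_R_def ind_class_def
  using R0_incl_in_R0_t[OF assms] one_in_Tplus le_alpha_one by (simp, intro bexI[of _ "mat 1"]) simp_all

lemma dist_to_R_inj:
  assumes d: "d \<in> distN0 S" "push S (mat 1) d = d" and d': "d' \<in> distN0 S" "push S (mat 1) d' = d'"
    and eq: "dist_to_R S M d = dist_to_R S M d'"
  shows "d = d'"
proof -
  have "(mat 1, R0_incl S M d) \<in> dist_to_R S M d'" using R0_incl_in_dist_to_R[OF d] eq by simp
  then obtain k where k: "k \<in> Tplus S" "le_alpha S (mat 1) k"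
    "mtrans M (mat 1) k (R0_incl S M d') = mtrans M (mat 1) k (R0_incl S M d)"
    unfolding dist_to_R_def R0_to_R_def ind_class_def by blast
  then have "R0_incl S M d' = R0_incl S M d"
    using mtrans_inj(1)[OF k(1,2)] R0_incl_in_R0_t d d' by (auto dest: inj_onD)
  then show ?thesis using R0_incl_inj d(1) d'(1) by metis
qed

lemma dist_apply_zero: "dist_apply S (\<lambda>_. 0) f = 0"
  by (simp add: dist_apply_def)

lemma push_zero: "push S t (\<lambda>_. 0) = (\<lambda>_. 0)"
  by (rule ext) (simp add: push_def dist_apply_zero)

text \<open>Being the zero element means becoming 0 in some component k. The zero there is the image
  of the zero distribution, so injectivity of the transition map and of \<open>R0_incl\<close> gives
  d = 0.\<close>

lemma dist_to_R_nonzero: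
  assumes d: "d \<in> distN0 S" "push S (mat 1) d = d" and nz: "d \<noteq> (\<lambda>_. 0)"
  shows "dist_to_R S M d \<noteq> \<zero>\<^bsub>R_N1_ell S M\<^esub>"
proof
  assume "dist_to_R S M d = \<zero>\<^bsub>R_N1_ell S M\<^esub>"
  then have "(mat 1, R0_incl S M d) \<in> \<zero>\<^bsub>R_N1_ell S M\<^esub>" using R0_incl_in_dist_to_R[OF d] by simp
  then obtain k where k: "k \<in> Tplus S" "le_alpha S (mat 1) k"
    "mtrans M (mat 1) k (R0_incl S M d) = \<zero>\<^bsub>R0_t S M k\<^esub>"
    unfolding R_N1_ell_def ind_lim_def by auto
  have "mtrans M (mat 1) k (R0_incl S M (\<lambda>_. 0)) = R0_incl S M (\<lambda>_. 0)"
    using mtrans_inj(2)[OF k(1,2) zero_in_distN0] by (simp add: push_zero)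
  also have "\<dots> = mtrans M (mat 1) k (R0_incl S M d)"
    unfolding k(3) R0_incl_zero by (simp add: R0_t_def)
  finally have "R0_incl S M (\<lambda>_. 0) = R0_incl S M d"
    using mtrans_inj(1)[OF k(1,2)] R0_incl_in_R0_t[OF d] R0_incl_in_R0_t[OF zero_in_distN0 push_zero]
    by (auto dest: inj_onD)
  then show False using R0_incl_inj[OF zero_in_distN0 d(1)] nz by auto
qed

text \<open>d is the constant term of its own expansion: every finite partial sum whose index set
  contains 0 equals d exactly.\<close>

lemma has_expansion_constant:
  assumes r1: "r1 \<in> radii S" and d: "d \<in> distN0 S"
  shows "has_expansion S M r1 (memb_family d r1) (\<lambda>n. if n = 0 then d else (\<lambda>_. 0))"
  unfolding has_expansion_def Let_def
proof (intro ballI allI impI exI[of _ "{0}"] conjI)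
  fix r2 \<epsilon> and F' :: "int set"
  assume r2: "r2 \<in> above S r1" and \<epsilon>: "(0::real) < \<epsilon>" and F': "finite F' \<and> {0} \<subseteq> F'"
  let ?L = "mring M r1 r2"
  let ?e = "memb M r1 r2"
  interpret L: ring ?L by (rule microloc(1)[OF r1 r2])
  have c: "?e d \<in> carrier ?L" by (rule memb_closed[OF r1 r2 d])
  have U: "?e (bvar (alpha S)) \<in> Units ?L" by (rule microloc(4)[OF r1 r2])
  \<comment> \<open>Negative exponents occur as well; these powers lie in the ring because
    b_\<alpha> is a unit, and are then multiplied by 0.\<close>
  have pow: "?e (bvar (alpha S)) [^]\<^bsub>?L\<^esub> n \<in> carrier ?L" for n :: int
    unfolding int_pow_def2 using L.Units_pow_closed[OF U] by (simp only: L.Units_inv_closed L.Units_closed split: if_split) blast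
  have summand: "?e (bvar (alpha S)) [^]\<^bsub>?L\<^esub> n \<otimes>\<^bsub>?L\<^esub> ?e (if n = 0 then d else (\<lambda>_. 0))
      = (if 0 = n then ?e d else \<zero>\<^bsub>?L\<^esub>)" for n :: int
  proof (cases "n = 0")
    case True
    then show ?thesis using c by (simp add: int_pow_def2)
  next
    case False
    then have "?e (bvar (alpha S)) [^]\<^bsub>?L\<^esub> n \<otimes>\<^bsub>?L\<^esub> ?e (if n = 0 then d else (\<lambda>_. 0))
        = ?e (bvar (alpha S)) [^]\<^bsub>?L\<^esub> n \<otimes>\<^bsub>?L\<^esub> \<zero>\<^bsub>?L\<^esub>"
      by (simp only: if_False memb_zero[OF r1 r2])
    also have "\<dots> = \<zero>\<^bsub>?L\<^esub>" by (rule L.r_null[OF pow])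
    finally show ?thesis using False by simp
  qed
  have "finsum ?L (\<lambda>n. if 0 = n then ?e d else \<zero>\<^bsub>?L\<^esub>) F' = ?e d"
    using L.add.finprod_singleton[of 0 F' "\<lambda>_. ?e d"] F' c by simp
  then show "mmax M r1 r2 (memb_family d r1 r2 \<ominus>\<^bsub>?L\<^esub>
      finsum ?L (\<lambda>n. ?e (bvar (alpha S)) [^]\<^bsub>?L\<^esub> n \<otimes>\<^bsub>?L\<^esub> ?e (if n = 0 then d else (\<lambda>_. 0))) F') < \<epsilon>"
    unfolding summand using c r2 \<epsilon> mmax_zero[OF r1 r2] L.r_right_minus_eq[OF c c]
    by (simp add: memb_family_def del: L.r_right_minus_eq)
qed simp

lemma proj_coeff_zero: "proj_coeff S (\<lambda>_. 0) u = 0"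
  by (simp add: proj_coeff_def dist_apply_zero)

text \<open>With the constant expansion, the formula for j on R_0 has only the term n = 0, so the
  value of j is read off from the images of d in all K[N_1/N_k].\<close>

lemma natural_map_kernel:
  assumes j: "natural_map S M j" and d: "d \<in> distN1 S"
    and zero: "\<And>k u. u \<in> N1_mod S k \<Longrightarrow> proj_coeff S d u = 0"
  shows "j (dist_to_R S M d) = \<zero>\<^bsub>R_bb_N1_ell S\<^esub>"
proof -
  obtain r1 where r1: "r1 \<in> radii S" using radii_nonempty by blast
  have d0: "d \<in> distN0 S" using d distN1_subset by blast
  let ?f = "\<lambda>n :: int. if n = 0 then d else (\<lambda>_. 0)"
  have nat: "j (R0_to_R S M (R0_class S M r1 y)) = (\<lambda>k\<in>{1..}. \<lambda>u\<in>N1_mod S k. \<lambda>n. proj_coeff S (f n) u)"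
    if "y \<in> carrier (Dopen S M r1)" "\<forall>n. f n \<in> distN1 S" "has_expansion S M r1 y f" for y f
    using j r1 that unfolding natural_map_def by blast
  have "\<forall>n. ?f n \<in> distN1 S" using d zero_in_distN1 by auto
  then have "j (R0_to_R S M (R0_class S M r1 (memb_family d r1))) =
      (\<lambda>k\<in>{1..}. \<lambda>u\<in>N1_mod S k. \<lambda>n. proj_coeff S (?f n) u)"
    by (intro nat[OF memb_family_in_Dopen[OF r1 d0]] has_expansion_constant[OF r1 d0])
  also have "\<dots> = (\<lambda>k\<in>{1..}. \<lambda>u\<in>N1_mod S k. \<lambda>n. 0)"
    using zero by (intro restrict_ext ext) (auto simp: proj_coeff_zero)
  also have "\<dots> = \<zero>\<^bsub>R_bb_N1_ell S\<^esub>"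
    by (simp add: R_bb_N1_ell_def proj_lim_def robba_N1_def robba_def Let_def)
  finally show ?thesis by (simp add: dist_to_R_def R0_incl_eq[OF r1 d0])
qed

end

theorem mainTheorem8:
  fixes S :: "('q::nonarch_field, 'k::nonarch_field, 'n::finite) setting"
    and M :: "('q, 'k, 'n, 'a) microloc"
    and j :: "(('q, 'n) mat \<times> 'a R0elt) set \<Rightarrow> nat \<Rightarrow> ('q, 'n) mat set \<Rightarrow> int \<Rightarrow> 'k"
  assumes "valid_setting S"
    and "valid_microloc S M"
    and "natural_map S M j"
  shows "(\<forall>\<beta>\<in>pos_roots S - {alpha S}.
            log_gen \<beta> \<in> distN1 S
            \<and> dist_to_R S M (log_gen \<beta>) \<in> a_kernel (R_N1_ell S M) (R_bb_N1_ell S) j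
            \<and> dist_to_R S M (log_gen \<beta>) \<noteq> \<zero>\<^bsub>R_N1_ell S M\<^esub>)
         \<and> (pos_roots S \<noteq> {alpha S} \<longrightarrow> \<not> inj_on j (carrier (R_N1_ell S M)))"
proof -
  interpret valid_microloc_loc S M
    using assms(1,2) by unfold_locales
  have log: "log_gen \<beta> \<in> distN1 S" "log_gen \<beta> \<in> distN0 S" "push S (mat 1) (log_gen \<beta>) = log_gen \<beta>"
    "j (dist_to_R S M (log_gen \<beta>)) = \<zero>\<^bsub>R_bb_N1_ell S\<^esub>" if "\<beta> \<in> pos_roots S" "\<beta> \<noteq> alpha S" for \<beta>
  proof -
    show N1: "log_gen \<beta> \<in> distN1 S" by (rule log_gen_in_distN1[OF that])
    then show "log_gen \<beta> \<in> distN0 S" using distN1_subset by blast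
    show "push S (mat 1) (log_gen \<beta>) = log_gen \<beta>" by (rule push_one[OF that(1) log_gen_single])
    show "j (dist_to_R S M (log_gen \<beta>)) = \<zero>\<^bsub>R_bb_N1_ell S\<^esub>"
      by (rule natural_map_kernel[OF assms(3) N1 proj_coeff_log_gen[OF that]])
  qed
  \<comment> \<open>The zero distribution serves as the second point of the same fibre of j. If the
    two classes coincided, \<open>dist_to_R_inj\<close> would force the logarithm series to
    vanish.\<close>
  have zero: "j (dist_to_R S M (\<lambda>_. 0)) = \<zero>\<^bsub>R_bb_N1_ell S\<^esub>"
    by (rule natural_map_kernel[OF assms(3) zero_in_distN1 proj_coeff_zero])
  have "\<not> inj_on j (carrier (R_N1_ell S M))" if other: "pos_roots S \<noteq> {alpha S}"
  proof
    assume inj: "inj_on j (carrier (R_N1_ell S M))"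
    obtain \<beta> where \<beta>: "\<beta> \<in> pos_roots S" "\<beta> \<noteq> alpha S" using other alpha_pos by blast
    have "dist_to_R S M (log_gen \<beta>) = dist_to_R S M (\<lambda>_. 0)"
    proof (rule inj_onD[OF inj])
      show "j (dist_to_R S M (log_gen \<beta>)) = j (dist_to_R S M (\<lambda>_. 0))"
        using log(4)[OF \<beta>] zero by simp
    qed (rule dist_to_R_in_carrier[OF log(2,3)[OF \<beta>]] dist_to_R_in_carrier[OF zero_in_distN0 push_zero])+
    then have "log_gen \<beta> = (\<lambda>_. 0 :: 'k)"
      by (rule dist_to_R_inj[OF log(2,3)[OF \<beta>] zero_in_distN0 push_zero])
    then show False by (rule notE[OF log_gen_nonzero])
  qed
  moreover have "dist_to_R S M (log_gen \<beta>) \<in> a_kernel (R_N1_ell S M) (R_bb_N1_ell S) j"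
    if \<beta>: "\<beta> \<in> pos_roots S" "\<beta> \<noteq> alpha S" for \<beta>
    using log(4)[OF \<beta>] dist_to_R_in_carrier[OF log(2,3)[OF \<beta>]] by (simp add: a_kernel_def')
  moreover have "dist_to_R S M (log_gen \<beta>) \<noteq> \<zero>\<^bsub>R_N1_ell S M\<^esub>"
    if \<beta>: "\<beta> \<in> pos_roots S" "\<beta> \<noteq> alpha S" for \<beta>
    by (rule dist_to_R_nonzero[OF log(2,3)[OF \<beta>] log_gen_nonzero])
  ultimately show ?thesis using log(1) by simp
qed

end
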